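(* Let $\mathbb{k}\in\{\mathbb{R},\mathbb{C}\}$. The tensor products $\otimes^2_w$ on $\mathsf{TVS}_w$ and $\otimes^2_m$ on $\mathsf{TVS}_m$ satisfy $$V\otimes^2_wW\cong\bigl(L((W')_\sigma,V),\,\sigma(L((W')_\sigma,V),\,W'\otimes_{\mathbb{k}}V')\bigr),\qquad V,W\in\mathsf{TVS}_w,$$ $$V\otimes^2_mW\cong\bigl(L((W')_\tau,V),\,\tau(L((W')_\tau,V),\,W'\otimes_{\mathbb{k}}V')\bigr),\qquad V,W\in\mathsf{TVS}_m.$$ Here $L(U,V)$ denotes the space of continuous linear maps $U\to V$, $(W')_\sigma=(W',\sigma(W',W))$, $(W')_\tau=(W',\tau(W',W))$, and the pairings are $\langle f,w'\otimes v'\rangle=v'(f(w'))$.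
   Context: $\mathsf{TVS}$ is the category of Hausdorff locally convex topological $\mathbb{k}$-vector spaces and continuous linear maps; $V'$ is the space of continuous linear functionals on $V$. $\mathsf{chu}$ is the category of triples $(V,W,\langle-,-\rangle)$ with $V,W$ vector spaces and $\langle-,-\rangle: V\otimes_{\mathbb{k}}W\to\mathbb{k}$ linear such that both $V\to W^\star$ and $W\to V^\star$ are injective; a morphism $(V_1,W_1)\to(V_2,W_2)$ is a pair of linear maps $f: V_1\to V_2$, $g: W_2\to W_1$ with $\langle f(v),w\rangle_2=\langle v,g(w)\rangle_1$. The duality is $(V,W,\langle-,-\rangle)^\star=(W,V,\langle-,-\rangle)$ (arguments swapped). The internal hom is $\underline{\mathrm{Hom}}((V_1,W_1),(V_2,W_2))=(\mathrm{Hom}_{\mathsf{chu}}((V_1,W_1),(V_2,W_2)),\,V_1\otimes_{\mathbb{k}}W_2)$ with pairing $\langle(f,g),v\otimes w\rangle=\langle f(v),w\rangle_2$. For a pair $(V,W)\in\mathsf{chu}$, a dual topology on $V$ is a Hausdorff locally convex topology for which $W\to V^\star$ induces an isomorphism of $W$ onto the topological dual; $\sigma(V,W)$ is the weakest and $\tau(V,W)$ the strongest dual topology. $\mathsf{TVS}_w$ (resp. $\mathsf{TVS}_m$) is the full subcategory of $\mathsf{TVS}$ of spaces whose topology is $\sigma(V,V')$ (resp. $\tau(V,V')$). $T_w,T_m$ send $V$ to $(V,V',\mathrm{eval})$; $R:\mathsf{chu}\to\mathsf{TVS}_w$ and $\mathcal{L}:\mathsf{chu}\to\mathsf{TVS}_m$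 send $(V,W)$ to $(V,\sigma(V,W))$ and $(V,\tau(V,W))$. Set $\underline{\mathrm{Hom}}_w(V,W)=R(\underline{\mathrm{Hom}}(T_wV,T_wW))$, $D_w(V)=R((T_wV)^\star)$ (a contravariant self-equivalence with quasi-inverse $D_w^{-1}\cong D_w$), $V\otimes^1_wW=D_w(\underline{\mathrm{Hom}}_w(V,D_w(W)))$ and $V\otimes^2_wW=D_w^{-1}(D_w(W)\otimes^1_wD_w(V))$; and $\underline{\mathrm{Hom}}_m$, $D_m$, $\otimes^1_m$, $\otimes^2_m$ analogously with $\mathcal{L},T_m$ in place of $R,T_w$. *)

theory Defs
  imports "HOL-Analysis.Analysis" "HOL-Library.Function_Algebras"
begin

section \<open>Vector spaces\<close>

text \<open>
  A vector space over \<open>'k\<close> is a linear subspace \<open>car\<close> of an ambient vector space, which is an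
  additive group type together with a scalar multiplication.  An arbitrary vector space is the
  case \<open>car = UNIV\<close>; subspaces are needed because dual spaces, spaces of linear maps and tensor
  products are subspaces of function types.

  A map defined on \<open>car V\<close> is represented by the total function that is \<open>0\<close> outside \<open>car V\<close>, so
  that equality of maps is equality of functions and the sum of maps is the pointwise sum of
  \<^theory>\<open>HOL-Library.Function_Algebras\<close>.
\<close>

record ('k, 'v) vspace =
  car :: "'v set"
  scl :: "'k \<Rightarrow> 'v \<Rightarrow> 'v"

definition is_vspace :: "('k::real_normed_field, 'v::ab_group_add) vspace \<Rightarrow> bool" where
  "is_vspace V \<longleftrightarrow> vector_space (scl V) \<and> module.subspace (scl V) (car V)"

definition ground :: "('k::real_normed_field, 'k) vspace" where
  "ground = \<lparr>car = UNIV, scl = (*)\<rparr>"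

definition lin_maps ::
  "('k::real_normed_field, 'v::ab_group_add) vspace \<Rightarrow> ('k, 'w::ab_group_add) vspace \<Rightarrow> ('v \<Rightarrow> 'w) set"
where
  "lin_maps V W = {f.
     (\<forall>x\<in>car V. f x \<in> car W) \<and>
     (\<forall>x\<in>car V. \<forall>y\<in>car V. f (x + y) = f x + f y) \<and>
     (\<forall>c. \<forall>x\<in>car V. f (scl V c x) = scl W c (f x)) \<and>
     (\<forall>x. x \<notin> car V \<longrightarrow> f x = 0)}"

definition hom_space ::
  "('k::real_normed_field, 'v::ab_group_add) vspace \<Rightarrow> ('k, 'w::ab_group_add) vspace
    \<Rightarrow> ('k, 'v \<Rightarrow> 'w) vspace" where
  "hom_space V W = \<lparr>car = lin_maps V W, scl = (\<lambda>c f x. scl W c (f x))\<rparr>"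

abbreviation alg_dual ::
  "('k::real_normed_field, 'v::ab_group_add) vspace \<Rightarrow> ('k, 'v \<Rightarrow> 'k) vspace" where
  "alg_dual V \<equiv> hom_space V ground"

text \<open>Bilinear maps \<open>V \<times> W \<rightarrow> U\<close>, curried, are the linear maps \<open>V \<rightarrow> Hom(W, U)\<close>.\<close>

abbreviation bil_maps where
  "bil_maps V W U \<equiv> lin_maps V (hom_space W U)"

definition on_carriers ::
  "('k::real_normed_field, 'v::ab_group_add) vspace \<Rightarrow> ('k, 'w::ab_group_add) vspace
    \<Rightarrow> ('v \<Rightarrow> 'w \<Rightarrow> 'k) \<Rightarrow> ('v \<Rightarrow> 'w \<Rightarrow> 'k)" where
  "on_carriers V W b = (\<lambda>v w. if v \<in> car V \<and> w \<in> car W then b v w else 0)"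


section \<open>The algebraic tensor product\<close>

text \<open>
  Over a field the canonical map from \<open>V \<otimes> W\<close> to the dual of the space of bilinear forms on
  \<open>V \<times> W\<close> is injective.  The tensor product is taken to be its image, the span of the
  evaluations \<open>v \<otimes> w = (B \<mapsto> B v w)\<close>.  The universal property is proved below
  (\<open>tensor_universal\<close>).
\<close>

definition pure_tensor ::
  "('k::real_normed_field, 'v::ab_group_add) vspace \<Rightarrow> ('k, 'w::ab_group_add) vspace
    \<Rightarrow> 'v \<Rightarrow> 'w \<Rightarrow> ('v \<Rightarrow> 'w \<Rightarrow> 'k) \<Rightarrow> 'k" where
  "pure_tensor V W v w = (\<lambda>B. if B \<in> bil_maps V W ground then B v w else 0)"

definition tensor ::
  "('k::real_normed_field, 'v::ab_group_add) vspace \<Rightarrow> ('k, 'w::ab_group_add) vspace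
    \<Rightarrow> ('k, ('v \<Rightarrow> 'w \<Rightarrow> 'k) \<Rightarrow> 'k) vspace" where
  "tensor V W =
    \<lparr>car = module.span (\<lambda>c t B. c * t B) {pure_tensor V W v w |v w. v \<in> car V \<and> w \<in> car W},
     scl = (\<lambda>c t B. c * t B)\<rparr>"

text \<open>
  The linear functional on \<open>V \<otimes> W\<close> induced by a bilinear form \<open>b\<close>: it maps \<open>v \<otimes> w\<close> to \<open>b v w\<close>.
\<close>

definition tensor_eval ::
  "('k::real_normed_field, 'v::ab_group_add) vspace \<Rightarrow> ('k, 'w::ab_group_add) vspace
    \<Rightarrow> ('v \<Rightarrow> 'w \<Rightarrow> 'k) \<Rightarrow> (('v \<Rightarrow> 'w \<Rightarrow> 'k) \<Rightarrow> 'k) \<Rightarrow> 'k" where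
  "tensor_eval V W b t = t (on_carriers V W b)"

lemma tensor_eval_pure:
  assumes "on_carriers V W b \<in> bil_maps V W ground" "v \<in> car V" "w \<in> car W"
  shows "tensor_eval V W b (pure_tensor V W v w) = b v w"
  using assms by (simp add: tensor_eval_def pure_tensor_def on_carriers_def)

lemma tensor_universal:
  fixes V :: "('k::real_normed_field, 'v::ab_group_add) vspace"
    and W :: "('k, 'w::ab_group_add) vspace" and U :: "('k, 'u::ab_group_add) vspace"
  assumes U: "is_vspace U" and b: "b \<in> bil_maps V W U"
  shows "\<exists>!\<phi>. \<phi> \<in> lin_maps (tensor V W) U \<and>
           (\<forall>v\<in>car V. \<forall>w\<in>car W. \<phi> (pure_tensor V W v w) = b v w)"
proof -
  define s :: "'k \<Rightarrow> (('v \<Rightarrow> 'w \<Rightarrow> 'k) \<Rightarrow> 'k) \<Rightarrow> (('v \<Rightarrow> 'w \<Rightarrow> 'k) \<Rightarrow> 'k)" where "s = (\<lambda>c t B. c * t B)"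
  define G where "G = {pure_tensor V W v w |v w. v \<in> car V \<and> w \<in> car W}"
  interpret S: vector_space s
    by unfold_locales (auto simp: s_def fun_eq_iff algebra_simps)
  interpret SU: vector_space "scl U" using U by (simp add: is_vspace_def)
  have subU: "SU.subspace (car U)" using U by (simp add: is_vspace_def)
  have car_T: "car (tensor V W) = S.span G" and scl_T: "scl (tensor V W) = s"
    by (simp_all add: tensor_def s_def G_def)
  define p :: "'k \<Rightarrow> (('v \<Rightarrow> 'w \<Rightarrow> 'k) \<Rightarrow> 'k) \<times> 'u \<Rightarrow> (('v \<Rightarrow> 'w \<Rightarrow> 'k) \<Rightarrow> 'k) \<times> 'u"
    where "p = (\<lambda>c (t, u). (s c t, scl U c u))"
  interpret P: vector_space p
    by unfold_locales (auto simp: p_def S.scale_right_distrib S.scale_left_distrib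
        SU.scale_right_distrib SU.scale_left_distrib)
  have p: "p c (t, u) = (s c t, scl U c u)" for c t u by (simp add: p_def)
  define H where "H = {(pure_tensor V W v w, b v w) |v w. v \<in> car V \<and> w \<in> car W}"
  have bU: "b v w \<in> car U" if "v \<in> car V" "w \<in> car W" for v w
    using b that by (auto simp: lin_maps_def hom_space_def)
  have ev: "l u = t (\<lambda>v w. l (b v w))"
    if l: "Vector_Spaces.linear (scl U) (*) l" and "(t, u) \<in> P.span H" for l t u
  proof -
    from l have add: "l (x + y) = l x + l y" and sc: "l (scl U c x) = c * l x" for x y c
      by (auto simp: Vector_Spaces.linear_iff)
    have l0: "l 0 = 0" using sc[of 0 0] by simp
    have lb: "(\<lambda>v w. l (b v w)) \<in> bil_maps V W ground"
      using b by (auto simp: lin_maps_def hom_space_def ground_def fun_eq_iff add sc l0)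
    have "case x of (t, u) \<Rightarrow> l u = t (\<lambda>v w. l (b v w))" if "x \<in> P.span H" for x
      using that
    proof (induction rule: P.span_induct)
      case base
      show ?case
        unfolding P.subspace_def by (auto simp: p add sc l0 zero_prod_def) (simp add: s_def)
    next
      case (step x)
      then show ?case using lb by (auto simp: H_def pure_tensor_def)
    qed
    with that show ?thesis by blast
  qed
  have sep: "u = 0" if "(0, u) \<in> P.span H" for u
  proof (rule ccontr)
    assume "u \<noteq> 0"
    interpret K: vector_space "(*) :: 'k \<Rightarrow> 'k \<Rightarrow> 'k"
      by unfold_locales (auto simp: algebra_simps)
    interpret UK: vector_space_pair "scl U" "(*) :: 'k \<Rightarrow> 'k \<Rightarrow> 'k" ..
    have "SU.independent {u}" using \<open>u \<noteq> 0\<close> by simp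
    from UK.linear_independent_extend[OF this, of "\<lambda>_. 1"]
    obtain l where "Vector_Spaces.linear (scl U) (*) l" "l u = 1" by auto
    with ev[OF _ that] show False by (metis zero_fun_apply zero_neq_one)
  qed
  have uniq: "u = u'" if "(t, u) \<in> P.span H" "(t, u') \<in> P.span H" for t u u'
    using sep[of "u - u'"] P.span_diff[OF that] by simp
  have ex: "\<exists>u. (t, u) \<in> P.span H" if "t \<in> S.span G" for t
    using that
  proof (induction rule: S.span_induct)
    case base
    show ?case
    proof (rule S.subspaceI; clarsimp)
      show "\<exists>u. (0, u) \<in> P.span H" using P.span_zero[of H] by (auto simp: zero_prod_def)
      show "\<exists>u. (x + y, u) \<in> P.span H" if "(x, u) \<in> P.span H" "(y, v) \<in> P.span H" for x u y v
        using P.span_add[OF that] by auto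
      show "\<exists>u. (s c x, u) \<in> P.span H" if "(x, u) \<in> P.span H" for c x u
        using P.span_scale[OF that, of c] by (auto simp: p)
    qed
  next
    case (step t)
    then obtain v w where "(t, b v w) \<in> H" by (auto simp: G_def H_def)
    then have "(t, b v w) \<in> P.span H" by (rule P.span_base)
    then show ?case by blast
  qed
  have rng: "x \<in> S.span G \<times> car U" if "x \<in> P.span H" for x
    using that
  proof (induction rule: P.span_induct)
    case base
    show ?case using subU unfolding P.subspace_def
      by (auto simp: p zero_prod_def S.span_zero S.span_add S.span_scale
          SU.subspace_def)
  next
    case (step x)
    then show ?case using bU by (auto simp: H_def G_def intro!: S.span_base)
  qed
  define \<phi> where "\<phi> t = (if t \<in> S.span G then THE u. (t, u) \<in> P.span H else 0)" for t
  have \<phi>: "\<phi> t = u" if "(t, u) \<in> P.span H" for t u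
  proof -
    have "(THE u. (t, u) \<in> P.span H) = u" using that uniq by (blast intro: the_equality)
    then show ?thesis using rng[OF that] by (simp add: \<phi>_def)
  qed
  have gr: "(t, \<phi> t) \<in> P.span H" if "t \<in> S.span G" for t
    using ex[OF that] \<phi> by metis
  show ?thesis
  proof (rule ex1I)
    have "\<phi> t \<in> car U" if "t \<in> S.span G" for t using rng[OF gr[OF that]] by simp
    moreover have "\<phi> (t + t') = \<phi> t + \<phi> t'" if "t \<in> S.span G" "t' \<in> S.span G" for t t'
      using P.span_add[OF gr[OF that(1)] gr[OF that(2)]] by (auto intro: \<phi>)
    moreover have "\<phi> (s c t) = scl U c (\<phi> t)" if "t \<in> S.span G" for c t
      using P.span_scale[OF gr[OF that], of c] by (auto intro: \<phi> simp: p)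
    ultimately have "\<phi> \<in> lin_maps (tensor V W) U"
      by (auto simp: lin_maps_def car_T scl_T \<phi>_def)
    moreover have "\<phi> (pure_tensor V W v w) = b v w" if "v \<in> car V" "w \<in> car W" for v w
    proof -
      have "(pure_tensor V W v w, b v w) \<in> H" using that by (auto simp: H_def)
      then show ?thesis by (intro \<phi> P.span_base)
    qed
    ultimately show "\<phi> \<in> lin_maps (tensor V W) U \<and>
        (\<forall>v\<in>car V. \<forall>w\<in>car W. \<phi> (pure_tensor V W v w) = b v w)" by blast
  next
    fix \<psi> assume \<psi>: "\<psi> \<in> lin_maps (tensor V W) U \<and>
        (\<forall>v\<in>car V. \<forall>w\<in>car W. \<psi> (pure_tensor V W v w) = b v w)"
    have mem: "t \<in> S.span G \<and> (t, \<psi> t) \<in> P.span H" if "t \<in> S.span G" for t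
      using that
    proof (induction rule: S.span_induct_alt)
      case base
      have "\<psi> 0 = 0" using \<psi> S.span_zero[of G]
        by (auto simp: lin_maps_def car_T scl_T) (metis S.scale_zero_left SU.scale_zero_left)
      then show ?case using P.span_zero[of H] S.span_zero[of G] unfolding zero_prod_def by metis
    next
      case (step c x t)
      then obtain v w where vw: "x = pure_tensor V W v w" "v \<in> car V" "w \<in> car W"
        by (auto simp: G_def)
      have "(x, \<psi> x) \<in> H" using vw \<psi> by (auto simp: H_def)
      then have x: "(x, \<psi> x) \<in> P.span H" by (rule P.span_base)
      have xG: "x \<in> S.span G" using step by (auto intro: S.span_base)
      have "\<psi> (s c x + t) = scl U c (\<psi> x) + \<psi> t"
        using \<psi> xG step S.span_scale[OF xG, of c] by (auto simp: lin_maps_def car_T scl_T)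
      moreover have "s c x + t \<in> S.span G" using step S.span_add[OF S.span_scale[OF xG, of c]] by blast
      moreover have "(s c x + t, scl U c (\<psi> x) + \<psi> t) \<in> P.span H"
        using P.span_add[OF P.span_scale[OF x, of c], of "(t, \<psi> t)"] step by (simp add: p)
      ultimately show ?case by metis
    qed
    show "\<psi> = \<phi>"
    proof
      fix t show "\<psi> t = \<phi> t"
      proof (cases "t \<in> S.span G")
        case True
        with mem show ?thesis by (metis \<phi>)
      next
        case False
        with \<psi> show ?thesis by (auto simp: lin_maps_def car_T \<phi>_def)
      qed
    qed
  qed
qed


section \<open>Hausdorff locally convex spaces\<close>

record ('k, 'v) tvs =
  und :: "('k, 'v) vspace"
  topol :: "'v topology"

definition convex_in :: "('k::real_normed_field, 'v::ab_group_add) vspace \<Rightarrow> 'v set \<Rightarrow> bool" where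
  "convex_in V S \<longleftrightarrow>
     (\<forall>x\<in>S. \<forall>y\<in>S. \<forall>a b :: real. 0 \<le> a \<longrightarrow> 0 \<le> b \<longrightarrow> a + b = 1 \<longrightarrow>
        scl V (of_real a) x + scl V (of_real b) y \<in> S)"

definition is_TVS :: "('k::real_normed_field, 'v::ab_group_add) tvs \<Rightarrow> bool" where
  "is_TVS X \<longleftrightarrow>
     is_vspace (und X) \<and>
     topspace (topol X) = car (und X) \<and>
     continuous_map (prod_topology (topol X) (topol X)) (topol X) (\<lambda>(x, y). x + y) \<and>
     continuous_map (prod_topology euclidean (topol X)) (topol X) (\<lambda>(c, x). scl (und X) c x) \<and>
     Hausdorff_space (topol X) \<and>
     neighbourhood_base_at 0 (convex_in (und X)) (topol X)"

definition ground_tvs :: "('k::real_normed_field, 'k) tvs" where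
  "ground_tvs = \<lparr>und = ground, topol = euclidean\<rparr>"

definition cont_lin ::
  "('k::real_normed_field, 'v::ab_group_add) tvs \<Rightarrow> ('k, 'w::ab_group_add) tvs
    \<Rightarrow> ('k, 'v \<Rightarrow> 'w) vspace" where
  "cont_lin X Y =
    \<lparr>car = {f \<in> lin_maps (und X) (und Y). continuous_map (topol X) (topol Y) f},
     scl = (\<lambda>c f x. scl (und Y) c (f x))\<rparr>"

abbreviation top_dual :: "('k::real_normed_field, 'v::ab_group_add) tvs \<Rightarrow> ('k, 'v \<Rightarrow> 'k) vspace" where
  "top_dual X \<equiv> cont_lin X ground_tvs"

definition tvs_iso ::
  "('k::real_normed_field, 'v::ab_group_add) tvs \<Rightarrow> ('k, 'w::ab_group_add) tvs \<Rightarrow> bool" where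
  "tvs_iso X Y \<longleftrightarrow>
     (\<exists>f\<in>car (cont_lin X Y). \<exists>g\<in>car (cont_lin Y X).
        (\<forall>x\<in>car (und X). g (f x) = x) \<and> (\<forall>y\<in>car (und Y). f (g y) = y))"


section \<open>The category chu\<close>

text \<open>
  The pairing \<open>V \<otimes> W \<rightarrow> k\<close> is given as a bilinear form.  In curried form \<open>p\<close> it is itself the
  map \<open>V \<rightarrow> W\<^sup>\<star>\<close>, and \<open>\<lambda>w v. p v w\<close> is the map \<open>W \<rightarrow> V\<^sup>\<star>\<close>.
\<close>

record ('k, 'v, 'w) chu =
  lft :: "('k, 'v) vspace"
  rgt :: "('k, 'w) vspace"
  pairing :: "'v \<Rightarrow> 'w \<Rightarrow> 'k"

definition is_chu :: "('k::real_normed_field, 'v::ab_group_add, 'w::ab_group_add) chu \<Rightarrow> bool" where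
  "is_chu A \<longleftrightarrow>
     is_vspace (lft A) \<and> is_vspace (rgt A) \<and>
     pairing A \<in> bil_maps (lft A) (rgt A) ground \<and>
     inj_on (pairing A) (car (lft A)) \<and>
     inj_on (\<lambda>w v. pairing A v w) (car (rgt A))"

definition chu_hom ::
  "('k::real_normed_field, 'v1::ab_group_add, 'w1::ab_group_add) chu
    \<Rightarrow> ('k, 'v2::ab_group_add, 'w2::ab_group_add) chu \<Rightarrow> (('v1 \<Rightarrow> 'v2) \<times> ('w2 \<Rightarrow> 'w1)) set" where
  "chu_hom A B = {(f, g).
     f \<in> lin_maps (lft A) (lft B) \<and> g \<in> lin_maps (rgt B) (rgt A) \<and>
     (\<forall>v\<in>car (lft A). \<forall>w\<in>car (rgt B). pairing B (f v) w = pairing A v (g w))}"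

definition chu_hom_space ::
  "('k::real_normed_field, 'v1::ab_group_add, 'w1::ab_group_add) chu
    \<Rightarrow> ('k, 'v2::ab_group_add, 'w2::ab_group_add) chu
    \<Rightarrow> ('k, ('v1 \<Rightarrow> 'v2) \<times> ('w2 \<Rightarrow> 'w1)) vspace" where
  "chu_hom_space A B =
    \<lparr>car = chu_hom A B,
     scl = (\<lambda>c (f, g). (\<lambda>v. scl (lft B) c (f v), \<lambda>w. scl (rgt A) c (g w)))\<rparr>"

definition chu_dual ::
  "('k::real_normed_field, 'v::ab_group_add, 'w::ab_group_add) chu \<Rightarrow> ('k, 'w, 'v) chu" where
  "chu_dual A = \<lparr>lft = rgt A, rgt = lft A, pairing = (\<lambda>w v. pairing A v w)\<rparr>"

definition chu_ihom ::
  "('k::real_normed_field, 'v1::ab_group_add, 'w1::ab_group_add) chu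
    \<Rightarrow> ('k, 'v2::ab_group_add, 'w2::ab_group_add) chu
    \<Rightarrow> ('k, ('v1 \<Rightarrow> 'v2) \<times> ('w2 \<Rightarrow> 'w1), ('v1 \<Rightarrow> 'w2 \<Rightarrow> 'k) \<Rightarrow> 'k) chu" where
  "chu_ihom A B =
    \<lparr>lft = chu_hom_space A B,
     rgt = tensor (lft A) (rgt B),
     pairing = on_carriers (chu_hom_space A B) (tensor (lft A) (rgt B))
       (\<lambda>(f, g). tensor_eval (lft A) (rgt B) (\<lambda>v w. pairing B (f v) w))\<rparr>"


section \<open>Dual topologies\<close>

definition dual_topology ::
  "('k::real_normed_field, 'v::ab_group_add, 'w::ab_group_add) chu \<Rightarrow> 'v topology \<Rightarrow> bool" where
  "dual_topology A T \<longleftrightarrow>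
     is_chu A \<and>
     is_TVS \<lparr>und = lft A, topol = T\<rparr> \<and>
     bij_betw (\<lambda>w v. pairing A v w) (car (rgt A)) (car (top_dual \<lparr>und = lft A, topol = T\<rparr>))"

definition weaker_topology :: "'v topology \<Rightarrow> 'v topology \<Rightarrow> bool" where
  "weaker_topology S T \<longleftrightarrow> (\<forall>U. openin S U \<longrightarrow> openin T U)"

definition sigma_top ::
  "('k::real_normed_field, 'v::ab_group_add, 'w::ab_group_add) chu \<Rightarrow> 'v topology" where
  "sigma_top A =
    (THE S. dual_topology A S \<and> (\<forall>T. dual_topology A T \<longrightarrow> weaker_topology S T))"

definition tau_top ::
  "('k::real_normed_field, 'v::ab_group_add, 'w::ab_group_add) chu \<Rightarrow> 'v topology" where
  "tau_top A =
    (THE S. dual_topology A S \<and> (\<forall>T. dual_topology A T \<longrightarrow> weaker_topology T S))"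

text \<open>\<open>R\<close> and \<open>\<L>\<close> on objects.\<close>

definition weak_space ::
  "('k::real_normed_field, 'v::ab_group_add, 'w::ab_group_add) chu \<Rightarrow> ('k, 'v) tvs" where
  "weak_space A = \<lparr>und = lft A, topol = sigma_top A\<rparr>"

definition mackey_space ::
  "('k::real_normed_field, 'v::ab_group_add, 'w::ab_group_add) chu \<Rightarrow> ('k, 'v) tvs" where
  "mackey_space A = \<lparr>und = lft A, topol = tau_top A\<rparr>"

text \<open>The common formula \<open>(V, V', eval)\<close> for \<open>T\<^sub>w\<close> and \<open>T\<^sub>m\<close>.\<close>

definition chu_of :: "('k::real_normed_field, 'v::ab_group_add) tvs \<Rightarrow> ('k, 'v, 'v \<Rightarrow> 'k) chu" where
  "chu_of X =
    \<lparr>lft = und X, rgt = top_dual X,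
     pairing = on_carriers (und X) (top_dual X) (\<lambda>v v'. v' v)\<rparr>"

definition is_TVSw :: "('k::real_normed_field, 'v::ab_group_add) tvs \<Rightarrow> bool" where
  "is_TVSw X \<longleftrightarrow> is_TVS X \<and> topol X = sigma_top (chu_of X)"

definition is_TVSm :: "('k::real_normed_field, 'v::ab_group_add) tvs \<Rightarrow> bool" where
  "is_TVSm X \<longleftrightarrow> is_TVS X \<and> topol X = tau_top (chu_of X)"

definition iso_w ::
  "('k::real_normed_field, 'v::ab_group_add) tvs \<Rightarrow> ('k, 'w::ab_group_add) tvs \<Rightarrow> bool"
  (infix \<open>\<cong>\<^sub>w\<close> 50) where
  "X \<cong>\<^sub>w Y \<longleftrightarrow> is_TVSw X \<and> is_TVSw Y \<and> tvs_iso X Y"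

definition iso_m ::
  "('k::real_normed_field, 'v::ab_group_add) tvs \<Rightarrow> ('k, 'w::ab_group_add) tvs \<Rightarrow> bool"
  (infix \<open>\<cong>\<^sub>m\<close> 50) where
  "X \<cong>\<^sub>m Y \<longleftrightarrow> is_TVSm X \<and> is_TVSm Y \<and> tvs_iso X Y"


section \<open>Internal hom, duality and tensor products\<close>

definition hom_w where
  "hom_w X Y = weak_space (chu_ihom (chu_of X) (chu_of Y))"

definition D_w where
  "D_w X = weak_space (chu_dual (chu_of X))"

definition tensor1_w (infixl \<open>\<otimes>\<^sup>1\<^sub>w\<close> 70) where
  "X \<otimes>\<^sup>1\<^sub>w Y = D_w (hom_w X (D_w Y))"

text \<open>The outer \<open>D_w\<close> is used as the quasi-inverse of \<open>D_w\<close>.\<close>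

definition tensor2_w (infixl \<open>\<otimes>\<^sup>2\<^sub>w\<close> 70) where
  "X \<otimes>\<^sup>2\<^sub>w Y = D_w (D_w Y \<otimes>\<^sup>1\<^sub>w D_w X)"

definition hom_m where
  "hom_m X Y = mackey_space (chu_ihom (chu_of X) (chu_of Y))"

definition D_m where
  "D_m X = mackey_space (chu_dual (chu_of X))"

definition tensor1_m (infixl \<open>\<otimes>\<^sup>1\<^sub>m\<close> 70) where
  "X \<otimes>\<^sup>1\<^sub>m Y = D_m (hom_m X (D_m Y))"

definition tensor2_m (infixl \<open>\<otimes>\<^sup>2\<^sub>m\<close> 70) where
  "X \<otimes>\<^sup>2\<^sub>m Y = D_m (D_m Y \<otimes>\<^sup>1\<^sub>m D_m X)"


section \<open>The spaces of operators\<close>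

definition eval_dual ::
  "('k::real_normed_field, 'w::ab_group_add) tvs \<Rightarrow> ('k, 'w \<Rightarrow> 'k, 'w) chu" where
  "eval_dual Y =
    \<lparr>lft = top_dual Y, rgt = und Y,
     pairing = on_carriers (top_dual Y) (und Y) (\<lambda>w' w. w' w)\<rparr>"

definition dual_sigma ::
  "('k::real_normed_field, 'w::ab_group_add) tvs \<Rightarrow> ('k, 'w \<Rightarrow> 'k) tvs" where
  "dual_sigma Y = \<lparr>und = top_dual Y, topol = sigma_top (eval_dual Y)\<rparr>"

definition dual_tau ::
  "('k::real_normed_field, 'w::ab_group_add) tvs \<Rightarrow> ('k, 'w \<Rightarrow> 'k) tvs" where
  "dual_tau Y = \<lparr>und = top_dual Y, topol = tau_top (eval_dual Y)\<rparr>"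

text \<open>
  For a space \<open>L\<close> of linear maps \<open>W' \<rightarrow> V\<close>, the pair \<open>(L, W' \<otimes> V')\<close> with
  \<open>\<langle>f, w' \<otimes> v'\<rangle> = v' (f w')\<close>.
\<close>

definition operator_pair ::
  "('k::real_normed_field, ('w::ab_group_add \<Rightarrow> 'k) \<Rightarrow> 'v::ab_group_add) vspace
    \<Rightarrow> ('k, 'w) tvs \<Rightarrow> ('k, 'v) tvs
    \<Rightarrow> ('k, ('w \<Rightarrow> 'k) \<Rightarrow> 'v, (('w \<Rightarrow> 'k) \<Rightarrow> ('v \<Rightarrow> 'k) \<Rightarrow> 'k) \<Rightarrow> 'k) chu" where
  "operator_pair L Y X =
    \<lparr>lft = L, rgt = tensor (top_dual Y) (top_dual X),
     pairing = on_carriers L (tensor (top_dual Y) (top_dual X))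
       (\<lambda>f. tensor_eval (top_dual Y) (top_dual X) (\<lambda>w' v'. v' (f w')))\<rparr>"

definition L_sigma ::
  "('k::real_normed_field, 'w::ab_group_add) tvs \<Rightarrow> ('k, 'v::ab_group_add) tvs
    \<Rightarrow> ('k, ('w \<Rightarrow> 'k) \<Rightarrow> 'v) tvs" where
  "L_sigma Y X =
    \<lparr>und = cont_lin (dual_sigma Y) X,
     topol = sigma_top (operator_pair (cont_lin (dual_sigma Y) X) Y X)\<rparr>"

definition L_tau ::
  "('k::real_normed_field, 'w::ab_group_add) tvs \<Rightarrow> ('k, 'v::ab_group_add) tvs
    \<Rightarrow> ('k, ('w \<Rightarrow> 'k) \<Rightarrow> 'v) tvs" where
  "L_tau Y X =
    \<lparr>und = cont_lin (dual_tau Y) X,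
     topol = tau_top (operator_pair (cont_lin (dual_tau Y) X) Y X)\<rparr>"

end

theory Submission
  imports Defs
begin

text \<open>
  A dual pair determines its weak and its Mackey topology through seminorms: the weak one is
  generated by the absolute values of the functionals, the Mackey one by all seminorms that
  dominate only functionals of the pair.  The latter seminorms are closed under sums and under
  pullback because, by Hahn--Banach, a functional dominated by \<open>p + q \<circ> f\<close> splits into one dominated
  by \<open>p\<close> and the pullback of one dominated by \<open>q\<close>; this replaces the Mackey--Arens theorem.  In both
  cases the topology depends only on the set of functionals, and a linear map is continuous iff it
  pulls back functionals to functionals.  Hence \<open>V \<otimes>\<^sup>2 W\<close> is, by biduality, the internal hom from
  \<open>D W\<close> to \<open>D (D V)\<close>, whose elements are the continuous linear maps \<open>W' \<rightarrow> V\<close>.  Its pairing with the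
  tensor product is nondegenerate since the rank one maps separate tensors.

  The scalars are only assumed to form a Euclidean space with multiplicative norm, which covers
  the real and the complex case at once.
\<close>

section \<open>Splitting functionals dominated by seminorms\<close>

text \<open>\<open>sigma_top\<close> and \<open>tau_top\<close> are definite descriptions, so even
  the existence of a strongest dual topology has to be established before anything can be computed.
  The classical route describes it by uniform convergence on weakly compact absolutely convex sets.
  With seminorms the one point at risk is that two admissible seminorms might have a sum that
  dominates a new functional; the splitting theorem excludes this. Every dual topology is then
  coarser, because the gauges of its convex neighbourhoods dominate only continuous functionals. The
  second obstacle is that \<open>V \<otimes>\<^sup>2\<^sub>w W\<close> unfolds to an internal hom
  into the bidual of V, under two further dualities. The bidual consists of functionals on V' and
  not of elements of V, so it is isomorphic to V without being equal to it, and the tensor side of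
  the pairing has to be transported along the evaluation map.\<close>

definition sublinear_on :: "(real \<Rightarrow> 'v::ab_group_add \<Rightarrow> 'v) \<Rightarrow> 'v set \<Rightarrow> ('v \<Rightarrow> real) \<Rightarrow> bool" where
  "sublinear_on sc C s \<longleftrightarrow>
     (\<forall>x\<in>C. \<forall>y\<in>C. s (x + y) \<le> s x + s y) \<and> (\<forall>t>0. \<forall>x\<in>C. s (sc t x) \<le> t * s x)"

definition real_linear_on :: "(real \<Rightarrow> 'v::ab_group_add \<Rightarrow> 'v) \<Rightarrow> 'v set \<Rightarrow> ('v \<Rightarrow> real) \<Rightarrow> bool" where
  "real_linear_on sc C u \<longleftrightarrow>
     (\<forall>x\<in>C. \<forall>y\<in>C. u (x + y) = u x + u y) \<and> (\<forall>t. \<forall>x\<in>C. u (sc t x) = t * u x)"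

locale real_subspace = vector_space sc for sc :: "real \<Rightarrow> 'v::ab_group_add \<Rightarrow> 'v" +
  fixes C
  assumes subspace_C: "subspace C"
begin

lemma C_closed [simp, intro]:
  "0 \<in> C" "x \<in> C \<Longrightarrow> y \<in> C \<Longrightarrow> x + y \<in> C" "x \<in> C \<Longrightarrow> sc t x \<in> C" "x \<in> C \<Longrightarrow> - x \<in> C"
  using subspace_C subspace_0 subspace_add subspace_scale subspace_neg by blast+

lemma sublinear_onD:
  assumes "sublinear_on sc C s"
  shows "x \<in> C \<Longrightarrow> y \<in> C \<Longrightarrow> s (x + y) \<le> s x + s y"
    and "t > 0 \<Longrightarrow> x \<in> C \<Longrightarrow> s (sc t x) = t * s x"
    and "s 0 = 0"
    and "x \<in> C \<Longrightarrow> - s (- x) \<le> s x"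
proof -
  show add: "s (x + y) \<le> s x + s y" if "x \<in> C" "y \<in> C" for x y
    using assms that by (auto simp: sublinear_on_def)
  have le: "s (sc t x) \<le> t * s x" if "t > 0" "x \<in> C" for t x
    using assms that by (auto simp: sublinear_on_def)
  show "s (sc t x) = t * s x" if "t > 0" "x \<in> C"
    using le[OF that] le[of "1/t" "sc t x"] that by (simp add: field_simps)
  \<comment> \<open>The factor 2 gives s 0 \<ge> 0 and the factor 1/2 gives s 0 \<le> 0.\<close>
  show 0: "s 0 = 0" using le[of 2 0] le[of "1/2" 0] by simp
  show "- s (- x) \<le> s x" if "x \<in> C"
    using add[of x "- x"] that 0 by simp
qed

text \<open>Subtracting the value at \<open>x\<close> along the ray through \<open>x\<close> lowers \<open>s\<close> unless \<open>s\<close> is additive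
  at \<open>x\<close>; this makes minimal sublinear functionals linear.\<close>

lemma sublinear_lower_along:
  assumes s: "sublinear_on sc C s" and x: "x \<in> C"
  obtains s' where "sublinear_on sc C s'" "\<And>y. y \<in> C \<Longrightarrow> s' y \<le> s y"
    "\<And>y. y \<in> C \<Longrightarrow> s' y \<le> s (y + x) - s x" "\<And>y. y \<notin> C \<Longrightarrow> s' y = 0"
proof
  \<comment> \<open>The quantity under the infimum does not increase with t, so \<open>s'\<close> is
    its limit along the ray. The choices t = 0 and t = 1 give the two required upper bounds.\<close>
  define s' where "s' y = (if y \<in> C then INF t\<in>{0..}. s (y + sc t x) - t * s x else 0)" for y
  note sD = sublinear_onD[OF s]
  have hom0: "s (sc t x) = t * s x" if "t \<ge> 0" for t
    using that sD(2)[of t x] sD(3) x by (cases "t = 0") auto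
  \<comment> \<open>Subadditivity at y + t x and - y, whose sum is t x, gives a lower bound
    independent of t, so the infimum is finite.\<close>
  have lower: "- s (- y) \<le> s (y + sc t x) - t * s x" if "y \<in> C" "t \<ge> 0" for y t
    using sD(1)[of "y + sc t x" "- y"] that x hom0[OF that(2)] by (auto simp: algebra_simps)
  have bdd: "bdd_below ((\<lambda>t. s (y + sc t x) - t * s x) ` {0..})" if "y \<in> C" for y
    using lower[OF that] by (intro bdd_belowI2[where m = "- s (- y)"]) auto
  have le: "s' y \<le> s (y + sc t x) - t * s x" if "y \<in> C" "t \<ge> 0" for y t
    unfolding s'_def using cINF_lower[OF bdd[OF that(1)], of t] that by auto
  have ge: "b \<le> s' y" if "y \<in> C" "\<And>t. t \<ge> 0 \<Longrightarrow> b \<le> s (y + sc t x) - t * s x" for y b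
    unfolding s'_def using that by (auto intro!: cINF_greatest)
  show "s' y \<le> s y" if "y \<in> C" for y using le[OF that, of 0] by simp
  show "s' y \<le> s (y + x) - s x" if "y \<in> C" for y using le[OF that, of 1] by simp
  show "s' y = 0" if "y \<notin> C" for y using that by (simp add: s'_def)
  show "sublinear_on sc C s'"
    unfolding sublinear_on_def
  proof (intro conjI ballI allI impI)
    fix y z assume y: "y \<in> C" and z: "z \<in> C"
    \<comment> \<open>A parameter r for y and a parameter t for z combine to r + t for the sum; the
      two infima are then taken one after the other.\<close>
    have "s' (y + z) - (s (z + sc t x) - t * s x) \<le> s' y" if t: "t \<ge> 0" for t
    proof (rule ge[OF y])
      fix r :: real assume r: "r \<ge> 0"
      have "s' (y + z) \<le> s ((y + sc r x) + (z + sc t x)) - (r + t) * s x"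
        using le[of "y + z" "r + t"] r t y z by (simp add: scale_left_distrib add_ac)
      also have "\<dots> \<le> s (y + sc r x) + s (z + sc t x) - (r + t) * s x"
        using sD(1)[of "y + sc r x" "z + sc t x"] x y z by auto
      finally show "s' (y + z) - (s (z + sc t x) - t * s x) \<le> s (y + sc r x) - r * s x"
        by (simp add: algebra_simps)
    qed
    then have "s' (y + z) - s' y \<le> s (z + sc t x) - t * s x" if t: "t \<ge> 0" for t
      using that by (simp add: algebra_simps)
    from ge[OF z this] show "s' (y + z) \<le> s' y + s' z" by simp
  next
    fix r y assume r: "(r::real) > 0" and y: "y \<in> C"
    have "s' (sc r y) / r \<le> s' y"
    proof (rule ge[OF y])
      fix t :: real assume t: "t \<ge> 0"
      have "s' (sc r y) \<le> s (sc r y + sc (r * t) x) - r * t * s x"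
        using le[of "sc r y" "r * t"] r t y by simp
      also have "sc r y + sc (r * t) x = sc r (y + sc t x)" by (simp add: scale_right_distrib)
      also have "s \<dots> = r * s (y + sc t x)" using sD(2)[OF r] y x by auto
      finally show "s' (sc r y) / r \<le> s (y + sc t x) - t * s x"
        using r by (simp add: field_simps)
    qed
    then show "s' (sc r y) \<le> r * s' y" using r by (simp add: field_simps)
  qed
qed

text \<open>Zorn's lemma yields a minimal sublinear functional below \<open>r\<close>. As it cannot
  be lowered along any x, it is additive, and additivity turns positive homogeneity into real
  homogeneity.\<close>

lemma exists_linear_below:
  assumes r: "sublinear_on sc C r"
  obtains u where "real_linear_on sc C u" "\<And>x. x \<in> C \<Longrightarrow> u x \<le> r x"
proof -
  \<comment> \<open>Fixing the value 0 outside \<open>C\<close> lets minimality conclude an equality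
    of total functions.\<close>
  define A where "A = {s. sublinear_on sc C s \<and> (\<forall>x\<in>C. s x \<le> r x) \<and> (\<forall>x. x \<notin> C \<longrightarrow> s x = 0)}"
  \<comment> \<open>The order is reversed, so a maximal element for \<open>P\<close> is pointwise
    minimal.\<close>
  define P where "P s s' \<longleftrightarrow> (\<forall>x. s' x \<le> (s x :: real))" for s s' :: "'v \<Rightarrow> real"
  define r0 where "r0 x = (if x \<in> C then r x else 0)" for x
  have r0: "r0 \<in> A" using r by (auto simp: A_def r0_def sublinear_on_def)
  have "\<exists>m\<in>A. \<forall>s\<in>A. P m s \<longrightarrow> s = m"
  proof (rule predicate_Zorn)
    show "partial_order_on A (relation_of P A)"
      by (rule partial_order_on_relation_ofI) (auto simp: P_def fun_eq_iff intro: order_trans antisym)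
    fix K assume K: "K \<in> Chains (relation_of P A)"
    then have KA: "K \<subseteq> A" and chain: "\<And>s s'. s \<in> K \<Longrightarrow> s' \<in> K \<Longrightarrow> P s s' \<or> P s' s"
      by (auto simp: Chains_def relation_of_def)
    show "\<exists>u\<in>A. \<forall>a\<in>K. P a u"
    proof (cases "K = {}")
      case True then show ?thesis using r0 by auto
    next
      case False
      define u where "u x = (INF s\<in>K. s x)" for x
      \<comment> \<open>The bound - r (- x) is common to all members, because s (- x) \<le> r (- x)
        and - s (- x) \<le> s x; hence the infimum over a chain is finite.\<close>
      have lower: "(if x \<in> C then - r (- x) else 0) \<le> s x" if "s \<in> K" for s x
      proof (cases "x \<in> C")
        case True
        then have "s (- x) \<le> r (- x)" "- s (- x) \<le> s x"
          using KA that sublinear_onD(4)[of s x] by (auto simp: A_def)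
        then show ?thesis using True by simp
      qed (use KA that in \<open>auto simp: A_def\<close>)
      have bdd: "bdd_below ((\<lambda>s. s x) ` K)" for x
        using lower by (intro bdd_belowI2)
      have le: "u x \<le> s x" if "s \<in> K" for s x
        unfolding u_def using cINF_lower[OF bdd that] .
      have ge: "b \<le> u x" if "\<And>s. s \<in> K \<Longrightarrow> b \<le> s x" for b x
        unfolding u_def using that False by (intro cINF_greatest)
      obtain k where k: "k \<in> K" using False by blast
      have "sublinear_on sc C u"
        unfolding sublinear_on_def
      proof (intro conjI ballI allI impI)
        fix x y assume xy: "x \<in> C" "y \<in> C"
        have "u (x + y) \<le> s x + s' y" if s: "s \<in> K" "s' \<in> K" for s s'
        proof -
          \<comment> \<open>Comparability in the chain makes the infimum subadditive: one member
            lies below both s and s'.\<close>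
          obtain m where m: "m \<in> K" "P s m" "P s' m"
            using chain[OF s] s P_def by blast
          have "u (x + y) \<le> m (x + y)" using le[OF m(1)] .
          also have "\<dots> \<le> m x + m y"
            using m(1) KA xy sublinear_onD(1)[of m x y] by (auto simp: A_def)
          also have "\<dots> \<le> s x + s' y" using m by (auto simp: P_def intro: add_mono)
          finally show ?thesis .
        qed
        then have "u (x + y) - s' y \<le> u x" if "s' \<in> K" for s'
          using that by (intro ge) (simp add: algebra_simps)
        then have "u (x + y) - u x \<le> u y"
          by (intro ge) (simp add: algebra_simps)
        then show "u (x + y) \<le> u x + u y" by simp
      next
        fix t x assume t: "(t::real) > 0" and x: "x \<in> C"
        have "u (sc t x) / t \<le> s x" if "s \<in> K" for s
          using le[OF that, of "sc t x"] sublinear_onD(2)[of s t x] KA that t x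
          by (auto simp: A_def field_simps)
        then have "u (sc t x) / t \<le> u x" by (rule ge)
        then show "u (sc t x) \<le> t * u x" using t by (simp add: field_simps)
      qed
      moreover have "u x \<le> r x" if "x \<in> C" for x
        using le[OF k, of x] k KA that by (force simp: A_def)
      moreover have "u x = 0" if "x \<notin> C" for x
        using le[OF k, of x] ge[of 0 x] KA k that by (force simp: A_def)
      ultimately have "u \<in> A" by (auto simp: A_def)
      then show ?thesis using le by (auto simp: P_def)
    qed
  qed
  then obtain m where m: "m \<in> A" and min: "\<And>s. s \<in> A \<Longrightarrow> P m s \<Longrightarrow> s = m" by blast
  have sub: "sublinear_on sc C m" and mr: "\<And>x. x \<in> C \<Longrightarrow> m x \<le> r x" and m0: "\<And>x. x \<notin> C \<Longrightarrow> m x = 0"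
    using m by (auto simp: A_def)
  note mD = sublinear_onD[OF sub]
  have add: "m (y + x) = m y + m x" if x: "x \<in> C" and y: "y \<in> C" for x y
  proof -
    obtain s where s: "sublinear_on sc C s" "\<And>y. y \<in> C \<Longrightarrow> s y \<le> m y"
      "\<And>y. y \<in> C \<Longrightarrow> s y \<le> m (y + x) - m x" "\<And>y. y \<notin> C \<Longrightarrow> s y = 0"
      using sublinear_lower_along[OF sub x] by blast
    have "s \<in> A" using s mr order_trans[OF s(2) mr] unfolding A_def by auto
    moreover have "P m s" using s(2,4) m0 by (metis P_def order_refl)
    ultimately have "s = m" by (rule min)
    \<comment> \<open>From s = m follows m y \<le> m (y + x) - m x; the reverse inequality is
      subadditivity.\<close>
    then show ?thesis using s(3)[OF y] mD(1)[OF y x] by simp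
  qed
  have neg: "m (- x) = - m x" if "x \<in> C" for x
    using add[of "- x" x] that mD(3) by auto
  have "m (sc t x) = t * m x" if x: "x \<in> C" for t x
  proof (cases t "0::real" rule: linorder_cases)
    case less
    then have "m (sc (- t) x) = - t * m x" using mD(2)[of "- t" x] x by simp
    then show ?thesis using neg[of "sc t x"] x by simp
  qed (use mD x in auto)
  then have "real_linear_on sc C m" using add by (auto simp: real_linear_on_def)
  then show ?thesis using mr that by blast
qed

end

text \<open>The linear minorants of r y = inf (q (y + f x) + p x - h x) over x are exactly the
  functionals wanted: x = 0 bounds u by q, and y = - f x bounds h - u o f by p.\<close>

lemma real_hahn_banach_split:
  fixes sc1 :: "real \<Rightarrow> 'v::ab_group_add \<Rightarrow> 'v" and sc2 :: "real \<Rightarrow> 'w::ab_group_add \<Rightarrow> 'w"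
  assumes "real_subspace sc1 C1" "real_subspace sc2 C2"
    and p: "sublinear_on sc1 C1 p" and q: "sublinear_on sc2 C2 q"
    and f: "\<And>x. x \<in> C1 \<Longrightarrow> f x \<in> C2" "\<And>x y. x \<in> C1 \<Longrightarrow> y \<in> C1 \<Longrightarrow> f (x + y) = f x + f y"
      "\<And>t x. x \<in> C1 \<Longrightarrow> f (sc1 t x) = sc2 t (f x)"
    and h: "real_linear_on sc1 C1 h" "\<And>x. x \<in> C1 \<Longrightarrow> h x \<le> p x + q (f x)"
  obtains u where "real_linear_on sc2 C2 u" "\<And>y. y \<in> C2 \<Longrightarrow> u y \<le> q y"
    "\<And>x. x \<in> C1 \<Longrightarrow> h x - u (f x) \<le> p x"
proof -
  interpret C1: real_subspace sc1 C1 by fact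
  interpret C2: real_subspace sc2 C2 by fact
  note pD = C1.sublinear_onD[OF p] and qD = C2.sublinear_onD[OF q]
  have hadd: "h (x + y) = h x + h y" if "x \<in> C1" "y \<in> C1" for x y
    using h that by (auto simp: real_linear_on_def)
  have hsc: "h (sc1 t x) = t * h x" if "x \<in> C1" for t x
    using h that by (auto simp: real_linear_on_def)
  have f0: "f 0 = 0" using f(3)[of 0 0] by simp
  have h0: "h 0 = 0" using hsc[of 0 0] by simp
  define r where "r y = (INF x\<in>C1. q (y + f x) + p x - h x)" for y
  \<comment> \<open>Here the domination of h enters: h x \<le> p x + q (f x), and q (f x) \<le> q (y
    + f x) + q (- y).\<close>
  have lower: "- q (- y) \<le> q (y + f x) + p x - h x" if "y \<in> C2" "x \<in> C1" for x y
    using qD(1)[of "y + f x" "- y"] h(2)[OF that(2)] that f(1)[OF that(2)] by (simp add: algebra_simps)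
  have bdd: "bdd_below ((\<lambda>x. q (y + f x) + p x - h x) ` C1)" if "y \<in> C2" for y
    using lower[OF that] by (intro bdd_belowI2)
  have le: "r y \<le> q (y + f x) + p x - h x" if "y \<in> C2" "x \<in> C1" for x y
    unfolding r_def using cINF_lower[OF bdd[OF that(1)] that(2)] .
  have ge: "b \<le> r y" if "\<And>x. x \<in> C1 \<Longrightarrow> b \<le> q (y + f x) + p x - h x" for y b
    unfolding r_def using that C1.C_closed(1) by (intro cINF_greatest) auto
  have "sublinear_on sc2 C2 r"
    unfolding sublinear_on_def
  proof (intro conjI ballI allI impI)
    fix y z assume y: "y \<in> C2" and z: "z \<in> C2"
    have "r (y + z) \<le> (q (y + f x) + p x - h x) + (q (z + f x') + p x' - h x')"
      if x: "x \<in> C1" "x' \<in> C1" for x x'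
    proof -
      have "r (y + z) \<le> q ((y + f x) + (z + f x')) + p (x + x') - h (x + x')"
        using le[of "y + z" "x + x'"] x y z f(2)[OF x] by (simp add: algebra_simps)
      also have "\<dots> \<le> (q (y + f x) + q (z + f x')) + (p x + p x') - (h x + h x')"
        using qD(1)[of "y + f x" "z + f x'"] pD(1)[of x x'] hadd[OF x] x y z f(1) by auto
      finally show ?thesis by simp
    qed
    then have "r (y + z) - (q (z + f x') + p x' - h x') \<le> r y" if "x' \<in> C1" for x'
      using that by (intro ge) (simp add: algebra_simps)
    then have "r (y + z) - r y \<le> r z"
      by (intro ge) (simp add: algebra_simps)
    then show "r (y + z) \<le> r y + r z" by simp
  next
    fix t y assume t: "(t::real) > 0" and y: "y \<in> C2"
    have "r (sc2 t y) / t \<le> r y"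
    proof (rule ge)
      fix x assume x: "x \<in> C1"
      have "r (sc2 t y) \<le> q (sc2 t y + f (sc1 t x)) + p (sc1 t x) - h (sc1 t x)"
        using le[of "sc2 t y" "sc1 t x"] x y by simp
      also have "\<dots> = t * (q (y + f x) + p x - h x)"
        using f(3)[OF x, of t] qD(2)[OF t, of "y + f x"] pD(2)[OF t x] hsc[OF x, of t] y f(1)[OF x]
        by (simp add: C2.scale_right_distrib algebra_simps)
      finally show "r (sc2 t y) / t \<le> q (y + f x) + p x - h x"
        using t by (simp add: field_simps)
    qed
    then show "r (sc2 t y) \<le> t * r y" using t by (simp add: field_simps)
  qed
  then obtain u where u: "real_linear_on sc2 C2 u" and ur: "\<And>y. y \<in> C2 \<Longrightarrow> u y \<le> r y"
    using C2.exists_linear_below by blast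
  have "u y \<le> q y" if "y \<in> C2" for y
    using ur[OF that] le[OF that C1.C_closed(1)] by (simp add: f0 pD(3) h0)
  moreover have "h x - u (f x) \<le> p x" if x: "x \<in> C1" for x
  proof -
    have "u (sc2 (-1) (f x)) = -1 * u (f x)" using u f(1)[OF x] unfolding real_linear_on_def by blast
    then have "u (- f x) = - u (f x)" by simp
    moreover have "u (- f x) \<le> q (- f x + f x) + p x - h x"
      using ur[of "- f x"] le[of "- f x" x] x f(1)[OF x] by fastforce
    ultimately show ?thesis by (simp add: qD(3))
  qed
  ultimately show ?thesis using u that by blast
qed

section \<open>Seminorms and linear functionals over the scalar field\<close>

locale vspace_on =
  fixes V :: "('k::real_normed_field, 'v::ab_group_add) vspace"
  assumes is_vspace: "is_vspace V"
begin

sublocale vector_space "scl V" using is_vspace by (simp add: is_vspace_def)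

lemma car_closed [simp, intro]:
  "0 \<in> car V" "x \<in> car V \<Longrightarrow> y \<in> car V \<Longrightarrow> x + y \<in> car V" "x \<in> car V \<Longrightarrow> scl V c x \<in> car V"
  "x \<in> car V \<Longrightarrow> - x \<in> car V" "x \<in> car V \<Longrightarrow> y \<in> car V \<Longrightarrow> x - y \<in> car V"
  using is_vspace subspace_0 subspace_add subspace_scale subspace_neg subspace_diff
  unfolding is_vspace_def by blast+

lemma real_subspace: "real_subspace (\<lambda>t. scl V (of_real t)) (car V)"
proof -
  interpret R: vector_space "\<lambda>t. scl V (of_real t)"
    by unfold_locales (auto simp: scale_right_distrib scale_left_distrib)
  show ?thesis by unfold_locales (auto simp: R.subspace_def)
qed

end

text \<open>Nonnegativity and p 0 = 0 follow from homogeneity at -1 and 0 together with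
  subadditivity. Values outside the carrier are unconstrained.\<close>

definition seminorm_on :: "('k::real_normed_field, 'v::ab_group_add) vspace \<Rightarrow> ('v \<Rightarrow> real) \<Rightarrow> bool" where
  "seminorm_on V p \<longleftrightarrow>
     (\<forall>x\<in>car V. \<forall>y\<in>car V. p (x + y) \<le> p x + p y) \<and> (\<forall>c. \<forall>x\<in>car V. p (scl V c x) = norm c * p x)"

context vspace_on
begin

lemma seminorm_onD:
  assumes "seminorm_on V p"
  shows "x \<in> car V \<Longrightarrow> y \<in> car V \<Longrightarrow> p (x + y) \<le> p x + p y"
    and "x \<in> car V \<Longrightarrow> p (scl V c x) = norm c * p x"
    and "p 0 = 0"
    and "x \<in> car V \<Longrightarrow> p (- x) = p x"
    and "x \<in> car V \<Longrightarrow> 0 \<le> p x"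
    and "sublinear_on (\<lambda>t. scl V (of_real t)) (car V) p"
proof -
  show add: "p (x + y) \<le> p x + p y" if "x \<in> car V" "y \<in> car V" for x y
    using assms that by (auto simp: seminorm_on_def)
  show sc: "p (scl V c x) = norm c * p x" if "x \<in> car V" for c x
    using assms that by (auto simp: seminorm_on_def)
  show p0: "p 0 = 0" using sc[of 0 0] by simp
  show neg: "p (- x) = p x" if "x \<in> car V" for x using sc[OF that, of "-1"] by simp
  show "0 \<le> p x" if "x \<in> car V" for x using add[of x "- x"] that p0 neg[OF that] by simp
  show "sublinear_on (\<lambda>t. scl V (of_real t)) (car V) p"
    using add sc by (auto simp: sublinear_on_def)
qed

end

lemma alg_dualD:
  assumes "h \<in> car (alg_dual V)"
  shows "x \<in> car V \<Longrightarrow> y \<in> car V \<Longrightarrow> h (x + y) = h x + h y"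
    and "x \<in> car V \<Longrightarrow> h (scl V c x) = c * h x"
    and "x \<notin> car V \<Longrightarrow> h x = 0"
  using assms by (auto simp: hom_space_def lin_maps_def ground_def)

lemma alg_dualI:
  assumes "\<And>x y. x \<in> car V \<Longrightarrow> y \<in> car V \<Longrightarrow> h (x + y) = h x + h y"
    and "\<And>c x. x \<in> car V \<Longrightarrow> h (scl V c x) = c * h x"
    and "\<And>x. x \<notin> car V \<Longrightarrow> h x = 0"
  shows "h \<in> car (alg_dual V)"
  using assms by (auto simp: hom_space_def lin_maps_def ground_def)

text \<open>Riesz representation for the nondegenerate form \<open>(c, z) \<mapsto> Re (c z)\<close>, where \<open>Re z\<close> is the
  inner product of \<open>z\<close> and \<open>1\<close>.\<close>

lemma real_functional_as_Re:
  fixes l :: "'k::{real_normed_field,euclidean_space} \<Rightarrow> real"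
  assumes "linear l"
  shows "\<exists>!z. \<forall>c. inner (c * z) 1 = l c"
proof -
  \<comment> \<open>\<open>M z\<close> records the values of c \<mapsto> Re (c z) on the basis.
    Nondegeneracy makes \<open>M\<close> injective and equality of dimensions makes it surjective,
    so every real linear functional is represented.\<close>
  define M where "M z = (\<Sum>b\<in>Basis. inner (b * z) 1 *\<^sub>R b)" for z :: 'k
  have linM: "linear M"
    unfolding M_def by (rule linearI)
      (simp_all add: distrib_left inner_add_left scaleR_add_left sum.distrib scaleR_sum_right)
  have lc: "linear (\<lambda>c. inner (c * z) 1)" for z :: 'k
    by (rule linearI) (simp_all add: distrib_right inner_add_left)
  have nondeg: "z = 0" if "\<And>c. inner (c * z) 1 = 0" for z :: 'k
    using that[of "inverse z"] by (cases "z = 0") auto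
  have M_inner: "inner (M z) b = inner (b * z) 1" if "b \<in> Basis" for z b
    unfolding M_def using that by (simp add: inner_sum_left inner_Basis if_distrib cong: if_cong)
  have "inj M"
  proof (rule linear_injective_0[OF linM, THEN iffD2], intro allI impI)
    fix z assume "M z = 0"
    then have "inner (b * z) 1 = 0" if "b \<in> Basis" for b using M_inner[OF that, of z] by simp
    then have "inner (c * z) 1 = 0" for c
      using linear_eq_on_span[OF lc linear_zero, of Basis z c] by (simp add: span_Basis)
    then show "z = 0" by (rule nondeg)
  qed
  then have "surj M" using linear_injective_imp_surjective[OF linM] by blast
  then obtain z where z: "M z = (\<Sum>b\<in>Basis. l b *\<^sub>R b)" by (metis surjD)
  have "inner (b * z) 1 = l b" if "b \<in> Basis" for b
    using M_inner[OF that, of z] that by (simp add: z inner_sum_left inner_Basis if_distrib cong: if_cong)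
  then have "inner (c * z) 1 = l c" for c
    using linear_eq_on_span[OF lc assms, of Basis z c] by (simp add: span_Basis)
  moreover have "z' = z" if "\<forall>c. inner (c * z') 1 = l c" for z'
    using nondeg[of "z' - z"] that calculation by (simp add: right_diff_distrib inner_diff_left)
  ultimately show ?thesis by blast
qed



text \<open>For complex scalars this is the formula h x = u x - i u (i x). Without naming i, h x is
  the unique scalar representing the real functional c \<mapsto> u (c x), and uniqueness yields
  additivity and homogeneity.\<close>

lemma real_linear_as_Re:
  fixes V :: "('k::{real_normed_field,euclidean_space}, 'v::ab_group_add) vspace"
  assumes "is_vspace V" and u: "real_linear_on (\<lambda>t. scl V (of_real t)) (car V) u"
  obtains h where "h \<in> car (alg_dual V)" "\<And>x. x \<in> car V \<Longrightarrow> inner (h x) 1 = u x"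
proof -
  interpret vspace_on V by unfold_locales fact
  have add: "u (x + y) = u x + u y" if "x \<in> car V" "y \<in> car V" for x y
    using u that by (auto simp: real_linear_on_def)
  have sc: "u (scl V (of_real t) x) = t * u x" if "x \<in> car V" for t x
    using u that by (auto simp: real_linear_on_def)
  have lin: "linear (\<lambda>c. u (scl V c x))" if x: "x \<in> car V" for x
  proof (rule linearI)
    show "u (scl V (c + d) x) = u (scl V c x) + u (scl V d x)" for c d
      using add x by (simp add: scale_left_distrib)
    show "u (scl V (r *\<^sub>R c) x) = r *\<^sub>R u (scl V c x)" for r c
      using sc[of "scl V c x" r] x by (simp add: scaleR_conv_of_real)
  qed
  define h where "h x = (if x \<in> car V then THE z. \<forall>c. inner (c * z) 1 = u (scl V c x) else 0)" for x
  have h: "inner (c * h x) 1 = u (scl V c x)" if "x \<in> car V" for x c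
    using theI'[OF real_functional_as_Re[OF lin[OF that]]] that by (simp add: h_def)
  have uniq: "z = h x" if "x \<in> car V" "\<And>c. inner (c * z) 1 = u (scl V c x)" for x z
    using real_functional_as_Re[OF lin[OF that(1)]] h[OF that(1)] that(2) by blast
  have "h \<in> car (alg_dual V)"
  proof (rule alg_dualI)
    show "h (x + y) = h x + h y" if "x \<in> car V" "y \<in> car V" for x y
      by (rule uniq[symmetric])
        (use that in \<open>simp_all add: distrib_left inner_add_left h add scale_right_distrib\<close>)
    show "h (scl V c x) = c * h x" if x: "x \<in> car V" for c x
    proof (rule uniq[symmetric])
      show "inner (d * (c * h x)) 1 = u (scl V d (scl V c x))" for d
        using h[OF x, of "d * c"] by (simp add: mult.assoc)
    qed (use x in simp)
  qed (simp add: h_def)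
  moreover have "inner (h x) 1 = u x" if "x \<in> car V" for x using h[OF that, of 1] by simp
  ultimately show ?thesis using that by blast
qed

lemma inner_one_le_norm: "inner z 1 \<le> norm (z::'k::{real_normed_field,euclidean_space})"
  using norm_cauchy_schwarz[of z 1] by simp

text \<open>A scalar of norm 1 rotates x so that h x becomes the nonnegative real |h x|, while p x
  stays the same.\<close>

lemma norm_le_seminorm_if_Re_le:
  fixes V :: "('k::{real_normed_field,euclidean_space}, 'v::ab_group_add) vspace"
  assumes "is_vspace V" and h: "h \<in> car (alg_dual V)" and p: "seminorm_on V p"
    and re: "\<And>x. x \<in> car V \<Longrightarrow> inner (h x) 1 \<le> p x" and x: "x \<in> car V"
  shows "norm (h x) \<le> p x"
proof -
  interpret vspace_on V by unfold_locales fact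
  show ?thesis
  proof (cases "h x = 0")
    case True
    then show ?thesis using seminorm_onD(5)[OF p x] by simp
  next
    case False
    define c where "c = of_real (norm (h x)) / h x"
    have c: "norm c = 1" "c * h x = of_real (norm (h x))" using False by (simp_all add: c_def norm_divide)
    have "norm (h x) = inner (h (scl V c x)) 1"
      using alg_dualD(2)[OF h x, of c] c by simp
    also have "\<dots> \<le> p x" using re[of "scl V c x"] seminorm_onD(2)[OF p x, of c] c x by simp
    finally show ?thesis .
  qed
qed

text \<open>This form of the Hahn--Banach theorem covers extension (\<open>p = 0\<close>, \<open>f\<close> an inclusion) and
  splitting with respect to a sum of seminorms (\<open>f\<close> the identity).\<close>

theorem hahn_banach_split:
  fixes V :: "('k::{real_normed_field,euclidean_space}, 'v::ab_group_add) vspace"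
    and W :: "('k, 'w::ab_group_add) vspace"
  assumes V: "is_vspace V" and W: "is_vspace W"
    and p: "seminorm_on V p" and q: "seminorm_on W q" and f: "f \<in> lin_maps V W"
    and h: "h \<in> car (alg_dual V)" and hle: "\<And>x. x \<in> car V \<Longrightarrow> norm (h x) \<le> p x + q (f x)"
  obtains h1 h2 where "h1 \<in> car (alg_dual V)" "h2 \<in> car (alg_dual W)"
    "\<And>x. x \<in> car V \<Longrightarrow> norm (h1 x) \<le> p x" "\<And>y. y \<in> car W \<Longrightarrow> norm (h2 y) \<le> q y"
    "\<And>x. x \<in> car V \<Longrightarrow> h x = h1 x + h2 (f x)"
proof -
  interpret V: vspace_on V by unfold_locales fact
  interpret W: vspace_on W by unfold_locales fact
  have fD: "f x \<in> car W" "y \<in> car V \<Longrightarrow> f (x + y) = f x + f y" "f (scl V c x) = scl W c (f x)"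
    if "x \<in> car V" for x y c
    using f that by (auto simp: lin_maps_def)
  have "real_linear_on (\<lambda>t. scl V (of_real t)) (car V) (\<lambda>x. inner (h x) 1)"
    using alg_dualD[OF h] by (auto simp: real_linear_on_def inner_add_left of_real_def)
  moreover have "inner (h x) 1 \<le> p x + q (f x)" if "x \<in> car V" for x
    using hle[OF that] inner_one_le_norm[of "h x"] by simp
  ultimately obtain u where u: "real_linear_on (\<lambda>t. scl W (of_real t)) (car W) u"
    and uq: "\<And>y. y \<in> car W \<Longrightarrow> u y \<le> q y"
    and up: "\<And>x. x \<in> car V \<Longrightarrow> inner (h x) 1 - u (f x) \<le> p x"
    using real_hahn_banach_split[OF V.real_subspace W.real_subspace
        V.seminorm_onD(6)[OF p] W.seminorm_onD(6)[OF q], of f "\<lambda>x. inner (h x) 1"] fD by blast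
  obtain h2 where h2: "h2 \<in> car (alg_dual W)" "\<And>y. y \<in> car W \<Longrightarrow> inner (h2 y) 1 = u y"
    using real_linear_as_Re[OF W u] by blast
  \<comment> \<open>Only real parts have been split. Taking \<open>h1\<close> as the remainder makes
    the decomposition hold by definition, and both bounds are then lifted from real parts to norms
    by rotation.\<close>
  define h1 where "h1 x = (if x \<in> car V then h x - h2 (f x) else 0)" for x
  have h1: "h1 \<in> car (alg_dual V)"
    by (rule alg_dualI)
      (use fD alg_dualD(1,2)[OF h] alg_dualD(1,2)[OF h2(1)] in \<open>simp_all add: h1_def algebra_simps\<close>)
  show ?thesis
  proof
    show "norm (h1 x) \<le> p x" if "x \<in> car V" for x
      by (rule norm_le_seminorm_if_Re_le[OF V h1 p _ that])
        (use up h2(2) fD(1) in \<open>simp add: h1_def inner_diff_left\<close>)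
    show "norm (h2 y) \<le> q y" if "y \<in> car W" for y
      by (rule norm_le_seminorm_if_Re_le[OF W h2(1) q _ that]) (use uq h2(2) in simp)
    show "h1 \<in> car (alg_dual V)" "h2 \<in> car (alg_dual W)" by fact+
  qed (simp add: h1_def)
qed

section \<open>Locally convex topologies and seminorms\<close>

text \<open>A single seminorm ball around each point replaces finite intersections of balls, because
  the families in use are closed under sums.\<close>

definition seminorm_topology ::
  "('k::real_normed_field, 'v::ab_group_add) vspace \<Rightarrow> ('v \<Rightarrow> real) set \<Rightarrow> 'v topology" where
  "seminorm_topology V P = topology (\<lambda>U. U \<subseteq> car V \<and>
     (\<forall>x\<in>U. \<exists>p\<in>P. \<exists>e>0. \<forall>y\<in>car V. p (y - x) < e \<longrightarrow> y \<in> U))"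

locale seminorm_family = vspace_on V for V :: "('k::real_normed_field, 'v::ab_group_add) vspace" +
  fixes P :: "('v \<Rightarrow> real) set"
  assumes seminorm: "p \<in> P \<Longrightarrow> seminorm_on V p"
    and add_mem: "p \<in> P \<Longrightarrow> q \<in> P \<Longrightarrow> (\<lambda>x. p x + q x) \<in> P"
    and nonempty: "P \<noteq> {}"
begin

lemma openin_iff:
  "openin (seminorm_topology V P) U \<longleftrightarrow> U \<subseteq> car V \<and>
     (\<forall>x\<in>U. \<exists>p\<in>P. \<exists>e>0. \<forall>y\<in>car V. p (y - x) < e \<longrightarrow> y \<in> U)"
proof -
  define open_set where "open_set U \<longleftrightarrow> U \<subseteq> car V \<and>
    (\<forall>x\<in>U. \<exists>p\<in>P. \<exists>e>0. \<forall>y\<in>car V. p (y - x) < e \<longrightarrow> y \<in> U)" for U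
  have "istopology open_set"
    unfolding istopology_def
  proof (intro conjI allI impI)
    fix S T assume S: "open_set S" and T: "open_set T"
    have "\<exists>p\<in>P. \<exists>e>0. \<forall>y\<in>car V. p (y - x) < e \<longrightarrow> y \<in> S \<inter> T" if x: "x \<in> S \<inter> T" for x
    proof -
      obtain p e where p: "p \<in> P" "e > 0" "\<And>y. y \<in> car V \<Longrightarrow> p (y - x) < e \<Longrightarrow> y \<in> S"
        using S x unfolding open_set_def by blast
      obtain q d where q: "q \<in> P" "d > 0" "\<And>y. y \<in> car V \<Longrightarrow> q (y - x) < d \<Longrightarrow> y \<in> T"
        using T x unfolding open_set_def by blast
      have "x \<in> car V" using S x by (auto simp: open_set_def)
      then have "y \<in> S \<inter> T" if "y \<in> car V" "p (y - x) + q (y - x) < min e d" for y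
        using p(3)[OF that(1)] q(3)[OF that(1)] that(2) seminorm_onD(5)[OF seminorm[OF p(1)], of "y - x"]
          seminorm_onD(5)[OF seminorm[OF q(1)], of "y - x"] that(1) by auto
      then show ?thesis
        using add_mem[OF p(1) q(1)] p(2) q(2) by (intro bexI[of _ "\<lambda>x. p x + q x"] exI[of _ "min e d"]) auto
    qed
    then show "open_set (S \<inter> T)" using S unfolding open_set_def by blast
  next
    fix \<K> assume "\<forall>K\<in>\<K>. open_set K"
    then show "open_set (\<Union>\<K>)" unfolding open_set_def by (meson Union_iff Union_least)
  qed
  then show ?thesis
    unfolding seminorm_topology_def open_set_def[abs_def] by (simp add: topology_inverse')
qed

lemma topspace_seminorm_topology [simp]: "topspace (seminorm_topology V P) = car V"
proof
  show "topspace (seminorm_topology V P) \<subseteq> car V" unfolding topspace_def openin_iff by blast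
  have "openin (seminorm_topology V P) (car V)"
    unfolding openin_iff using nonempty zero_less_one by blast
  then show "car V \<subseteq> topspace (seminorm_topology V P)" by (rule openin_subset)
qed

lemma openin_seminorm_ball:
  assumes p: "p \<in> P" and x: "x \<in> car V"
  shows "openin (seminorm_topology V P) {y \<in> car V. p (y - x) < e}"
  unfolding openin_iff
proof safe
  fix y assume y: "y \<in> car V" "p (y - x) < e"
  have "p (z - x) < e" if z: "z \<in> car V" "p (z - y) < e - p (y - x)" for z
    using seminorm_onD(1)[OF seminorm[OF p], of "z - y" "y - x"] x y z by simp
  then show "\<exists>p'\<in>P. \<exists>d>0. \<forall>z\<in>car V. p' (z - y) < d \<longrightarrow> z \<in> {y \<in> car V. p (y - x) < e}"
    using p y by (intro bexI[of _ p] exI[of _ "e - p (y - x)"]) auto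
qed

lemma continuous_map_seminormI:
  assumes "\<And>z. z \<in> topspace Z \<Longrightarrow> f z \<in> car V"
    and "\<And>z p e. z \<in> topspace Z \<Longrightarrow> p \<in> P \<Longrightarrow> e > 0 \<Longrightarrow>
      \<exists>N. openin Z N \<and> z \<in> N \<and> (\<forall>z'\<in>N. p (f z' - f z) < e)"
  shows "continuous_map Z (seminorm_topology V P) f"
  unfolding continuous_map_def
proof (intro conjI allI impI)
  show "f \<in> topspace Z \<rightarrow> topspace (seminorm_topology V P)" using assms(1) by simp
  fix U assume U: "openin (seminorm_topology V P) U"
  show "openin Z {z \<in> topspace Z. f z \<in> U}"
  proof (subst openin_subopen, intro ballI)
    fix z assume z: "z \<in> {z \<in> topspace Z. f z \<in> U}"
    then obtain p e where p: "p \<in> P" "e > 0" "\<forall>y\<in>car V. p (y - f z) < e \<longrightarrow> y \<in> U"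
      using U unfolding openin_iff by blast
    obtain N where N: "openin Z N" "z \<in> N" "\<forall>z'\<in>N. p (f z' - f z) < e"
      using assms(2)[OF _ p(1,2), of z] z by blast
    then have "N \<subseteq> {z \<in> topspace Z. f z \<in> U}"
      using p(3) assms(1) openin_subset[OF N(1)] by blast
    then show "\<exists>T. openin Z T \<and> z \<in> T \<and> T \<subseteq> {z \<in> topspace Z. f z \<in> U}" using N by blast
  qed
qed

lemma continuous_add:
  "continuous_map (prod_topology (seminorm_topology V P) (seminorm_topology V P))
     (seminorm_topology V P) (\<lambda>(x, y). x + y)"
proof (rule continuous_map_seminormI)
  fix z p e
  assume z: "z \<in> topspace (prod_topology (seminorm_topology V P) (seminorm_topology V P))"
    and p: "p \<in> P" and e: "(e::real) > 0"
  obtain x y where xy: "z = (x, y)" "x \<in> car V" "y \<in> car V" using z by auto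
  define B where "B x = {y \<in> car V. p (y - x) < e / 2}" for x
  have "p ((x' + y') - (x + y)) < e" if "x' \<in> B x" "y' \<in> B y" for x' y'
    using seminorm_onD(1)[OF seminorm[OF p], of "x' - x" "y' - y"] xy that by (simp add: B_def algebra_simps)
  moreover have "x \<in> B x" "y \<in> B y"
    using xy e seminorm_onD(3)[OF seminorm[OF p]] by (auto simp: B_def)
  moreover have "openin (seminorm_topology V P) (B x)" "openin (seminorm_topology V P) (B y)"
    unfolding B_def by (rule openin_seminorm_ball[OF p]; use xy in simp)+
  ultimately show "\<exists>N. openin (prod_topology (seminorm_topology V P) (seminorm_topology V P)) N \<and> z \<in> N \<and>
      (\<forall>z'\<in>N. p ((case z' of (x, y) \<Rightarrow> x + y) - (case z of (x, y) \<Rightarrow> x + y)) < e)"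
    using xy
    by (intro exI[of _ "B x \<times> B y"]) (auto simp: openin_prod_Times_iff)
qed auto

lemma continuous_scale:
  "continuous_map (prod_topology euclidean (seminorm_topology V P))
     (seminorm_topology V P) (\<lambda>(c, x). scl V c x)"
proof (rule continuous_map_seminormI)
  fix z :: "'k \<times> 'v" and p e
  assume z: "z \<in> topspace (prod_topology euclidean (seminorm_topology V P))"
    and p: "p \<in> P" and e: "(e::real) > 0"
  note pD = seminorm_onD[OF seminorm[OF p]]
  obtain c x where cx: "z = (c, x)" "x \<in> car V" using z by auto
  have px: "p x \<ge> 0" using pD(5) cx by simp
  \<comment> \<open>The increment is c' (x' - x) + (c' - c) x. The bound 1 on d keeps |c'| \<le> |c|
    + 1, so r makes the first term at most e/2. The other bound on d makes the second term less than
    e/2, with p x + 1 guarding against p x = 0.\<close>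
  define d where "d = min 1 (e / (2 * (p x + 1)))"
  define r where "r = e / (2 * (norm c + 1))"
  have d: "d > 0" "d \<le> 1" "d * p x < e / 2"
  proof -
    show "d > 0" "d \<le> 1" using e px by (auto simp: d_def)
    have "d * (p x + 1) \<le> e / (2 * (p x + 1)) * (p x + 1)"
      using px by (intro mult_right_mono) (auto simp: d_def)
    also have "\<dots> = e / 2"
    proof -
      have "p x + 1 \<noteq> 0" using px by linarith
      then show ?thesis by (simp add: field_simps)
    qed
    finally have "d * (p x + 1) \<le> e / 2" .
    then show "d * p x < e / 2" using \<open>d > 0\<close> by (simp add: algebra_simps)
  qed
  have r: "r > 0" using e by (simp add: r_def add_nonneg_pos)
  define B where "B = {y \<in> car V. p (y - x) < r}"
  have "p (scl V c' x' - scl V c x) < e" if c': "c' \<in> ball c d" and x': "x' \<in> B" for c' x'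
  proof -
    have x'B: "x' \<in> car V" "p (x' - x) < r" using x' by (auto simp: B_def)
    have n: "norm (c' - c) < d" using c' by (simp add: dist_norm norm_minus_commute)
    then have nc: "norm c' \<le> norm c + 1" using d(2) norm_triangle_sub[of c' c] by simp
    have "scl V c' x' - scl V c x = scl V c' (x' - x) + scl V (c' - c) x"
      by (simp add: scale_right_diff_distrib scale_left_diff_distrib)
    then have "p (scl V c' x' - scl V c x) \<le> norm c' * p (x' - x) + norm (c' - c) * p x"
      using pD(1)[of "scl V c' (x' - x)" "scl V (c' - c) x"] pD(2) cx x'B by auto
    also have "norm c' * p (x' - x) \<le> (norm c + 1) * r"
      using nc x'B pD(5)[of "x' - x"] cx by (intro mult_mono) auto
    also have "(norm c + 1) * r = e / 2"
    proof -
      have "norm c + 1 \<noteq> 0" using norm_ge_zero[of c] by linarith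
      then show ?thesis by (simp add: r_def field_simps)
    qed
    also have "norm (c' - c) * p x \<le> d * p x" using n px by (intro mult_right_mono) auto
    finally show ?thesis using d(3) by simp
  qed
  moreover have "x \<in> B" using cx r pD(3) by (auto simp: B_def)
  moreover have "openin (seminorm_topology V P) B"
    unfolding B_def by (rule openin_seminorm_ball[OF p]; use cx in simp)+
  ultimately show "\<exists>N. openin (prod_topology euclidean (seminorm_topology V P)) N \<and> z \<in> N \<and>
      (\<forall>z'\<in>N. p ((case z' of (c, x) \<Rightarrow> scl V c x) - (case z of (c, x) \<Rightarrow> scl V c x)) < e)"
    using cx d(1)
    by (intro exI[of _ "ball c d \<times> B"]) (auto simp: openin_prod_Times_iff)
qed auto

lemma is_TVS_seminorm_topology:
  assumes sep: "\<And>x. x \<in> car V \<Longrightarrow> (\<And>p. p \<in> P \<Longrightarrow> p x = 0) \<Longrightarrow> x = 0"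
  shows "is_TVS \<lparr>und = V, topol = seminorm_topology V P\<rparr>"
proof -
  have "Hausdorff_space (seminorm_topology V P)"
    unfolding Hausdorff_space_def
  proof (intro allI impI)
    fix x y assume xy: "x \<in> topspace (seminorm_topology V P) \<and> y \<in> topspace (seminorm_topology V P) \<and> x \<noteq> y"
    then have car: "x \<in> car V" "y \<in> car V" "y - x \<noteq> 0" by auto
    then obtain p where p: "p \<in> P" "p (y - x) \<noteq> 0" using sep[of "y - x"] by auto
    note pD = seminorm_onD[OF seminorm[OF p(1)]]
    \<comment> \<open>With half of p (y - x) as radius, the triangle inequality keeps the two balls
      apart.\<close>
    define e where "e = p (y - x) / 2"
    have e: "e > 0" using pD(5)[of "y - x"] p(2) car by (simp add: e_def)
    let ?B = "\<lambda>x. {z \<in> car V. p (z - x) < e}"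
    have "disjnt (?B x) (?B y)"
    proof -
      have False if "z \<in> ?B x" "z \<in> ?B y" for z
        using pD(1)[of "- (z - y)" "z - x"] pD(4)[of "z - y"] that car by (auto simp: e_def)
      then show ?thesis unfolding disjnt_def by blast
    qed
    moreover have "x \<in> ?B x" "y \<in> ?B y" using car e pD(3) by auto
    ultimately show "\<exists>U W. openin (seminorm_topology V P) U \<and> openin (seminorm_topology V P) W \<and>
        x \<in> U \<and> y \<in> W \<and> disjnt U W"
      using openin_seminorm_ball[OF p(1)] car by blast
  qed
  moreover have "neighbourhood_base_at 0 (convex_in V) (seminorm_topology V P)"
    unfolding neighbourhood_base_at_def
  proof (intro allI impI)
    fix W assume "openin (seminorm_topology V P) W \<and> 0 \<in> W"
    then obtain p e where p: "p \<in> P" "e > 0" "\<forall>y\<in>car V. p (y - 0) < e \<longrightarrow> y \<in> W"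
      unfolding openin_iff by blast
    note pD = seminorm_onD[OF seminorm[OF p(1)]]
    let ?B = "{y \<in> car V. p (y - 0) < e}"
    have "convex_in V ?B"
      unfolding convex_in_def
    proof (intro ballI allI impI)
      fix x y and a b :: real
      assume x: "x \<in> ?B" and y: "y \<in> ?B" and ab: "0 \<le> a" "0 \<le> b" "a + b = 1"
      have "p (scl V (of_real a) x + scl V (of_real b) y) \<le> a * p x + b * p y"
        using pD(1)[of "scl V (of_real a) x" "scl V (of_real b) y"] pD(2) x y ab by auto
      also have "\<dots> < e" using convex_bound_lt[of "p x" e "p y" a b] x y ab by simp
      finally show "scl V (of_real a) x + scl V (of_real b) y \<in> ?B" using x y by auto
    qed
    then show "\<exists>U C. openin (seminorm_topology V P) U \<and> convex_in V C \<and> 0 \<in> U \<and> U \<subseteq> C \<and> C \<subseteq> W"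
      using openin_seminorm_ball[OF p(1), of 0 e] p pD(3) by (intro exI[of _ ?B]) auto
  qed
  ultimately show ?thesis
    using is_vspace continuous_add continuous_scale by (simp add: is_TVS_def)
qed

end

text \<open>For a seminorm on a topological vector space this amounts to continuity, since scaling
  and translation carry the bound to arbitrarily small balls at any point. In this form it is easily
  checked for gauges and functionals and is stable under sums.\<close>

definition bounded_near_zero :: "('k, 'v::zero) tvs \<Rightarrow> ('v \<Rightarrow> real) \<Rightarrow> bool" where
  "bounded_near_zero X p \<longleftrightarrow> (\<exists>N B. openin (topol X) N \<and> 0 \<in> N \<and> (\<forall>x\<in>N. p x \<le> B))"

lemma bounded_near_zero_add:
  assumes "bounded_near_zero X p" "bounded_near_zero X q"
  shows "bounded_near_zero X (\<lambda>x. p x + q x)"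
proof -
  obtain N B N' B' where "openin (topol X) N" "0 \<in> N" "\<forall>x\<in>N. p x \<le> B"
    "openin (topol X) N'" "0 \<in> N'" "\<forall>x\<in>N'. q x \<le> B'"
    using assms by (auto simp: bounded_near_zero_def)
  then show ?thesis unfolding bounded_near_zero_def
    by (intro exI[of _ "N \<inter> N'"] exI[of _ "B + B'"]) (auto intro: add_mono)
qed

lemma (in seminorm_family) bounded_near_zero_seminorm:
  assumes "p \<in> P"
  shows "bounded_near_zero \<lparr>und = V, topol = seminorm_topology V P\<rparr> p"
  using openin_seminorm_ball[OF assms car_closed(1), of 1] seminorm_onD(3)[OF seminorm[OF assms]]
  unfolding bounded_near_zero_def by (intro exI[of _ "{y \<in> car V. p (y - 0) < 1}"] exI[of _ 1]) auto

lemma top_dual_iff: "h \<in> car (top_dual X) \<longleftrightarrow> h \<in> car (alg_dual (und X)) \<and> continuous_map (topol X) euclidean h"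
  by (auto simp: cont_lin_def ground_tvs_def hom_space_def)

section \<open>Continuous seminorms and functionals on a locally convex space\<close>

locale tvs_on =
  fixes X :: "('k::real_normed_field, 'v::ab_group_add) tvs"
  assumes is_TVS: "is_TVS X"
begin

sublocale vspace_on "und X" using is_TVS by unfold_locales (simp add: is_TVS_def)

lemma topspace_topol [simp]: "topspace (topol X) = car (und X)"
  using is_TVS by (simp add: is_TVS_def)

lemma affine_continuous:
  assumes "a \<in> car (und X)"
  shows "continuous_map (topol X) (topol X) (\<lambda>y. scl (und X) c (y + a))"
proof -
  have "continuous_map (topol X) (prod_topology (topol X) (topol X)) (\<lambda>y. (y, a))"
    using assms by (simp add: continuous_map_pairedI)
  then have add: "continuous_map (topol X) (topol X) (\<lambda>y. y + a)"
    using is_TVS continuous_map_compose[of _ _ "\<lambda>y. (y, a)" _ "\<lambda>(x, y). x + y"]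
    unfolding is_TVS_def o_def by auto
  then have "continuous_map (topol X) (prod_topology euclidean (topol X)) (\<lambda>y. (c, y + a))"
    by (simp add: continuous_map_pairedI)
  then show ?thesis
    using is_TVS continuous_map_compose[of _ _ "\<lambda>y. (c, y + a)" _ "\<lambda>(c, x). scl (und X) c x"]
    unfolding is_TVS_def o_def by auto
qed

lemma scale_continuous:
  assumes "x \<in> car (und X)"
  shows "continuous_map euclidean (topol X) (\<lambda>c. scl (und X) c x)"
proof -
  have "continuous_map euclidean (prod_topology euclidean (topol X)) (\<lambda>c. (c, x))"
    using assms by (simp add: continuous_map_pairedI)
  then show ?thesis
    using is_TVS continuous_map_compose[of _ _ "\<lambda>c. (c, x)" _ "\<lambda>(c, x). scl (und X) c x"]
    unfolding is_TVS_def o_def by auto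
qed

lemma seminorm_neighbourhood:
  assumes p: "seminorm_on (und X) p" and b: "bounded_near_zero X p" and x: "x \<in> car (und X)" and e: "e > 0"
  shows "\<exists>N. openin (topol X) N \<and> x \<in> N \<and> (\<forall>y\<in>N. p (y - x) < e)"
proof -
  obtain N B where N: "openin (topol X) N" "0 \<in> N" "\<And>x. x \<in> N \<Longrightarrow> p x \<le> B"
    using b by (auto simp: bounded_near_zero_def)
  have B: "B \<ge> 0" using N(3)[OF N(2)] seminorm_onD(3)[OF p] by simp
  \<comment> \<open>If t (y - x) lies in N then p (y - x) \<le> B / t, which is below e. The summand
    1 makes this strict and keeps t positive when B = 0.\<close>
  define t where "t = (B + 1) / e"
  have t: "t > 0" using B e by (simp add: t_def)
  define M where "M = {y \<in> topspace (topol X). scl (und X) (of_real t) (y + - x) \<in> N}"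
  have "openin (topol X) M"
    unfolding M_def using affine_continuous[of "- x"] x N(1)
    by (intro openin_continuous_map_preimage[of _ "topol X"]) auto
  moreover have "x \<in> M" using x N(2) by (simp add: M_def)
  moreover have "p (y - x) < e" if "y \<in> M" for y
  proof -
    have "t * p (y - x) \<le> B"
      using N(3)[of "scl (und X) (of_real t) (y + - x)"] seminorm_onD(2)[OF p, of "y - x" "of_real t"]
        that x t by (auto simp: M_def)
    also have "B < t * e" using e by (simp add: t_def)
    finally show ?thesis using t by simp
  qed
  ultimately show ?thesis by blast
qed

text \<open>Continuity of a functional is reduced to domination by a continuous seminorm, since |h y
  - h x| \<le> p (y - x).\<close>

lemma top_dual_if_dominated:
  assumes p: "seminorm_on (und X) p" "bounded_near_zero X p" and h: "h \<in> car (alg_dual (und X))"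
    and le: "\<And>x. x \<in> car (und X) \<Longrightarrow> norm (h x) \<le> p x"
  shows "h \<in> car (top_dual X)"
proof -
  have diff: "h (y - x) = h y - h x" if "x \<in> car (und X)" "y \<in> car (und X)" for x y
    using alg_dualD(1)[OF h, of "y - x" x] that by simp
  have "openin (topol X) {x \<in> topspace (topol X). h x \<in> U}" if "open U" for U
  proof (subst openin_subopen, intro ballI)
    fix x assume x: "x \<in> {x \<in> topspace (topol X). h x \<in> U}"
    then obtain e where e: "e > 0" "\<And>z. dist z (h x) < e \<Longrightarrow> z \<in> U"
      using \<open>open U\<close> by (auto simp: open_dist)
    obtain N where N: "openin (topol X) N" "x \<in> N" "\<And>y. y \<in> N \<Longrightarrow> p (y - x) < e"
      using seminorm_neighbourhood[OF p _ e(1), of x] x by auto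
    have "h y \<in> U" if "y \<in> N" for y
      using le[of "y - x"] diff[of x y] N(3)[OF that] openin_subset[OF N(1)] that x
      by (intro e(2)) (auto simp: dist_norm)
    then show "\<exists>T. openin (topol X) T \<and> x \<in> T \<and> T \<subseteq> {x \<in> topspace (topol X). h x \<in> U}"
      using N(1,2) openin_subset[OF N(1)] by blast
  qed
  then have "continuous_map (topol X) euclidean h" by (auto simp: continuous_map_def)
  then show ?thesis using h by (simp add: top_dual_iff)
qed

lemma bounded_near_zero_top_dual:
  assumes "h \<in> car (top_dual X)"
  shows "bounded_near_zero X (\<lambda>x. norm (h x))"
proof -
  have h: "h \<in> car (alg_dual (und X))" "continuous_map (topol X) euclidean h"
    using assms by (auto simp: top_dual_iff)
  have "openin (topol X) {x \<in> topspace (topol X). h x \<in> ball 0 1}"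
    using h(2) by (rule openin_continuous_map_preimage) simp
  moreover have "h 0 = 0" using alg_dualD(2)[OF h(1), of 0 0] by simp
  ultimately show ?thesis
    unfolding bounded_near_zero_def
    by (intro exI[of _ "{x \<in> topspace (topol X). h x \<in> ball 0 1}"] exI[of _ 1]) auto
qed

lemma weaker_seminorm_topology:
  assumes "seminorm_family (und X) P" and b: "\<And>p. p \<in> P \<Longrightarrow> bounded_near_zero X p"
  shows "weaker_topology (seminorm_topology (und X) P) (topol X)"
  unfolding weaker_topology_def
proof (intro allI impI)
  interpret P: seminorm_family "und X" P by fact
  fix U assume U: "openin (seminorm_topology (und X) P) U"
  show "openin (topol X) U"
  proof (subst openin_subopen, intro ballI)
    fix x assume x: "x \<in> U"
    then obtain p e where p: "p \<in> P" "e > 0" "\<forall>y\<in>car (und X). p (y - x) < e \<longrightarrow> y \<in> U" "x \<in> car (und X)"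
      using U unfolding P.openin_iff by blast
    then obtain N where N: "openin (topol X) N" "x \<in> N" "\<And>y. y \<in> N \<Longrightarrow> p (y - x) < e"
      using seminorm_neighbourhood[OF P.seminorm b] by metis
    then show "\<exists>T. openin (topol X) T \<and> x \<in> T \<and> T \<subseteq> U"
      using p(3) openin_subset[OF N(1)] by (intro exI[of _ N]) auto
  qed
qed

text \<open>The seminorm is the gauge of the balanced core of a convex neighbourhood.\<close>

lemma seminorm_below_neighbourhood:
  assumes W: "openin (topol X) W" "0 \<in> W"
  obtains p where "seminorm_on (und X) p" "bounded_near_zero X p"
    "\<And>x. x \<in> car (und X) \<Longrightarrow> p x < 1 \<Longrightarrow> x \<in> W"
proof -
  let ?s = "scl (und X)"
  obtain U C where U: "openin (topol X) U" "0 \<in> U" "U \<subseteq> C" and C: "convex_in (und X) C" "C \<subseteq> W"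
  proof -
    have "neighbourhood_base_at 0 (convex_in (und X)) (topol X)" using is_TVS by (simp add: is_TVS_def)
    then show ?thesis using W that unfolding neighbourhood_base_at_def by meson
  qed
  define B where "B = {x \<in> car (und X). \<forall>c. norm c \<le> 1 \<longrightarrow> ?s c x \<in> C}"
  have convB: "?s (of_real a) x + ?s (of_real b) y \<in> B"
    if "x \<in> B" "y \<in> B" "0 \<le> a" "0 \<le> b" "a + b = 1" for x y a b
  proof -
    have "?s c (?s (of_real a) x + ?s (of_real b) y) \<in> C" if "norm c \<le> 1" for c
    proof -
      have "?s c (?s (of_real a) x + ?s (of_real b) y) = ?s (of_real a) (?s c x) + ?s (of_real b) (?s c y)"
        by (simp add: scale_right_distrib mult.commute)
      also have "?s c x \<in> C" "?s c y \<in> C"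
        using \<open>x \<in> B\<close> \<open>y \<in> B\<close> \<open>norm c \<le> 1\<close> by (auto simp: B_def)
      then have "?s (of_real a) (?s c x) + ?s (of_real b) (?s c y) \<in> C"
        using C(1) \<open>0 \<le> a\<close> \<open>0 \<le> b\<close> \<open>a + b = 1\<close> unfolding convex_in_def by blast
      finally show ?thesis .
    qed
    then show ?thesis using that by (auto simp: B_def)
  qed
  have balB: "?s c x \<in> B" if "x \<in> B" "norm c \<le> 1" for c x
    using that by (auto simp: B_def norm_mult mult_le_one)
  have BW: "x \<in> W" if "x \<in> B" for x
  proof -
    have "?s 1 x \<in> C" using that unfolding B_def by (metis (mono_tags) mem_Collect_eq norm_one order_refl)
    then show ?thesis using C(2) by auto
  qed
  \<comment> \<open>The factor d / 2 in place of d keeps the norm of c d / 2 strictly below d for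
    every c of norm at most 1.\<close>
  have inB: "?s (of_real (d / 2)) x \<in> B"
    if "d > 0" "\<And>c. norm c < d \<Longrightarrow> ?s c x \<in> U" "x \<in> car (und X)" for d x
  proof -
    have "?s c (?s (of_real (d / 2)) x) \<in> C" if "norm c \<le> 1" for c
    proof -
      have "norm c * (d / 2) \<le> 1 * (d / 2)" using \<open>d > 0\<close> that by (intro mult_right_mono) auto
      then have "norm (c * of_real (d / 2)) < d" using \<open>d > 0\<close> by (simp add: norm_mult)
      then show ?thesis using \<open>\<And>c. norm c < d \<Longrightarrow> ?s c x \<in> U\<close> U(3) by auto
    qed
    then show ?thesis using that(3) by (simp add: B_def)
  qed
  define T where "T x = {t. t > 0 \<and> ?s (of_real (1 / t)) x \<in> B}" for x
  define p where "p x = Inf (T x)" for x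
  have bdd: "bdd_below (T x)" for x by (rule bdd_belowI[of _ 0]) (simp add: T_def)
  \<comment> \<open>\<open>B\<close> is absorbing: c \<mapsto> c x is continuous at 0, so small
    multiples of x lie in U.\<close>
  have Tne: "T x \<noteq> {}" if x: "x \<in> car (und X)" for x
  proof -
    have "openin euclidean {c \<in> topspace euclidean. ?s c x \<in> U}"
      using openin_continuous_map_preimage[OF scale_continuous[OF x] U(1)] .
    then have "open {c. ?s c x \<in> U}" by simp
    moreover have "0 \<in> {c. ?s c x \<in> U}" using U(2) by simp
    ultimately obtain d where "d > 0" "\<And>c. norm c < d \<Longrightarrow> ?s c x \<in> U"
      unfolding open_dist by (metis dist_0_norm dist_commute mem_Collect_eq)
    then have "2 / d \<in> T x" using inB[of d x] x by (simp add: T_def)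
    then show ?thesis by blast
  qed
  have p_le: "p x \<le> t" if "t \<in> T x" for x t unfolding p_def using bdd that by (rule cInf_lower[rotated])
  have le_p: "b \<le> p x" if "x \<in> car (und X)" "\<And>t. t \<in> T x \<Longrightarrow> b \<le> t" for b x
    unfolding p_def using Tne[OF that(1)] that(2) by (rule cInf_greatest)
  have addT: "t + r \<in> T (x + y)" if "t \<in> T x" "r \<in> T y" for t r x y
  proof -
    have pos: "t > 0" "r > 0" using that by (auto simp: T_def)
    \<comment> \<open>The point (x + y) / (t + r) is the convex combination of x / t and y / r with
      weights t / (t + r) and r / (t + r).\<close>
    have "?s (of_real (t / (t + r))) (?s (of_real (1 / t)) x) + ?s (of_real (r / (t + r))) (?s (of_real (1 / r)) y) \<in> B"
      using that pos by (intro convB) (auto simp: T_def add_divide_distrib[symmetric])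
    also have "?s (of_real (t / (t + r))) (?s (of_real (1 / t)) x) + ?s (of_real (r / (t + r))) (?s (of_real (1 / r)) y)
        = ?s (of_real (1 / (t + r))) (x + y)"
      using pos by (simp add: scale_right_distrib of_real_mult[symmetric] of_real_divide[symmetric]
          del: of_real_mult of_real_divide)
    finally show ?thesis using pos by (simp add: T_def)
  qed
  have scT: "norm c * t \<in> T (?s c x)" if "t \<in> T x" "c \<noteq> 0" for c t x
  proof -
    have pos: "t > 0" using that by (auto simp: T_def)
    \<comment> \<open>The phase c / |c| is absorbed because \<open>B\<close> is balanced, which
      leaves only the factor |c|.\<close>
    have "?s (c / of_real (norm c)) (?s (of_real (1 / t)) x) \<in> B"
      by (rule balB) (use that in \<open>auto simp: T_def norm_divide\<close>)
    also have "?s (c / of_real (norm c)) (?s (of_real (1 / t)) x) = ?s (of_real (1 / (norm c * t))) (?s c x)"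
      by (simp add: mult_ac)
    finally show ?thesis using pos that by (simp add: T_def)
  qed
  have p_nonneg: "p x \<ge> 0" if "x \<in> car (und X)" for x by (rule le_p[OF that]) (simp add: T_def)
  have p_sc_le: "p (?s c x) \<le> norm c * p x" if x: "x \<in> car (und X)" and c: "c \<noteq> 0" for c x
  proof -
    have "p (?s c x) / norm c \<le> p x"
      using p_le[OF scT[OF _ c]] c by (intro le_p[OF x]) (simp add: field_simps)
    then show ?thesis using c by (simp add: field_simps)
  qed
  have p0: "p 0 = 0"
  proof (rule antisym)
    have "0 \<in> B" using U by (auto simp: B_def)
    then have "t \<in> T 0" if "t > 0" for t using that by (simp add: T_def)
    then have "p 0 \<le> 0 + t" if "t > 0" for t using p_le that by simp
    then show "p 0 \<le> 0" by (rule field_le_epsilon)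
    show "0 \<le> p 0" using p_nonneg by simp
  qed
  have "seminorm_on (und X) p"
    unfolding seminorm_on_def
  proof (intro conjI ballI allI)
    fix x y assume x: "x \<in> car (und X)" and y: "y \<in> car (und X)"
    have "p (x + y) - r \<le> p x" if "r \<in> T y" for r
      using p_le[OF addT[OF _ that]] by (intro le_p[OF x]) (simp add: algebra_simps)
    then have "p (x + y) - p x \<le> p y" by (intro le_p[OF y]) (simp add: algebra_simps)
    then show "p (x + y) \<le> p x + p y" by simp
  next
    fix c x assume x: "x \<in> car (und X)"
    show "p (?s c x) = norm c * p x"
    proof (cases "c = 0")
      case False
      \<comment> \<open>The reverse inequality is \<open>p_sc_le\<close> applied to c x and the
        factor 1 / c.\<close>
      have "p (?s (1 / c) (?s c x)) \<le> norm (1 / c) * p (?s c x)"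
        using p_sc_le[of "?s c x" "1 / c"] x False by simp
      then have "norm c * p x \<le> p (?s c x)" using False by (simp add: norm_divide field_simps)
      then show ?thesis using p_sc_le[OF x False] by simp
    qed (simp add: p0)
  qed
  moreover have "bounded_near_zero X p"
  proof -
    \<comment> \<open>Joint continuity of scaling at (0, 0) gives one radius d for all points of a
      neighbourhood N, hence the uniform bound 2 / d.\<close>
    have "openin (prod_topology euclidean (topol X))
        {z \<in> topspace (prod_topology euclidean (topol X)). (\<lambda>(c, x). ?s c x) z \<in> U}"
      using is_TVS U(1) unfolding is_TVS_def by (intro openin_continuous_map_preimage) auto
    moreover have "(0, 0) \<in> {z \<in> topspace (prod_topology euclidean (topol X)). (\<lambda>(c, x). ?s c x) z \<in> U}"
      using U(2) by simp
    ultimately obtain A N where A: "openin euclidean A" "0 \<in> A" and N: "openin (topol X) N" "0 \<in> N"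
      and AN: "A \<times> N \<subseteq> {z \<in> topspace (prod_topology euclidean (topol X)). (\<lambda>(c, x). ?s c x) z \<in> U}"
      unfolding openin_prod_topology_alt by blast
    obtain d where d: "d > 0" "\<And>c. norm c < d \<Longrightarrow> c \<in> A"
      using A unfolding open_openin[symmetric] open_dist by (metis dist_0_norm dist_commute)
    have "p x \<le> 2 / d" if "x \<in> N" for x
    proof -
      have "?s c x \<in> U" if "norm c < d" for c using AN d(2)[OF that] \<open>x \<in> N\<close> by auto
      then have "2 / d \<in> T x" using inB[of d x] d(1) that openin_subset[OF N(1)] by (auto simp: T_def)
      then show ?thesis by (rule p_le)
    qed
    then show ?thesis using N unfolding bounded_near_zero_def by blast
  qed
  moreover have "x \<in> W" if x: "x \<in> car (und X)" "p x < 1" for x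
  proof -
    obtain t where t: "t \<in> T x" "t < 1"
      using cInf_lessD[of "T x" 1] Tne[OF x(1)] x(2) by (auto simp: p_def)
    have "?s (of_real t) (?s (of_real (1 / t)) x) \<in> B" by (rule balB) (use t in \<open>auto simp: T_def\<close>)
    moreover have "?s (of_real t) (?s (of_real (1 / t)) x) = x" using t by (simp add: T_def)
    ultimately show ?thesis using BW by simp
  qed
  ultimately show ?thesis using that by blast
qed

end

lemma (in seminorm_family) dominated_if_continuous:
  assumes h: "h \<in> car (alg_dual V)" and cont: "continuous_map (seminorm_topology V P) euclidean h"
  obtains p C where "p \<in> P" "C > 0" "\<And>x. x \<in> car V \<Longrightarrow> norm (h x) \<le> C * p x"
proof -
  have "openin (seminorm_topology V P) {x \<in> topspace (seminorm_topology V P). h x \<in> ball 0 1}"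
    using cont by (rule openin_continuous_map_preimage) simp
  moreover have "0 \<in> {x \<in> topspace (seminorm_topology V P). h x \<in> ball 0 1}"
    using alg_dualD(2)[OF h, of 0 0] by simp
  ultimately obtain p e where p: "p \<in> P" and e: "e > 0"
    and "\<forall>x\<in>car V. p (x - 0) < e \<longrightarrow> x \<in> {x \<in> topspace (seminorm_topology V P). h x \<in> ball 0 1}"
    unfolding openin_iff by blast
  then have b: "\<And>x. x \<in> car V \<Longrightarrow> p x < e \<Longrightarrow> norm (h x) < 1" by simp
  note pD = seminorm_onD[OF seminorm[OF p]]
  have "norm (h x) \<le> (2 / e) * p x" if x: "x \<in> car V" for x
  proof -
    have "norm (h x) \<le> (2 / e) * p x + d" if d: "d > 0" for d
    proof -
      \<comment> \<open>The summand d keeps t positive even where p x = 0. Since e t > p x, the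
        point x / t lies in the ball of radius e, so |h x| < t; then d tends to 0.\<close>
      define t where "t = (2 / e) * p x + d"
      have t: "t > 0" using pD(5)[OF x] e d by (simp add: t_def add_nonneg_pos)
      have "e * t = 2 * p x + e * d" using e by (simp add: t_def field_simps)
      moreover have "e * d > 0" using e d by simp
      ultimately have "p x < e * t" using pD(5)[OF x] by linarith
      then have "p x / t < e" using t by (simp add: pos_divide_less_eq)
      then have "norm (h (scl V (of_real (1 / t)) x)) < 1"
        using b[of "scl V (of_real (1 / t)) x"] pD(2)[OF x, of "of_real (1 / t)"] x t by (simp add: norm_divide)
      then have "norm (h x) < t"
        using alg_dualD(2)[OF h x, of "of_real (1 / t)"] t by (simp add: norm_divide)
      then show ?thesis by (simp add: t_def)
    qed
    then show ?thesis by (rule field_le_epsilon)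
  qed
  then show ?thesis using p e that[of p "2 / e"] by simp
qed

section \<open>The weak and the Mackey topology\<close>

text \<open>Generating the sums inductively lets properties of these seminorms be checked on |w| and
  on sums of two.\<close>

inductive_set weak_seminorms :: "('v \<Rightarrow> 'k::real_normed_vector) set \<Rightarrow> ('v \<Rightarrow> real) set"
  for \<Phi> where
  norm: "w \<in> \<Phi> \<Longrightarrow> (\<lambda>x. norm (w x)) \<in> weak_seminorms \<Phi>"
| add: "p \<in> weak_seminorms \<Phi> \<Longrightarrow> q \<in> weak_seminorms \<Phi> \<Longrightarrow> (\<lambda>x. p x + q x) \<in> weak_seminorms \<Phi>"

text \<open>In terms of polars: the polar of the unit ball of p, taken in the algebraic dual, lies
  in \<Phi>. Such polars are automatically weakly compact, which links the definition to the
  classical description of the Mackey topology.\<close>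

definition mackey_seminorms ::
  "('k::real_normed_field, 'v::ab_group_add) vspace \<Rightarrow> ('v \<Rightarrow> 'k) set \<Rightarrow> ('v \<Rightarrow> real) set" where
  "mackey_seminorms V \<Phi> = {p. seminorm_on V p \<and>
     (\<forall>h\<in>car (alg_dual V). (\<forall>x\<in>car V. norm (h x) \<le> p x) \<longrightarrow> h \<in> \<Phi>)}"

lemma mackey_seminormsD:
  assumes "p \<in> mackey_seminorms V \<Phi>"
  shows "seminorm_on V p"
    and "h \<in> car (alg_dual V) \<Longrightarrow> (\<And>x. x \<in> car V \<Longrightarrow> norm (h x) \<le> p x) \<Longrightarrow> h \<in> \<Phi>"
  using assms by (auto simp: mackey_seminorms_def)

text \<open>The flag \<open>m\<close> selects the Mackey case, so that the weak and the Mackey case are treated together.\<close>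

definition dual_seminorms ::
  "bool \<Rightarrow> ('k::real_normed_field, 'v::ab_group_add) vspace \<Rightarrow> ('v \<Rightarrow> 'k) set \<Rightarrow> ('v \<Rightarrow> real) set" where
  "dual_seminorms m V \<Phi> = (if m then mackey_seminorms V \<Phi> else weak_seminorms \<Phi>)"

abbreviation dual_seminorm_topology where
  "dual_seminorm_topology m V \<Phi> \<equiv> seminorm_topology V (dual_seminorms m V \<Phi>)"

lemma is_vspace_ground: "is_vspace (ground :: ('k::real_normed_field, 'k) vspace)"
  unfolding is_vspace_def ground_def vspace.simps
  using vector_space_over_itself.subspace_UNIV vector_space_over_itself.vector_space_axioms by blast

lemma seminorm_on_norm_functional:
  "h \<in> car (alg_dual V) \<Longrightarrow> seminorm_on V (\<lambda>x. norm (h x))"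
  by (simp add: seminorm_on_def alg_dualD norm_triangle_ineq norm_mult)

lemma seminorm_on_add:
  assumes "seminorm_on V p" "seminorm_on V q"
  shows "seminorm_on V (\<lambda>x. p x + q x)"
proof -
  have "p (x + y) + q (x + y) \<le> (p x + q x) + (p y + q y)" if "x \<in> car V" "y \<in> car V" for x y
    using assms that add_mono[of "p (x + y)" "p x + p y" "q (x + y)" "q x + q y"]
    by (simp add: seminorm_on_def)
  then show ?thesis using assms by (simp add: seminorm_on_def distrib_left)
qed

text \<open>Only the set of functionals is kept, not the space that parametrises it. Two pairs with
  the same left space and the same functionals therefore have literally the same weak and Mackey
  topologies.\<close>

locale dual_pair = vspace_on V
  for V :: "('k::{real_normed_field,euclidean_space}, 'v::ab_group_add) vspace" +
  fixes \<Phi> :: "('v \<Rightarrow> 'k) set"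
  assumes functionals: "\<Phi> \<subseteq> car (alg_dual V)"
    and functional_add: "w \<in> \<Phi> \<Longrightarrow> w' \<in> \<Phi> \<Longrightarrow> (\<lambda>x. w x + w' x) \<in> \<Phi>"
    and functional_scale: "w \<in> \<Phi> \<Longrightarrow> (\<lambda>x. c * w x) \<in> \<Phi>"
    and functional_ex: "\<Phi> \<noteq> {}"
    and separating: "x \<in> car V \<Longrightarrow> (\<And>w. w \<in> \<Phi> \<Longrightarrow> w x = 0) \<Longrightarrow> x = 0"

lemma lin_mapsD:
  assumes "f \<in> lin_maps V W"
  shows "x \<in> car V \<Longrightarrow> f x \<in> car W" "x \<in> car V \<Longrightarrow> y \<in> car V \<Longrightarrow> f (x + y) = f x + f y"
    "x \<in> car V \<Longrightarrow> f (scl V c x) = scl W c (f x)" "x \<notin> car V \<Longrightarrow> f x = 0"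
  using assms by (auto simp: lin_maps_def)

lemma lin_mapsI:
  assumes "\<And>x. x \<in> car V \<Longrightarrow> f x \<in> car W" "\<And>x y. x \<in> car V \<Longrightarrow> y \<in> car V \<Longrightarrow> f (x + y) = f x + f y"
    "\<And>c x. x \<in> car V \<Longrightarrow> f (scl V c x) = scl W c (f x)" "\<And>x. x \<notin> car V \<Longrightarrow> f x = 0"
  shows "f \<in> lin_maps V W"
  using assms by (auto simp: lin_maps_def)

lemma alg_dual_as_lin_maps: "h \<in> car (alg_dual V) \<longleftrightarrow> h \<in> lin_maps V ground"
  by (simp add: hom_space_def)

lemma alg_dual_compose:
  assumes f: "f \<in> lin_maps V W" and h: "h \<in> car (alg_dual W)"
  shows "(\<lambda>x. h (f x)) \<in> car (alg_dual V)"
proof (rule alg_dualI)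
  have "h 0 = 0" using alg_dualD(1)[OF h, of 0 0] alg_dualD(3)[OF h, of 0] by fastforce
  then show "x \<notin> car V \<Longrightarrow> h (f x) = 0" for x using lin_mapsD(4)[OF f] by simp
qed (use lin_mapsD[OF f] alg_dualD[OF h] in auto)

text \<open>A functional below q o f factors as \<open>h2\<close> o f with \<open>h2\<close> below
  q: it descends to the range of f and is extended from there. This is the split with p = 0, which
  forces \<open>h1\<close> to vanish.\<close>

lemma mackey_seminorms_pullback:
  fixes V :: "('k::{real_normed_field,euclidean_space}, 'v::ab_group_add) vspace"
    and W :: "('k, 'w::ab_group_add) vspace"
  assumes V: "is_vspace V" and W: "is_vspace W" and f: "f \<in> lin_maps V W"
    and pull: "\<And>w. w \<in> \<Psi> \<Longrightarrow> (\<lambda>x. w (f x)) \<in> \<Phi>" and q: "q \<in> mackey_seminorms W \<Psi>"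
  shows "(\<lambda>x. q (f x)) \<in> mackey_seminorms V \<Phi>"
proof -
  interpret V: vspace_on V by unfold_locales fact
  interpret W: vspace_on W by unfold_locales fact
  have qs: "seminorm_on W q" using q by (simp add: mackey_seminorms_def)
  have "h \<in> \<Phi>" if h: "h \<in> car (alg_dual V)" and le: "\<And>x. x \<in> car V \<Longrightarrow> norm (h x) \<le> q (f x)" for h
  proof -
    have "seminorm_on V (\<lambda>x. 0)" by (simp add: seminorm_on_def)
    moreover have "norm (h x) \<le> 0 + q (f x)" if "x \<in> car V" for x using le[OF that] by simp
    ultimately obtain h1 h2 where h2: "h2 \<in> car (alg_dual W)" "\<And>y. y \<in> car W \<Longrightarrow> norm (h2 y) \<le> q y"
      and h1: "\<And>x. x \<in> car V \<Longrightarrow> norm (h1 x) \<le> 0" and sum: "\<And>x. x \<in> car V \<Longrightarrow> h x = h1 x + h2 (f x)"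
      using hahn_banach_split[OF V W _ qs f h] by metis
    have "h2 \<in> \<Psi>" using mackey_seminormsD(2)[OF q h2] .
    moreover have "h = (\<lambda>x. h2 (f x))"
    proof
      show "h x = h2 (f x)" for x
      proof (cases "x \<in> car V")
        case True
        then show ?thesis using sum[OF True] h1[OF True] by simp
      next
        case False
        then show ?thesis using alg_dualD(3)[OF h False] alg_dualD(3)[OF alg_dual_compose[OF f h2(1)] False] by simp
      qed
    qed
    ultimately show ?thesis using pull by simp
  qed
  moreover have "seminorm_on V (\<lambda>x. q (f x))"
    using qs lin_mapsD[OF f] by (simp add: seminorm_on_def)
  ultimately show ?thesis by (simp add: mackey_seminorms_def)
qed

lemma norm_mem_mackey_seminorms_ground:
  "norm \<in> mackey_seminorms ground (car (alg_dual (ground :: ('k::real_normed_field, 'k) vspace)))"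
  by (auto simp: mackey_seminorms_def seminorm_on_def ground_def norm_triangle_ineq norm_mult)

context dual_pair
begin

lemma mackey_seminorms_add:
  assumes p: "p \<in> mackey_seminorms V \<Phi>" and q: "q \<in> mackey_seminorms V \<Phi>"
  shows "(\<lambda>x. p x + q x) \<in> mackey_seminorms V \<Phi>"
proof -
  \<comment> \<open>The identity in the encoding of linear maps, with value 0 outside the carrier.
    Splitting along it writes h as a functional below p plus one below q.\<close>
  define f where "f x = (if x \<in> car V then x else 0)" for x
  have f: "f \<in> lin_maps V V" by (auto simp: f_def lin_maps_def)
  have ps: "seminorm_on V p" and qs: "seminorm_on V q" using p q by (auto simp: mackey_seminorms_def)
  have "h \<in> \<Phi>" if h: "h \<in> car (alg_dual V)" and le: "\<And>x. x \<in> car V \<Longrightarrow> norm (h x) \<le> p x + q x" for h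
  proof -
    have "norm (h x) \<le> p x + q (f x)" if "x \<in> car V" for x using le that by (simp add: f_def)
    then obtain h1 h2 where h1: "h1 \<in> car (alg_dual V)" "\<And>x. x \<in> car V \<Longrightarrow> norm (h1 x) \<le> p x"
      and h2: "h2 \<in> car (alg_dual V)" "\<And>x. x \<in> car V \<Longrightarrow> norm (h2 x) \<le> q x"
      and sum: "\<And>x. x \<in> car V \<Longrightarrow> h x = h1 x + h2 (f x)"
      using hahn_banach_split[OF is_vspace is_vspace ps qs f h] by metis
    have "h1 \<in> \<Phi>" "h2 \<in> \<Phi>" using mackey_seminormsD(2)[OF p h1] mackey_seminormsD(2)[OF q h2] by auto
    moreover have "h = (\<lambda>x. h1 x + h2 x)"
    proof
      show "h x = h1 x + h2 x" for x
        using sum[of x] alg_dualD(3)[OF h] alg_dualD(3)[OF h1(1)] alg_dualD(3)[OF h2(1)]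
        by (cases "x \<in> car V") (auto simp: f_def)
    qed
    ultimately show ?thesis using functional_add by simp
  qed
  then show ?thesis using seminorm_on_add[OF ps qs] by (simp add: mackey_seminorms_def)
qed

text \<open>|w| is the pullback of the norm along w. Linear functionals on the scalars are
  multiplications by a constant, so their pullbacks are multiples of w.\<close>

lemma weak_seminorms_subset_mackey_seminorms: "weak_seminorms \<Phi> \<subseteq> mackey_seminorms V \<Phi>"
proof
  fix p assume "p \<in> weak_seminorms \<Phi>"
  then show "p \<in> mackey_seminorms V \<Phi>"
  proof induction
    case (norm w)
    then have w: "w \<in> lin_maps V ground" using functionals by (auto simp: alg_dual_as_lin_maps)
    have "(\<lambda>x. h (w x)) \<in> \<Phi>" if h: "h \<in> car (alg_dual ground)" for h
    proof -
      have "h (w x) = h 1 * w x" for x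
        using alg_dualD(2)[OF h, of 1 "w x"] by (simp add: ground_def mult.commute)
      then show ?thesis using functional_scale[OF norm, of "h 1"] by simp
    qed
    then show ?case
      using mackey_seminorms_pullback[OF is_vspace is_vspace_ground w _ norm_mem_mackey_seminorms_ground] by simp
  qed (rule mackey_seminorms_add)
qed

lemma dual_seminorms_subset: "dual_seminorms m V \<Phi> \<subseteq> mackey_seminorms V \<Phi>"
  using weak_seminorms_subset_mackey_seminorms by (simp add: dual_seminorms_def)

lemma norm_mem_dual_seminorms: "w \<in> \<Phi> \<Longrightarrow> (\<lambda>x. norm (w x)) \<in> dual_seminorms m V \<Phi>"
  using weak_seminorms_subset_mackey_seminorms by (auto simp: dual_seminorms_def intro: weak_seminorms.norm)

sublocale seminorms: seminorm_family V "dual_seminorms m V \<Phi>" for m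
proof
  show "seminorm_on V p" if "p \<in> dual_seminorms m V \<Phi>" for p
    using dual_seminorms_subset that by (auto simp: mackey_seminorms_def)
  show "(\<lambda>x. p x + q x) \<in> dual_seminorms m V \<Phi>"
    if "p \<in> dual_seminorms m V \<Phi>" "q \<in> dual_seminorms m V \<Phi>" for p q
    using that mackey_seminorms_add by (auto simp: dual_seminorms_def intro: weak_seminorms.add)
  show "dual_seminorms m V \<Phi> \<noteq> {}" using functional_ex norm_mem_dual_seminorms by blast
qed

lemma is_TVS_dual_seminorm_topology: "is_TVS \<lparr>und = V, topol = dual_seminorm_topology m V \<Phi>\<rparr>"
  by (rule seminorms.is_TVS_seminorm_topology) (metis norm_mem_dual_seminorms norm_eq_zero separating)

text \<open>Each w is dominated by its own |w|. Conversely a continuous h is at most C p, so h / C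
  lies below a seminorm that dominates only members of \<Phi>. Weak seminorms are Mackey seminorms
  too, so one argument serves both flags.\<close>

lemma top_dual_dual_seminorm_topology:
  "car (top_dual \<lparr>und = V, topol = dual_seminorm_topology m V \<Phi>\<rparr>) = \<Phi>" (is "car (top_dual ?X) = _")
proof
  interpret X: tvs_on ?X by unfold_locales (rule is_TVS_dual_seminorm_topology)
  show "\<Phi> \<subseteq> car (top_dual ?X)"
  proof
    fix w assume w: "w \<in> \<Phi>"
    then show "w \<in> car (top_dual ?X)"
      using seminorms.bounded_near_zero_seminorm[OF norm_mem_dual_seminorms[OF w]] functionals
        seminorm_on_norm_functional[of w V]
      by (intro X.top_dual_if_dominated[of "\<lambda>x. norm (w x)"]) auto
  qed
  show "car (top_dual ?X) \<subseteq> \<Phi>"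
  proof
    fix h assume "h \<in> car (top_dual ?X)"
    then have h: "h \<in> car (alg_dual V)" "continuous_map (dual_seminorm_topology m V \<Phi>) euclidean h"
      by (auto simp: top_dual_iff)
    then obtain p C where p: "p \<in> dual_seminorms m V \<Phi>" and C: "C > 0"
      and le: "\<And>x. x \<in> car V \<Longrightarrow> norm (h x) \<le> C * p x"
      using seminorms.dominated_if_continuous by blast
    have "p \<in> mackey_seminorms V \<Phi>" using p dual_seminorms_subset by blast
    moreover have "(\<lambda>x. of_real (1 / C) * h x) \<in> car (alg_dual V)"
      using alg_dualD[OF h(1)] by (intro alg_dualI) (auto simp: algebra_simps)
    moreover have "norm (of_real (1 / C) * h x) \<le> p x" if "x \<in> car V" for x
      using le[OF that] C by (simp add: norm_mult norm_divide field_simps)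
    ultimately have "(\<lambda>x. of_real (1 / C) * h x) \<in> \<Phi>" by (rule mackey_seminormsD(2))
    from functional_scale[OF this, of "of_real C"] show "h \<in> \<Phi>" using C by simp
  qed
qed

text \<open>Each |w| is bounded near zero for T, so T refines the weak topology. A T-neighbourhood
  of 0 contains the open unit ball of a T-continuous seminorm; functionals below that seminorm are
  T-continuous, hence in \<Phi>, so it is a Mackey seminorm.\<close>

lemma
  assumes "is_TVS \<lparr>und = V, topol = T\<rparr>" and dual: "car (top_dual \<lparr>und = V, topol = T\<rparr>) = \<Phi>"
  shows weak_topology_weakest: "weaker_topology (dual_seminorm_topology False V \<Phi>) T"
    and mackey_topology_strongest: "weaker_topology T (dual_seminorm_topology True V \<Phi>)"
proof -
  interpret X: tvs_on "\<lparr>und = V, topol = T\<rparr>" by unfold_locales fact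
  have "bounded_near_zero \<lparr>und = V, topol = T\<rparr> p" if "p \<in> weak_seminorms \<Phi>" for p
    using that X.bounded_near_zero_top_dual unfolding dual
    by induction (auto intro: bounded_near_zero_add)
  then show "weaker_topology (dual_seminorm_topology False V \<Phi>) T"
    using X.weaker_seminorm_topology[of "weak_seminorms \<Phi>"] seminorms.seminorm_family_axioms[of False]
    by (simp add: dual_seminorms_def)
  show "weaker_topology T (dual_seminorm_topology True V \<Phi>)"
    unfolding weaker_topology_def seminorms.openin_iff
  proof (intro allI impI conjI ballI)
    fix U assume U: "openin T U"
    then show sub: "U \<subseteq> car V" using openin_subset[OF U] X.topspace_topol by simp
    fix x assume x: "x \<in> U"
    then have xV: "x \<in> car V" using sub by blast
    \<comment> \<open>The set is translated to the origin; the factor 1 matches the form of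
      \<open>affine_continuous\<close>.\<close>
    define N where "N = {y \<in> topspace T. scl V 1 (y + x) \<in> U}"
    have "openin T N"
      unfolding N_def using X.affine_continuous[of x 1] xV U by (intro openin_continuous_map_preimage) auto
    moreover have "0 \<in> N" using x xV X.topspace_topol by (simp add: N_def)
    ultimately obtain p where p: "seminorm_on V p" "bounded_near_zero \<lparr>und = V, topol = T\<rparr> p"
      "\<And>y. y \<in> car V \<Longrightarrow> p y < 1 \<Longrightarrow> y \<in> N"
      using X.seminorm_below_neighbourhood[of N] by auto
    have "p \<in> mackey_seminorms V \<Phi>"
      using p(1) X.top_dual_if_dominated[OF _ p(2)] dual by (auto simp: mackey_seminorms_def)
    moreover have "y \<in> U" if "y \<in> car V" "p (y - x) < 1" for y
      using p(3)[of "y - x"] that xV by (simp add: N_def)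
    ultimately show "\<exists>p\<in>dual_seminorms True V \<Phi>. \<exists>e>0. \<forall>y\<in>car V. p (y - x) < e \<longrightarrow> y \<in> U"
      unfolding dual_seminorms_def by (intro bexI[of _ p] exI[of _ 1]) auto
  qed
qed

end

section \<open>Pairs in chu as dual pairs, and their extremal topologies\<close>

definition functionals_of :: "('k::real_normed_field, 'v::ab_group_add, 'w::ab_group_add) chu \<Rightarrow> ('v \<Rightarrow> 'k) set" where
  "functionals_of A = (\<lambda>w v. pairing A v w) ` car (rgt A)"

lemma pairingD:
  assumes "pairing A \<in> bil_maps (lft A) (rgt A) ground"
  shows "v \<in> car (lft A) \<Longrightarrow> v' \<in> car (lft A) \<Longrightarrow> pairing A (v + v') w = pairing A v w + pairing A v' w"
    and "v \<in> car (lft A) \<Longrightarrow> pairing A (scl (lft A) c v) w = c * pairing A v w"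
    and "v \<in> car (lft A) \<Longrightarrow> w \<in> car (rgt A) \<Longrightarrow> w' \<in> car (rgt A) \<Longrightarrow>
      pairing A v (w + w') = pairing A v w + pairing A v w'"
    and "v \<in> car (lft A) \<Longrightarrow> w \<in> car (rgt A) \<Longrightarrow> pairing A v (scl (rgt A) c w) = c * pairing A v w"
    and "v \<notin> car (lft A) \<Longrightarrow> pairing A v w = 0" and "w \<notin> car (rgt A) \<Longrightarrow> pairing A v w = 0"
proof -
  note D = lin_mapsD[OF assms, unfolded hom_space_def]
  show "v \<in> car (lft A) \<Longrightarrow> v' \<in> car (lft A) \<Longrightarrow> pairing A (v + v') w = pairing A v w + pairing A v' w"
    using D(2) by simp
  show "v \<in> car (lft A) \<Longrightarrow> pairing A (scl (lft A) c v) w = c * pairing A v w"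
    using D(3) by (simp add: ground_def)
  have l: "v \<in> car (lft A) \<Longrightarrow> pairing A v \<in> lin_maps (rgt A) ground" for v using D(1) by simp
  show "v \<in> car (lft A) \<Longrightarrow> w \<in> car (rgt A) \<Longrightarrow> w' \<in> car (rgt A) \<Longrightarrow>
      pairing A v (w + w') = pairing A v w + pairing A v w'" using lin_mapsD(2)[OF l] by blast
  show "v \<in> car (lft A) \<Longrightarrow> w \<in> car (rgt A) \<Longrightarrow> pairing A v (scl (rgt A) c w) = c * pairing A v w"
    using lin_mapsD(3)[OF l] by (simp add: ground_def)
  show z: "v \<notin> car (lft A) \<Longrightarrow> pairing A v w = 0" for v using D(4) by simp
  show "w \<notin> car (rgt A) \<Longrightarrow> pairing A v w = 0"
    using lin_mapsD(4)[OF l] z by (cases "v \<in> car (lft A)") auto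
qed

lemma pairing_bil_mapsI:
  assumes "\<And>v v' w. v \<in> car V \<Longrightarrow> v' \<in> car V \<Longrightarrow> w \<in> car W \<Longrightarrow> b (v + v') w = b v w + b v' w"
    and "\<And>c v w. v \<in> car V \<Longrightarrow> w \<in> car W \<Longrightarrow> b (scl V c v) w = c * b v w"
    and "\<And>v w w'. v \<in> car V \<Longrightarrow> w \<in> car W \<Longrightarrow> w' \<in> car W \<Longrightarrow> b v (w + w') = b v w + b v w'"
    and "\<And>c v w. v \<in> car V \<Longrightarrow> w \<in> car W \<Longrightarrow> b v (scl W c w) = c * b v w"
    and "is_vspace V" "is_vspace W"
  shows "on_carriers V W b \<in> bil_maps V W ground"
proof -
  interpret V: vspace_on V by unfold_locales fact
  interpret W: vspace_on W by unfold_locales fact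
  show ?thesis
    using assms(1-4) by (auto simp: lin_maps_def hom_space_def on_carriers_def ground_def fun_eq_iff)
qed

lemma pairing_zero:
  assumes "is_chu A"
  shows "pairing A 0 w = 0" "pairing A v 0 = 0"
proof -
  have b: "pairing A \<in> bil_maps (lft A) (rgt A) ground" using assms by (simp add: is_chu_def)
  interpret L: vspace_on "lft A" using assms by unfold_locales (simp add: is_chu_def)
  interpret R: vspace_on "rgt A" using assms by unfold_locales (simp add: is_chu_def)
  show "pairing A 0 w = 0" using pairingD(2)[OF b, of 0 0 w] by simp
  show "pairing A v 0 = 0" using pairingD(4)[OF b, of v 0 0] pairingD(5)[OF b, of v 0]
    by (cases "v \<in> car (lft A)") auto
qed

lemma is_chuI:
  fixes A :: "('k::real_normed_field, 'v::ab_group_add, 'w::ab_group_add) chu"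
  assumes "is_vspace (lft A)" "is_vspace (rgt A)" and b: "pairing A \<in> bil_maps (lft A) (rgt A) ground"
    and l: "\<And>v. v \<in> car (lft A) \<Longrightarrow> (\<And>w. w \<in> car (rgt A) \<Longrightarrow> pairing A v w = 0) \<Longrightarrow> v = 0"
    and r: "\<And>w. w \<in> car (rgt A) \<Longrightarrow> (\<And>v. v \<in> car (lft A) \<Longrightarrow> pairing A v w = 0) \<Longrightarrow> w = 0"
  shows "is_chu A"
proof -
  interpret L: vspace_on "lft A" by unfold_locales fact
  interpret R: vspace_on "rgt A" by unfold_locales fact
  note D = pairingD[OF b]
  have "v = v'" if "v \<in> car (lft A)" "v' \<in> car (lft A)" "pairing A v = pairing A v'" for v v'
  proof -
    have "pairing A (v - v') w = 0" for w
      using D(1)[of "v - v'" v' w] that by simp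
    then show ?thesis using l[of "v - v'"] that by simp
  qed
  moreover have "w = w'" if "w \<in> car (rgt A)" "w' \<in> car (rgt A)" "(\<lambda>v. pairing A v w) = (\<lambda>v. pairing A v w')" for w w'
  proof -
    have "pairing A v (w - w') = 0" if v: "v \<in> car (lft A)" for v
      using D(3)[OF v, of "w - w'" w'] fun_cong[OF \<open>(\<lambda>v. pairing A v w) = (\<lambda>v. pairing A v w')\<close>, of v]
        \<open>w \<in> car (rgt A)\<close> \<open>w' \<in> car (rgt A)\<close> by simp
    then show ?thesis using r[of "w - w'"] that by simp
  qed
  ultimately show ?thesis using assms by (simp add: is_chu_def inj_on_def)
qed

lemma is_chuD:
  assumes A: "is_chu A"
  shows "is_vspace (lft A)" "is_vspace (rgt A)" "pairing A \<in> bil_maps (lft A) (rgt A) ground"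
    and "v \<in> car (lft A) \<Longrightarrow> (\<And>w. w \<in> car (rgt A) \<Longrightarrow> pairing A v w = 0) \<Longrightarrow> v = 0"
    and "w \<in> car (rgt A) \<Longrightarrow> (\<And>v. v \<in> car (lft A) \<Longrightarrow> pairing A v w = 0) \<Longrightarrow> w = 0"
proof -
  show V: "is_vspace (lft A)" and W: "is_vspace (rgt A)" and b: "pairing A \<in> bil_maps (lft A) (rgt A) ground"
    using A by (auto simp: is_chu_def)
  interpret L: vspace_on "lft A" by unfold_locales fact
  interpret R: vspace_on "rgt A" by unfold_locales fact
  have inj: "inj_on (pairing A) (car (lft A))" "inj_on (\<lambda>w v. pairing A v w) (car (rgt A))"
    using A by (auto simp: is_chu_def)
  show "v = 0" if v: "v \<in> car (lft A)" "\<And>w. w \<in> car (rgt A) \<Longrightarrow> pairing A v w = 0"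
  proof -
    have "pairing A v = pairing A 0"
      using v(2) pairingD(6)[OF b, of _ v] pairing_zero(1)[OF A] by (auto simp: fun_eq_iff)
    then show ?thesis using inj_onD[OF inj(1)] v by simp
  qed
  show "w = 0" if w: "w \<in> car (rgt A)" "\<And>v. v \<in> car (lft A) \<Longrightarrow> pairing A v w = 0"
  proof -
    have "(\<lambda>v. pairing A v w) = (\<lambda>v. pairing A v 0)"
      using w(2) pairingD(5)[OF b, of _ w] pairing_zero(2)[OF A] by (auto simp: fun_eq_iff)
    then show ?thesis using inj_onD[OF inj(2)] w by simp
  qed
qed

lemma dual_pair_functionals_of:
  fixes A :: "('k::{real_normed_field,euclidean_space}, 'v::ab_group_add, 'w::ab_group_add) chu"
  assumes A: "is_chu A"
  shows "dual_pair (lft A) (functionals_of A)"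
proof -
  note [simp] = is_chuD(1,2)[OF A]
  interpret L: vspace_on "lft A" by unfold_locales simp
  interpret R: vspace_on "rgt A" by unfold_locales simp
  note D = pairingD[OF is_chuD(3)[OF A]]
  show ?thesis
  proof
    show "functionals_of A \<subseteq> car (alg_dual (lft A))"
      using D by (auto simp: functionals_of_def intro!: alg_dualI)
    show "functionals_of A \<noteq> {}" using R.car_closed(1) by (auto simp: functionals_of_def)
    show "x = 0" if "x \<in> car (lft A)" "\<And>w. w \<in> functionals_of A \<Longrightarrow> w x = 0" for x
      using that by (intro is_chuD(4)[OF A]) (auto simp: functionals_of_def)
    fix h assume "h \<in> functionals_of A"
    then obtain w where w: "w \<in> car (rgt A)" "h = (\<lambda>v. pairing A v w)" by (auto simp: functionals_of_def)
    have "(\<lambda>x. c * h x) = (\<lambda>v. pairing A v (scl (rgt A) c w))" for c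
      unfolding w(2) using D(4)[OF _ w(1)] D(5) by (metis mult_zero_right)
    then show "(\<lambda>x. c * h x) \<in> functionals_of A" for c using w by (auto simp: functionals_of_def)
    fix h' assume "h' \<in> functionals_of A"
    then obtain w' where w': "w' \<in> car (rgt A)" "h' = (\<lambda>v. pairing A v w')" by (auto simp: functionals_of_def)
    have "(\<lambda>x. h x + h' x) = (\<lambda>v. pairing A v (w + w'))"
      unfolding w(2) w'(2) using D(3)[OF _ w(1) w'(1)] D(5) by (metis add_0)
    then show "(\<lambda>x. h x + h' x) \<in> functionals_of A" using w w' by (auto simp: functionals_of_def)
  qed
qed

text \<open>Injectivity of w \<mapsto> <-, w> is contained in \<open>is_chu\<close>, so bijectivity
  onto the topological dual becomes an equality of sets of functionals.\<close>

lemma dual_topology_iff: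
  assumes A: "is_chu A"
  shows "dual_topology A T \<longleftrightarrow> is_TVS \<lparr>und = lft A, topol = T\<rparr> \<and>
    car (top_dual \<lparr>und = lft A, topol = T\<rparr>) = functionals_of A"
  using A by (auto simp: dual_topology_def bij_betw_def functionals_of_def is_chu_def)

lemma weaker_topology_antisym: "weaker_topology S T \<Longrightarrow> weaker_topology T S \<Longrightarrow> S = T"
  by (auto simp: weaker_topology_def topology_eq)

definition top_of ::
  "bool \<Rightarrow> ('k::real_normed_field, 'v::ab_group_add, 'w::ab_group_add) chu \<Rightarrow> 'v topology" where
  "top_of m A = (if m then tau_top A else sigma_top A)"

text \<open>Both definite descriptions are evaluated here: the seminorm topologies are themselves
  dual topologies and extremal among them, and mutual comparison forces uniqueness.\<close>

theorem top_of_eq: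
  fixes A :: "('k::{real_normed_field,euclidean_space}, 'v::ab_group_add, 'w::ab_group_add) chu"
  assumes A: "is_chu A"
  shows "top_of m A = dual_seminorm_topology m (lft A) (functionals_of A)"
proof -
  interpret dual_pair "lft A" "functionals_of A" using A by (rule dual_pair_functionals_of)
  let ?T = "\<lambda>m. dual_seminorm_topology m (lft A) (functionals_of A)"
  have dual: "dual_topology A (?T m)" for m
    using A is_TVS_dual_seminorm_topology top_dual_dual_seminorm_topology by (simp add: dual_topology_iff)
  have "weaker_topology (?T False) T" "weaker_topology T (?T True)" if "dual_topology A T" for T
    using that weak_topology_weakest mackey_topology_strongest A by (auto simp: dual_topology_iff)
  note extremal = this
  have "sigma_top A = ?T False"
    unfolding sigma_top_def
    by (rule the_equality) (use dual extremal weaker_topology_antisym in blast)+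
  moreover have "tau_top A = ?T True"
    unfolding tau_top_def
    by (rule the_equality) (use dual extremal weaker_topology_antisym in blast)+
  ultimately show ?thesis by (simp add: top_of_def)
qed

section \<open>Continuous linear maps and biduality\<close>

lemma is_vspaceI:
  assumes "vector_space (scl V)" "0 \<in> car V" "\<And>x y. x \<in> car V \<Longrightarrow> y \<in> car V \<Longrightarrow> x + y \<in> car V"
    "\<And>c x. x \<in> car V \<Longrightarrow> scl V c x \<in> car V"
  shows "is_vspace V"
proof -
  interpret vector_space "scl V" by fact
  show ?thesis using assms by (auto simp: is_vspace_def intro: subspaceI)
qed

lemma is_vspace_function_space:
  assumes "is_vspace W" "0 \<in> S" "\<And>f g. f \<in> S \<Longrightarrow> g \<in> S \<Longrightarrow> f + g \<in> S"
    "\<And>c f. f \<in> S \<Longrightarrow> (\<lambda>x. scl W c (f x)) \<in> S"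
  shows "is_vspace \<lparr>car = S, scl = \<lambda>c f x. scl W c (f x)\<rparr>"
proof -
  interpret W: vspace_on W by unfold_locales fact
  have "vector_space (\<lambda>c f x. scl W c (f x))"
    by unfold_locales (auto simp: fun_eq_iff W.scale_right_distrib W.scale_left_distrib)
  then show ?thesis using assms by (auto intro: is_vspaceI)
qed

lemma lin_maps_zero: "f \<in> lin_maps V W \<Longrightarrow> f 0 = 0"
  using lin_mapsD(2)[of f V W 0 0] lin_mapsD(4)[of f V W 0] by fastforce

lemma lin_maps_compose: "f \<in> lin_maps U V \<Longrightarrow> g \<in> lin_maps V W \<Longrightarrow> (\<lambda>x. g (f x)) \<in> lin_maps U W"
  by (intro lin_mapsI) (simp_all add: lin_mapsD lin_maps_zero)

lemma cont_lin_iff: "f \<in> car (cont_lin X Y) \<longleftrightarrow> f \<in> lin_maps (und X) (und Y) \<and> continuous_map (topol X) (topol Y) f"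
  by (simp add: cont_lin_def)

lemma cont_lin_compose:
  "f \<in> car (cont_lin X Y) \<Longrightarrow> g \<in> car (cont_lin Y Z) \<Longrightarrow> (\<lambda>x. g (f x)) \<in> car (cont_lin X Z)"
  using continuous_map_compose[of "topol X" "topol Y" f "topol Z" g]
  by (auto simp: cont_lin_iff o_def intro: lin_maps_compose)

lemma tvs_iso_trans:
  assumes "tvs_iso X Y" "tvs_iso Y Z"
  shows "tvs_iso X Z"
proof -
  obtain f g where f: "f \<in> car (cont_lin X Y)" "g \<in> car (cont_lin Y X)"
    "\<forall>x\<in>car (und X). g (f x) = x" "\<forall>y\<in>car (und Y). f (g y) = y"
    using assms(1) by (auto simp: tvs_iso_def)
  obtain h k where h: "h \<in> car (cont_lin Y Z)" "k \<in> car (cont_lin Z Y)"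
    "\<forall>x\<in>car (und Y). k (h x) = x" "\<forall>y\<in>car (und Z). h (k y) = y"
    using assms(2) by (auto simp: tvs_iso_def)
  have "f x \<in> car (und Y)" if "x \<in> car (und X)" for x using f(1) that lin_mapsD(1) by (auto simp: cont_lin_iff)
  moreover have "k z \<in> car (und Y)" if "z \<in> car (und Z)" for z using h(2) that lin_mapsD(1) by (auto simp: cont_lin_iff)
  ultimately show ?thesis
    using cont_lin_compose[OF f(1) h(1)] cont_lin_compose[OF h(2) f(2)] f(3,4) h(3,4)
    unfolding tvs_iso_def by (intro bexI[of _ "\<lambda>x. h (f x)"] bexI[of _ "\<lambda>z. g (k z)"]) auto
qed

lemma tvs_iso_sym: "tvs_iso X Y \<Longrightarrow> tvs_iso Y X"
  by (auto simp: tvs_iso_def)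

lemma scl_top_dual [simp]: "scl (top_dual X) = (\<lambda>c f x. c * f x)"
  by (simp add: cont_lin_def ground_tvs_def ground_def)

text \<open>Separation is the substantial part. The Hausdorff property gives a neighbourhood of 0
  missing x, local convexity a continuous seminorm with p x \<ge> 1, and Hahn--Banach a continuous
  functional that is nonzero at x.\<close>

lemma dual_pair_top_dual:
  fixes X :: "('k::{real_normed_field,euclidean_space}, 'v::ab_group_add) tvs"
  assumes "is_TVS X"
  shows "dual_pair (und X) (car (top_dual X))"
proof -
  interpret tvs_on X by unfold_locales fact
  show ?thesis
  proof
    show "car (top_dual X) \<subseteq> car (alg_dual (und X))" by (auto simp: top_dual_iff)
    have "(\<lambda>x. 0) \<in> car (top_dual X)" by (simp add: top_dual_iff alg_dualI)
    then show "car (top_dual X) \<noteq> {}" by blast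
  next
    fix w assume w: "w \<in> car (top_dual X)"
    have "continuous_map (topol X) euclidean (\<lambda>x. c * w x)" for c
    proof -
      have "continuous_on UNIV (\<lambda>z::'k. c * z)" by (intro continuous_intros)
      then show ?thesis
        using w continuous_map_compose[of "topol X" euclidean w euclidean "\<lambda>z. c * z"]
        by (simp add: top_dual_iff o_def)
    qed
    then show "(\<lambda>x. c * w x) \<in> car (top_dual X)" for c
      using w unfolding top_dual_iff by (auto intro!: alg_dualI simp: alg_dualD algebra_simps)
    fix w' assume w': "w' \<in> car (top_dual X)"
    show "(\<lambda>x. w x + w' x) \<in> car (top_dual X)"
      using w w' unfolding top_dual_iff
      by (auto intro!: alg_dualI continuous_intros simp: alg_dualD algebra_simps)
  next
    fix x assume x: "x \<in> car (und X)" and zero: "\<And>w. w \<in> car (top_dual X) \<Longrightarrow> w x = 0"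
    show "x = 0"
    proof (rule ccontr)
      assume "x \<noteq> 0"
      moreover have "Hausdorff_space (topol X)" using is_TVS by (simp add: is_TVS_def)
      ultimately obtain N N' where "openin (topol X) N" "0 \<in> N" "x \<in> N'" "disjnt N N'"
        using x unfolding Hausdorff_space_def by (metis car_closed(1) topspace_topol)
      then have N: "openin (topol X) N" "0 \<in> N" "x \<notin> N" by (auto simp: disjnt_iff)
      obtain p where p: "seminorm_on (und X) p" "bounded_near_zero X p"
        and pN: "\<And>y. y \<in> car (und X) \<Longrightarrow> p y < 1 \<Longrightarrow> y \<in> N"
        using seminorm_below_neighbourhood[OF N(1,2)] by blast
      have px: "p x \<ge> 1" using pN[OF x] N(3) by fastforce
      \<comment> \<open>Extension from the line through x: the functional c \<mapsto> p x * c has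
        norm p (c x) at c, and the split with zero first seminorm gives \<open>h2\<close> below p
        with \<open>h2 x\<close> = p x.\<close>
      define f where "f = (\<lambda>c. scl (und X) c x)"
      have f: "f \<in> lin_maps ground (und X)"
        using x by (auto simp: lin_maps_def f_def ground_def scale_left_distrib)
      define h where "h = (\<lambda>c::'k. of_real (p x) * c)"
      have h: "h \<in> car (alg_dual ground)" by (rule alg_dualI) (auto simp: h_def ground_def algebra_simps)
      have "norm (h c) \<le> 0 + p (f c)" for c
        using px seminorm_onD(2)[OF p(1) x] by (simp add: h_def f_def norm_mult)
      moreover have "seminorm_on (ground :: ('k,'k) vspace) (\<lambda>x. 0)" by (simp add: seminorm_on_def)
      ultimately obtain h1 h2 where h1: "\<And>c. c \<in> car ground \<Longrightarrow> norm (h1 c) \<le> 0"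
        and h2: "h2 \<in> car (alg_dual (und X))" "\<And>y. y \<in> car (und X) \<Longrightarrow> norm (h2 y) \<le> p y"
        and sum: "\<And>c. c \<in> car ground \<Longrightarrow> h c = h1 c + h2 (f c)"
        using hahn_banach_split[OF is_vspace_ground is_vspace _ p(1) f h] by metis
      have "h2 \<in> car (top_dual X)" by (rule top_dual_if_dominated[OF p h2])
      then have "h2 x = 0" by (rule zero)
      then show False using sum[of 1] h1[of 1] px by (simp add: f_def h_def ground_def)
    qed
  qed
qed

lemma is_vspace_top_dual:
  fixes X :: "('k::{real_normed_field,euclidean_space}, 'v::ab_group_add) tvs"
  assumes "is_TVS X"
  shows "is_vspace (top_dual X)"
proof -
  interpret dual_pair "und X" "car (top_dual X)" using assms by (rule dual_pair_top_dual)
  obtain w where "w \<in> car (top_dual X)" using functional_ex by blast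
  from functional_scale[OF this, of 0] have "0 \<in> car (top_dual X)" by (simp add: zero_fun_def)
  then have "is_vspace \<lparr>car = car (top_dual X), scl = \<lambda>c f x. scl ground c (f x)\<rparr>"
    using functional_add functional_scale is_vspace_ground
    by (intro is_vspace_function_space) (auto simp: ground_def plus_fun_def)
  also have "\<lparr>car = car (top_dual X), scl = \<lambda>c f x. scl ground c (f x)\<rparr> = top_dual X"
    by (simp add: cont_lin_def ground_tvs_def)
  finally show ?thesis .
qed

lemma chu_of_sel [simp]:
  "lft (chu_of X) = und X" "rgt (chu_of X) = top_dual X"
  by (simp_all add: chu_of_def)

lemma pairing_chu_of: "x \<in> car (und X) \<Longrightarrow> w \<in> car (top_dual X) \<Longrightarrow> pairing (chu_of X) x w = w x"
  by (simp add: chu_of_def on_carriers_def)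

lemma functionals_of_chu_of: "functionals_of (chu_of X) = car (top_dual X)"
proof -
  have "(\<lambda>v. pairing (chu_of X) v w) = w" if "w \<in> car (top_dual X)" for w
    using that alg_dualD(3)[of w "und X"] by (auto simp: chu_of_def on_carriers_def fun_eq_iff top_dual_iff)
  then show ?thesis by (force simp: functionals_of_def)
qed

lemma is_chu_chu_of:
  fixes X :: "('k::{real_normed_field,euclidean_space}, 'v::ab_group_add) tvs"
  assumes X: "is_TVS X"
  shows "is_chu (chu_of X)"
proof (rule is_chuI)
  interpret dual_pair "und X" "car (top_dual X)" using assms by (rule dual_pair_top_dual)
  note D = alg_dualD[OF subsetD[OF functionals]]
  show "is_vspace (lft (chu_of X))" "is_vspace (rgt (chu_of X))"
    using is_vspace is_vspace_top_dual[OF X] by auto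
  then show "pairing (chu_of X) \<in> bil_maps (lft (chu_of X)) (rgt (chu_of X)) ground"
    unfolding chu_of_def by (auto intro!: pairing_bil_mapsI simp: D)
  show "v = 0" if "v \<in> car (lft (chu_of X))" "\<And>w. w \<in> car (rgt (chu_of X)) \<Longrightarrow> pairing (chu_of X) v w = 0" for v
    using that separating[of v] by (simp add: pairing_chu_of)
  show "w = 0" if "w \<in> car (rgt (chu_of X))" "\<And>v. v \<in> car (lft (chu_of X)) \<Longrightarrow> pairing (chu_of X) v w = 0" for w
  proof
    show "w v = 0 v" for v
      using that D(3)[of w v] pairing_chu_of[of v X w] by (cases "v \<in> car (und X)") auto
  qed
qed

section \<open>Weak and Mackey spaces; continuity by transposition\<close>

definition space_of ::
  "bool \<Rightarrow> ('k::real_normed_field, 'v::ab_group_add, 'w::ab_group_add) chu \<Rightarrow> ('k, 'v) tvs" where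
  "space_of m A = \<lparr>und = lft A, topol = top_of m A\<rparr>"

definition is_TVS_of :: "bool \<Rightarrow> ('k::real_normed_field, 'v::ab_group_add) tvs \<Rightarrow> bool" where
  "is_TVS_of m X \<longleftrightarrow> is_TVS X \<and> topol X = top_of m (chu_of X)"

lemma und_space_of [simp]: "und (space_of m A) = lft A"
  by (simp add: space_of_def)

lemma is_TVS_ofD:
  fixes X :: "('k::{real_normed_field,euclidean_space}, 'v::ab_group_add) tvs"
  assumes "is_TVS_of m X"
  shows "is_TVS X" "topol X = dual_seminorm_topology m (und X) (car (top_dual X))"
  using assms top_of_eq[OF is_chu_chu_of, of X m] by (auto simp: is_TVS_of_def functionals_of_chu_of)

lemma top_dual_space_of:
  fixes A :: "('k::{real_normed_field,euclidean_space}, 'v::ab_group_add, 'w::ab_group_add) chu"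
  assumes "is_chu A"
  shows "car (top_dual (space_of m A)) = functionals_of A"
  using dual_pair.top_dual_dual_seminorm_topology[OF dual_pair_functionals_of[OF assms]]
  by (simp add: space_of_def top_of_eq[OF assms])

text \<open>The dual of \<open>space_of m A\<close> is the given set of functionals, and the
  topology depends only on the space and that set, so rebuilding the topology from the dual changes
  nothing.\<close>

lemma is_TVS_of_space_of:
  fixes A :: "('k::{real_normed_field,euclidean_space}, 'v::ab_group_add, 'w::ab_group_add) chu"
  assumes A: "is_chu A"
  shows "is_TVS_of m (space_of m A)"
proof -
  have X: "is_TVS (space_of m A)"
    using dual_pair.is_TVS_dual_seminorm_topology[OF dual_pair_functionals_of[OF A]]
    by (simp add: space_of_def top_of_eq[OF A])
  then show ?thesis
    using top_of_eq[OF is_chu_chu_of[OF X]] top_of_eq[OF A]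
    by (simp add: is_TVS_of_def functionals_of_chu_of top_dual_space_of[OF A]) (simp add: space_of_def)
qed

text \<open>It suffices that defining seminorms pull back to defining seminorms. In the Mackey case
  this is \<open>mackey_seminorms_pullback\<close>; weak seminorms are handled by induction over
  their sums.\<close>

lemma continuous_map_dual_seminorm_topology:
  fixes V :: "('k::{real_normed_field,euclidean_space}, 'v::ab_group_add) vspace"
    and W :: "('k, 'w::ab_group_add) vspace"
  assumes "dual_pair V \<Phi>" "dual_pair W \<Psi>" and f: "f \<in> lin_maps V W"
    and pull: "\<And>w. w \<in> \<Psi> \<Longrightarrow> (\<lambda>x. w (f x)) \<in> \<Phi>"
  shows "continuous_map (dual_seminorm_topology m V \<Phi>) (dual_seminorm_topology m W \<Psi>) f"
proof -
  interpret V: dual_pair V \<Phi> by fact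
  interpret W: dual_pair W \<Psi> by fact
  have pullback: "(\<lambda>x. q (f x)) \<in> dual_seminorms m V \<Phi>" if "q \<in> dual_seminorms m W \<Psi>" for q
  proof (cases m)
    case True
    then show ?thesis
      using that mackey_seminorms_pullback[OF V.is_vspace W.is_vspace f pull] by (simp add: dual_seminorms_def)
  next
    case False
    have "(\<lambda>x. q (f x)) \<in> weak_seminorms \<Phi>" if "q \<in> weak_seminorms \<Psi>"
      using that by induction (auto intro: pull weak_seminorms.intros)
    then show ?thesis using that False by (simp add: dual_seminorms_def)
  qed
  show ?thesis
  proof (rule W.seminorms.continuous_map_seminormI)
    show "f z \<in> car W" if "z \<in> topspace (dual_seminorm_topology m V \<Phi>)" for z
      using that lin_mapsD(1)[OF f] by simp
    fix z q and e :: real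
    assume z: "z \<in> topspace (dual_seminorm_topology m V \<Phi>)" and q: "q \<in> dual_seminorms m W \<Psi>" and e: "e > 0"
    let ?N = "{y \<in> car V. q (f (y - z)) < e}"
    have zV: "z \<in> car V" using z by simp
    have "openin (dual_seminorm_topology m V \<Phi>) ?N"
      using V.seminorms.openin_seminorm_ball[OF pullback[OF q] zV] .
    moreover have "z \<in> ?N"
      using zV e lin_maps_zero[OF f] W.seminorm_onD(3)[OF W.seminorms.seminorm[OF q]] by simp
    moreover have "f y - f z = f (y - z)" if "y \<in> car V" for y
      using lin_mapsD(2)[OF f, of "y - z" z] that zV by simp
    ultimately show "\<exists>N. openin (dual_seminorm_topology m V \<Phi>) N \<and> z \<in> N \<and> (\<forall>z'\<in>N. q (f z' - f z) < e)"
      by (intro exI[of _ ?N]) auto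
  qed
qed

text \<open>Source and target carry the same kind of topology, so continuity becomes a statement
  about functionals alone, and no open set has to be inspected when a map is constructed.\<close>

lemma cont_lin_iff_transpose:
  fixes X :: "('k::{real_normed_field,euclidean_space}, 'v::ab_group_add) tvs"
    and Y :: "('k, 'w::ab_group_add) tvs"
  assumes X: "is_TVS_of m X" and Y: "is_TVS_of m Y"
  shows "f \<in> car (cont_lin X Y) \<longleftrightarrow> f \<in> lin_maps (und X) (und Y) \<and>
    (\<forall>w\<in>car (top_dual Y). (\<lambda>x. w (f x)) \<in> car (top_dual X))"
proof -
  have "continuous_map (topol X) (topol Y) f"
    if "f \<in> lin_maps (und X) (und Y)" "\<And>w. w \<in> car (top_dual Y) \<Longrightarrow> (\<lambda>x. w (f x)) \<in> car (top_dual X)"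
    unfolding is_TVS_ofD(2)[OF X] is_TVS_ofD(2)[OF Y]
    using that X Y by (intro continuous_map_dual_seminorm_topology dual_pair_top_dual is_TVS_ofD(1))
  then show ?thesis using cont_lin_compose[of f X Y _ ground_tvs] by (auto simp: cont_lin_iff)
qed

lemma chu_dual_sel [simp]:
  "lft (chu_dual A) = rgt A" "rgt (chu_dual A) = lft A" "pairing (chu_dual A) w v = pairing A v w"
  by (simp_all add: chu_dual_def)

lemma is_chu_chu_dual:
  assumes A: "is_chu A"
  shows "is_chu (chu_dual A)"
proof (rule is_chuI)
  note D = pairingD[OF is_chuD(3)[OF A]]
  show V: "is_vspace (lft (chu_dual A))" "is_vspace (rgt (chu_dual A))" using is_chuD[OF A] by auto
  have "pairing (chu_dual A) = on_carriers (rgt A) (lft A) (\<lambda>w v. pairing A v w)"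
    using D(5,6) by (auto simp: on_carriers_def fun_eq_iff)
  also have "\<dots> \<in> bil_maps (rgt A) (lft A) ground"
    using D V by (intro pairing_bil_mapsI) auto
  finally show "pairing (chu_dual A) \<in> bil_maps (lft (chu_dual A)) (rgt (chu_dual A)) ground" by simp
qed (use is_chuD(4,5)[OF A] in auto)

section \<open>Duality and the evaluation isomorphism\<close>

definition D_of :: "bool \<Rightarrow> ('k::real_normed_field, 'v::ab_group_add) tvs \<Rightarrow> ('k, 'v \<Rightarrow> 'k) tvs" where
  "D_of m X = space_of m (chu_dual (chu_of X))"

lemma und_D_of [simp]: "und (D_of m X) = top_dual X"
  by (simp add: D_of_def)

lemma
  fixes X :: "('k::{real_normed_field,euclidean_space}, 'v::ab_group_add) tvs"
  assumes "is_TVS X"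
  shows is_TVS_of_D_of: "is_TVS_of m (D_of m X)"
    and top_dual_D_of: "car (top_dual (D_of m X)) = pairing (chu_of X) ` car (und X)"
  using is_TVS_of_space_of[OF is_chu_chu_dual[OF is_chu_chu_of[OF assms]]]
    top_dual_space_of[OF is_chu_chu_dual[OF is_chu_chu_of[OF assms]]]
  by (auto simp: D_of_def functionals_of_def)

text \<open>The dual of \<open>D_of m X\<close> consists of the evaluations at points of X, so
  evaluation is onto. Both directions are continuous because the functionals on the bidual are in
  turn the evaluations at elements of the dual of X.\<close>

lemma biduality:
  fixes X :: "('k::{real_normed_field,euclidean_space}, 'v::ab_group_add) tvs"
  assumes X: "is_TVS_of m X"
  obtains e g where "e \<in> car (cont_lin X (D_of m (D_of m X)))" "g \<in> car (cont_lin (D_of m (D_of m X)) X)"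
    "\<And>x. x \<in> car (und X) \<Longrightarrow> g (e x) = x" "\<And>\<xi>. \<xi> \<in> car (und (D_of m (D_of m X))) \<Longrightarrow> e (g \<xi>) = \<xi>"
proof -
  let ?DX = "D_of m X" and ?DDX = "D_of m (D_of m X)"
  have TX: "is_TVS X" using is_TVS_ofD(1)[OF X] .
  have DX: "is_TVS_of m ?DX" using is_TVS_of_D_of[OF TX] .
  have DDX: "is_TVS_of m ?DDX" using is_TVS_of_D_of[OF is_TVS_ofD(1)[OF DX]] .
  define e where "e = pairing (chu_of X)"
  have C: "is_chu (chu_of X)" using is_chu_chu_of[OF TX] .
  note D = pairingD[OF is_chuD(3)[OF C], folded e_def, simplified]
  have inj: "inj_on e (car (und X))" using C by (simp add: is_chu_def e_def)
  have img: "car (und ?DDX) = e ` car (und X)" using top_dual_D_of[OF TX] by (simp add: e_def)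
  have e_apply: "e x w = w x" if "x \<in> car (und X)" "w \<in> car (top_dual X)" for x w
    using pairing_chu_of[OF that] by (simp add: e_def)
  have e: "e \<in> lin_maps (und X) (und ?DDX)"
  proof (rule lin_mapsI)
    show "e x \<in> car (und ?DDX)" if "x \<in> car (und X)" for x using that img by blast
  qed (use D in \<open>auto simp: fun_eq_iff\<close>)
  define g where "g \<xi> = (if \<xi> \<in> car (und ?DDX) then inv_into (car (und X)) e \<xi> else 0)" for \<xi>
  have ge: "g (e x) = x" if "x \<in> car (und X)" for x
    using that inj img by (simp add: g_def)
  have g: "g \<in> lin_maps (und ?DDX) (und X)"
  proof (rule lin_mapsI)
    interpret V: vspace_on "und X" using is_chuD(1)[OF C] by unfold_locales simp
    fix \<xi> assume "\<xi> \<in> car (und ?DDX)"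
    then obtain x where x: "x \<in> car (und X)" "\<xi> = e x" using img by blast
    then show "g \<xi> \<in> car (und X)" using ge by simp
    show "g (scl (und ?DDX) c \<xi>) = scl (und X) c (g \<xi>)" for c
      using ge[of "scl (und X) c x"] ge x lin_mapsD(3)[OF e x(1)] by simp
    fix \<eta> assume "\<eta> \<in> car (und ?DDX)"
    then obtain y where y: "y \<in> car (und X)" "\<eta> = e y" using img by blast
    then show "g (\<xi> + \<eta>) = g \<xi> + g \<eta>"
      using ge[of "x + y"] ge x lin_mapsD(2)[OF e x(1) y(1)] by simp
  qed (simp add: g_def)
  have eg: "e (g \<xi>) = \<xi>" if "\<xi> \<in> car (und ?DDX)" for \<xi>
    using that img ge by force
  have dual_DDX: "car (top_dual ?DDX) = pairing (chu_of ?DX) ` car (top_dual X)"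
    using top_dual_D_of[OF is_TVS_ofD(1)[OF DX]] by simp
  have "e \<in> car (cont_lin X ?DDX)"
    unfolding cont_lin_iff_transpose[OF X DDX]
  proof (intro conjI ballI e)
    fix u assume "u \<in> car (top_dual ?DDX)"
    then obtain w where w: "w \<in> car (top_dual X)" "u = pairing (chu_of ?DX) w" using dual_DDX by blast
    have "u (e x) = w x" for x
    proof (cases "x \<in> car (und X)")
      case True
      then have "e x \<in> car (top_dual ?DX)" using img by simp
      then show ?thesis using pairing_chu_of[of w ?DX "e x"] w e_apply[OF True w(1)] by simp
    next
      case False
      then have "e x = 0" "w x = 0" using lin_mapsD(4)[OF e] w(1) by (auto simp: cont_lin_iff lin_mapsD(4))
      then show ?thesis using pairing_zero(2)[OF is_chu_chu_of[OF is_TVS_ofD(1)[OF DX]]] w(2) by simp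
    qed
    then show "(\<lambda>x. u (e x)) \<in> car (top_dual X)" using w(1) by simp
  qed
  moreover have "g \<in> car (cont_lin ?DDX X)"
    unfolding cont_lin_iff_transpose[OF DDX X]
  proof (intro conjI ballI g)
    fix w assume w: "w \<in> car (top_dual X)"
    have w0: "w 0 = 0" using w lin_maps_zero by (auto simp: cont_lin_iff)
    have "w (g \<xi>) = pairing (chu_of ?DX) w \<xi>" for \<xi>
    proof (cases "\<xi> \<in> car (und ?DDX)")
      case True
      then obtain x where x: "x \<in> car (und X)" "\<xi> = e x" using img by blast
      then show ?thesis using pairing_chu_of[of w ?DX \<xi>] True w ge e_apply by simp
    next
      case False
      then show ?thesis using w0 by (simp add: g_def chu_of_def on_carriers_def)
    qed
    then show "(\<lambda>\<xi>. w (g \<xi>)) \<in> car (top_dual ?DDX)" using w dual_DDX by auto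
  qed
  ultimately show ?thesis using that ge eg by blast
qed

section \<open>Tensor pairings and spaces of operators\<close>

lemma vector_space_tensor: "vector_space (\<lambda>c (t :: ('v \<Rightarrow> 'w \<Rightarrow> 'k::real_normed_field) \<Rightarrow> 'k) B. c * t B)"
  by unfold_locales (auto simp: fun_eq_iff algebra_simps)

lemma scl_tensor [simp]: "scl (tensor V W) = (\<lambda>c t B. c * t B)"
  by (simp add: tensor_def)

lemma is_vspace_tensor:
  fixes V :: "('k::real_normed_field, 'v::ab_group_add) vspace" and W :: "('k, 'w::ab_group_add) vspace"
  shows "is_vspace (tensor V W)"
proof -
  interpret vector_space "\<lambda>c (t :: ('v \<Rightarrow> 'w \<Rightarrow> 'k) \<Rightarrow> 'k) B. c * t B" by (rule vector_space_tensor)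
  show ?thesis using vector_space_tensor subspace_span by (simp add: is_vspace_def tensor_def)
qed

lemma pure_tensor_mem:
  fixes V :: "('k::real_normed_field, 'v::ab_group_add) vspace" and W :: "('k, 'w::ab_group_add) vspace"
  assumes "v \<in> car V" "w \<in> car W"
  shows "pure_tensor V W v w \<in> car (tensor V W)"
proof -
  interpret vector_space "\<lambda>c (t :: ('v \<Rightarrow> 'w \<Rightarrow> 'k) \<Rightarrow> 'k) B. c * t B" by (rule vector_space_tensor)
  show ?thesis using assms by (auto simp: tensor_def intro: span_base)
qed

lemma tensor_induct [consumes 1, case_names zero step]:
  fixes V :: "('k::real_normed_field, 'v::ab_group_add) vspace" and W :: "('k, 'w::ab_group_add) vspace"
  assumes "t \<in> car (tensor V W)" and "P 0"
    and step: "\<And>c v w t. v \<in> car V \<Longrightarrow> w \<in> car W \<Longrightarrow> t \<in> car (tensor V W) \<Longrightarrow> P t \<Longrightarrow>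
      P ((\<lambda>B. c * pure_tensor V W v w B) + t)"
  shows "P t"
proof -
  interpret vector_space "\<lambda>c (t :: ('v \<Rightarrow> 'w \<Rightarrow> 'k) \<Rightarrow> 'k) B. c * t B" by (rule vector_space_tensor)
  interpret T: vspace_on "tensor V W" by unfold_locales (rule is_vspace_tensor)
  let ?G = "{pure_tensor V W v w |v w. v \<in> car V \<and> w \<in> car W}"
  have "t \<in> span ?G" using assms(1) by (simp add: tensor_def)
  \<comment> \<open>Membership is carried along because the hypothesis \<open>step\<close> asks for
    it.\<close>
  then have "t \<in> car (tensor V W) \<and> P t"
  proof (induction rule: span_induct_alt)
    case base
    then show ?case using T.car_closed(1) \<open>P 0\<close> by (simp add: zero_fun_def)
  next
    case (step c x y)
    then obtain v w where vw: "v \<in> car V" "w \<in> car W" "x = pure_tensor V W v w" by blast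
    have "(\<lambda>B. c * pure_tensor V W v w B) + y \<in> car (tensor V W)"
      using T.car_closed(2)[OF T.car_closed(3)[OF pure_tensor_mem[OF vw(1,2)], of c]] step by simp
    moreover have "P ((\<lambda>B. c * pure_tensor V W v w B) + y)"
      by (rule assms(3)[OF vw(1,2)]) (use step(2) in simp_all)
    ultimately show ?case by (simp only: vw(3))
  qed
  then show ?thesis ..
qed

text \<open>A tensor is encoded as a function of forms with no linearity built in; linearity holds
  because it holds for the generators. Bilinearity of the combined form is a hypothesis since
  \<open>pure_tensor\<close> is 0 on anything else.\<close>

lemma
  assumes t: "t \<in> car (tensor V W)" and B: "B \<in> bil_maps V W ground"
  shows tensor_apply_add: "B' \<in> bil_maps V W ground \<Longrightarrow> (\<lambda>v w. B v w + B' v w) \<in> bil_maps V W ground \<Longrightarrow>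
      t (\<lambda>v w. B v w + B' v w) = t B + t B'"
    and tensor_apply_scale: "(\<lambda>v w. c * B v w) \<in> bil_maps V W ground \<Longrightarrow> t (\<lambda>v w. c * B v w) = c * t B"
  using t by (induction rule: tensor_induct) (simp_all add: pure_tensor_def B algebra_simps)

text \<open>Consequently tensors that agree on bilinear forms are equal.\<close>

lemma tensor_apply_outside: "t \<in> car (tensor V W) \<Longrightarrow> B \<notin> bil_maps V W ground \<Longrightarrow> t B = 0"
  by (induction rule: tensor_induct) (simp_all add: pure_tensor_def)

lemma bil_mapsD:
  assumes B: "B \<in> bil_maps V W ground"
  shows "v \<in> car V \<Longrightarrow> v' \<in> car V \<Longrightarrow> B (v + v') w = B v w + B v' w"
    and "v \<in> car V \<Longrightarrow> B (scl V c v) w = c * B v w"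
    and "v \<in> car V \<Longrightarrow> w \<in> car W \<Longrightarrow> w' \<in> car W \<Longrightarrow> B v (w + w') = B v w + B v w'"
    and "v \<in> car V \<Longrightarrow> w \<in> car W \<Longrightarrow> B v (scl W c w) = c * B v w"
  using pairingD[of "\<lparr>lft = V, rgt = W, pairing = B\<rparr>"] B by simp_all

lemma alg_dual_sum:
  assumes V: "is_vspace V" and h: "h \<in> car (alg_dual V)" and u: "\<And>b. b \<in> F \<Longrightarrow> u b \<in> car V"
  shows "(\<Sum>b\<in>F. u b) \<in> car V" "h (\<Sum>b\<in>F. u b) = (\<Sum>b\<in>F. h (u b))"
proof -
  interpret vspace_on V by unfold_locales fact
  have h0: "h 0 = 0" using h lin_maps_zero by (auto simp: alg_dual_as_lin_maps)
  have "(\<Sum>b\<in>F. u b) \<in> car V \<and> h (\<Sum>b\<in>F. u b) = (\<Sum>b\<in>F. h (u b))"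
    using u
  proof (induction F rule: infinite_finite_induct)
    case (insert b F)
    then show ?case using alg_dualD(1)[OF h, of "u b" "sum u F"] by simp
  qed (simp_all add: h0)
  then show "(\<Sum>b\<in>F. u b) \<in> car V" "h (\<Sum>b\<in>F. u b) = (\<Sum>b\<in>F. h (u b))" by auto
qed

text \<open>Moving all scalars into the left factor turns t into a finite sum of tensors u b
  \<otimes> b with b in S. The identity is expressed through its effect on bilinear forms.\<close>

lemma tensor_expand_in_basis:
  assumes V: "is_vspace V" and W: "is_vspace W" and t: "t \<in> car (tensor V W)"
    and S: "S \<subseteq> car W" "car W \<subseteq> module.span (scl W) S"
  obtains F u where "finite F" "F \<subseteq> S" "\<And>b. u b \<in> car V"
    "\<And>B. B \<in> bil_maps V W ground \<Longrightarrow> t B = (\<Sum>b\<in>F. B (u b) b)"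
proof -
  interpret V: vspace_on V by unfold_locales fact
  interpret W: vspace_on W by unfold_locales fact
  have B0: "B 0 w = 0" if "B \<in> bil_maps V W ground" for B w
    using lin_maps_zero[OF that] by simp
  have Bsum: "B v (\<Sum>b\<in>F. scl W (r b) b) = (\<Sum>b\<in>F. B (scl V (r b) v) b)"
    if B: "B \<in> bil_maps V W ground" and v: "v \<in> car V" and F: "F \<subseteq> S" for B v F r
  proof -
    have "B v \<in> car (alg_dual W)" using lin_mapsD(1)[OF B v] .
    then have "B v (\<Sum>b\<in>F. scl W (r b) b) = (\<Sum>b\<in>F. B v (scl W (r b) b))"
      using F S(1) by (intro alg_dual_sum(2)[OF W]) auto
    also have "\<dots> = (\<Sum>b\<in>F. B (scl V (r b) v) b)"
      using F S(1) bil_mapsD(2,4)[OF B v] by (intro sum.cong) auto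
    finally show ?thesis .
  qed
  \<comment> \<open>The coefficients vanish outside F, so that two expansions can be added over the
    union of their index sets.\<close>
  have "\<exists>F u. finite F \<and> F \<subseteq> S \<and> (\<forall>b. u b \<in> car V) \<and> (\<forall>b. b \<notin> F \<longrightarrow> u b = 0) \<and>
      (\<forall>B\<in>bil_maps V W ground. t B = (\<Sum>b\<in>F. B (u b) b))"
    using t
  proof (induction rule: tensor_induct)
    case zero
    show ?case by (rule exI[of _ "{}"], rule exI[of _ "\<lambda>_. 0"]) simp
  next
    case (step c v w t)
    then obtain F u where F: "finite F" "F \<subseteq> S" "\<And>b. u b \<in> car V" "\<And>b. b \<notin> F \<Longrightarrow> u b = 0"
      "\<And>B. B \<in> bil_maps V W ground \<Longrightarrow> t B = (\<Sum>b\<in>F. B (u b) b)" by blast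
    have "w \<in> W.span S" using step(2) S(2) by blast
    then obtain F' r where F': "finite F'" "F' \<subseteq> S" "w = (\<Sum>b\<in>F'. scl W (r b) b)"
      unfolding W.span_explicit by auto
    \<comment> \<open>With w expanded as the sum of \<open>r b\<close> times b, the left coefficient
      of b in c (v \<otimes> w) is v scaled by \<open>c * r b\<close>.\<close>
    define u' where "u' b = (if b \<in> F' then scl V (c * r b) v else 0)" for b
    have u': "u' b \<in> car V" for b using step(1) by (simp add: u'_def)
    have "c * pure_tensor V W v w B + t B = (\<Sum>b\<in>F \<union> F'. B (u' b + u b) b)"
      if B: "B \<in> bil_maps V W ground" for B
    proof -
      have "c * pure_tensor V W v w B = B (scl V c v) w"
        using B bil_mapsD(2)[OF B step(1), of c w] by (simp add: pure_tensor_def)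
      also have "\<dots> = (\<Sum>b\<in>F'. B (scl V (r b) (scl V c v)) b)"
        using Bsum[OF B _ F'(2), of "scl V c v"] step(1) F'(3) by simp
      also have "\<dots> = (\<Sum>b\<in>F'. B (u' b) b)"
        by (intro sum.cong) (auto simp: u'_def mult.commute)
      also have "\<dots> = (\<Sum>b\<in>F \<union> F'. B (u' b) b)"
        using F(1) F'(1) B0[OF B] by (intro sum.mono_neutral_left) (auto simp: u'_def)
      finally have 1: "c * pure_tensor V W v w B = (\<Sum>b\<in>F \<union> F'. B (u' b) b)" .
      have "t B = (\<Sum>b\<in>F \<union> F'. B (u b) b)"
        unfolding F(5)[OF B] using F(1,4) F'(1) B0[OF B] by (intro sum.mono_neutral_left) auto
      with 1 show ?thesis
        using bil_mapsD(1)[OF B u' F(3)] by (simp add: sum.distrib)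
    qed
    then show ?case
      using F F' u' by (intro exI[of _ "F \<union> F'"] exI[of _ "\<lambda>b. u' b + u b"]) (auto simp: u'_def)
  qed
  then show ?thesis using that by blast
qed

text \<open>Common shape of the pairing on an internal hom and the pairing on operators, so that
  nondegeneracy and the comparison of functionals are proved once for both.\<close>

definition tensor_pair ::
  "('k::real_normed_field, 'l::ab_group_add) vspace \<Rightarrow> ('k, 'v::ab_group_add) vspace
    \<Rightarrow> ('k, 'w::ab_group_add) vspace \<Rightarrow> ('l \<Rightarrow> 'v \<Rightarrow> 'w \<Rightarrow> 'k)
    \<Rightarrow> ('k, 'l, ('v \<Rightarrow> 'w \<Rightarrow> 'k) \<Rightarrow> 'k) chu" where
  "tensor_pair L V W \<beta> = \<lparr>lft = L, rgt = tensor V W,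
     pairing = on_carriers L (tensor V W) (\<lambda>l. tensor_eval V W (\<beta> l))\<rparr>"

lemma tensor_pair_sel [simp]: "lft (tensor_pair L V W \<beta>) = L" "rgt (tensor_pair L V W \<beta>) = tensor V W"
  by (simp_all add: tensor_pair_def)

lemma pairing_tensor_pair:
  "l \<in> car L \<Longrightarrow> t \<in> car (tensor V W) \<Longrightarrow> pairing (tensor_pair L V W \<beta>) l t = t (on_carriers V W (\<beta> l))"
  by (simp add: tensor_pair_def on_carriers_def tensor_eval_def)

text \<open>Expanding a tensor in a basis of \<open>W\<close>, the rank one elements already separate it from \<open>0\<close>.\<close>

lemma is_chu_tensor_pair:
  fixes V :: "('k::{real_normed_field,euclidean_space}, 'v::ab_group_add) vspace"
    and W :: "('k, 'w::ab_group_add) vspace" and L :: "('k, 'l::ab_group_add) vspace"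
  assumes L: "is_vspace L" and V: "dual_pair V \<Phi>" and W: "dual_pair W \<Psi>"
    and bil: "\<And>l. l \<in> car L \<Longrightarrow> on_carriers V W (\<beta> l) \<in> bil_maps V W ground"
    and add: "\<And>l l' v w. l \<in> car L \<Longrightarrow> l' \<in> car L \<Longrightarrow> v \<in> car V \<Longrightarrow> w \<in> car W \<Longrightarrow>
      \<beta> (l + l') v w = \<beta> l v w + \<beta> l' v w"
    and scale: "\<And>c l v w. l \<in> car L \<Longrightarrow> v \<in> car V \<Longrightarrow> w \<in> car W \<Longrightarrow> \<beta> (scl L c l) v w = c * \<beta> l v w"
    and faithful: "\<And>l. l \<in> car L \<Longrightarrow> (\<And>v w. v \<in> car V \<Longrightarrow> w \<in> car W \<Longrightarrow> \<beta> l v w = 0) \<Longrightarrow> l = 0"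
    and rank_one: "\<And>a c. a \<in> \<Phi> \<Longrightarrow> c \<in> \<Psi> \<Longrightarrow> \<exists>l\<in>car L. \<forall>v\<in>car V. \<forall>w\<in>car W. \<beta> l v w = a v * c w"
  shows "is_chu (tensor_pair L V W \<beta>)"
proof (rule is_chuI; (unfold tensor_pair_sel)?)
  interpret L: vspace_on L by unfold_locales fact
  interpret V: dual_pair V \<Phi> by fact
  interpret W: dual_pair W \<Psi> by fact
  show "is_vspace L" "is_vspace (tensor V W)" using L is_vspace_tensor by auto
  show "pairing (tensor_pair L V W \<beta>) \<in> bil_maps L (tensor V W) ground"
    unfolding tensor_pair_def chu.simps
  proof (rule pairing_bil_mapsI[OF _ _ _ _ L is_vspace_tensor])
    fix l t assume l: "l \<in> car L" and t: "t \<in> car (tensor V W)"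
    have eq: "on_carriers V W (\<beta> (scl L c l)) = (\<lambda>v w. c * on_carriers V W (\<beta> l) v w)" for c
      using scale[OF l] by (auto simp: on_carriers_def fun_eq_iff)
    show "tensor_eval V W (\<beta> (scl L c l)) t = c * tensor_eval V W (\<beta> l) t" for c
      using tensor_apply_scale[OF t bil[OF l]] bil[of "scl L c l"] l by (simp add: tensor_eval_def eq)
    fix l' assume l': "l' \<in> car L"
    have "on_carriers V W (\<beta> (l + l')) = (\<lambda>v w. on_carriers V W (\<beta> l) v w + on_carriers V W (\<beta> l') v w)"
      using add[OF l l'] by (auto simp: on_carriers_def fun_eq_iff)
    then show "tensor_eval V W (\<beta> (l + l')) t = tensor_eval V W (\<beta> l) t + tensor_eval V W (\<beta> l') t"
      using tensor_apply_add[OF t bil[OF l] bil[OF l']] bil[of "l + l'"] l l' by (simp add: tensor_eval_def)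
  qed (simp_all add: tensor_eval_def)
  show "l = 0" if l: "l \<in> car L"
    and zero: "\<And>t. t \<in> car (tensor V W) \<Longrightarrow> pairing (tensor_pair L V W \<beta>) l t = 0" for l
  proof (rule faithful[OF l])
    fix v w assume vw: "v \<in> car V" "w \<in> car W"
    show "\<beta> l v w = 0"
      using zero[OF pure_tensor_mem[OF vw]] bil[OF l] l vw pairing_tensor_pair[OF l pure_tensor_mem[OF vw]]
      by (simp add: pure_tensor_def on_carriers_def)
  qed
  show "t = 0" if t: "t \<in> car (tensor V W)"
    and zero: "\<And>l. l \<in> car L \<Longrightarrow> pairing (tensor_pair L V W \<beta>) l t = 0" for t
  proof -
    obtain S where S: "S \<subseteq> car W" "W.independent S" "car W \<subseteq> W.span S"
      using W.maximal_independent_subset[of "car W"] by blast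
    obtain F u where F: "finite F" "F \<subseteq> S" "\<And>b. u b \<in> car V"
      and tF: "\<And>B. B \<in> bil_maps V W ground \<Longrightarrow> t B = (\<Sum>b\<in>F. B (u b) b)"
      using tensor_expand_in_basis[OF V.is_vspace W.is_vspace t S(1,3)] by metis
    have FW: "b \<in> car W" if "b \<in> F" for b using that F(2) S(1) by blast
    have "u b = 0" if b: "b \<in> F" for b
    proof (rule V.separating[OF F(3)])
      fix a assume a: "a \<in> \<Phi>"
      \<comment> \<open>Pairing t with the rank one element for a and c gives c applied to this sum,
        so the sum is 0 as c varies. Independence of S then gives a (u b) = 0, and u b = 0 follows
        as a varies.\<close>
      have "(\<Sum>b\<in>F. scl W (a (u b)) b) = 0"
      proof (rule W.separating)
        show "(\<Sum>b\<in>F. scl W (a (u b)) b) \<in> car W"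
          \<comment> \<open>\<open>alg_dual_sum\<close> yields membership in the presence of a
            linear functional; any element of \<Psi> serves.\<close>
          using FW W.is_vspace W.functionals W.functional_ex by (auto intro!: alg_dual_sum(1))
        fix c assume c: "c \<in> \<Psi>"
        then have c': "c \<in> car (alg_dual W)" using W.functionals by blast
        obtain l where l: "l \<in> car L" "\<And>v w. v \<in> car V \<Longrightarrow> w \<in> car W \<Longrightarrow> \<beta> l v w = a v * c w"
          using rank_one[OF a c] by blast
        have "0 = t (on_carriers V W (\<beta> l))" using zero[OF l(1)] pairing_tensor_pair[OF l(1) t] by simp
        also have "\<dots> = (\<Sum>b\<in>F. on_carriers V W (\<beta> l) (u b) b)" using tF[OF bil[OF l(1)]] .
        also have "\<dots> = (\<Sum>b\<in>F. c (scl W (a (u b)) b))"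
          using l(2) F(3) FW alg_dualD(2)[OF c'] by (intro sum.cong) (auto simp: on_carriers_def)
        also have "\<dots> = c (\<Sum>b\<in>F. scl W (a (u b)) b)"
          using FW by (intro alg_dual_sum(2)[OF W.is_vspace c', symmetric]) auto
        finally show "c (\<Sum>b\<in>F. scl W (a (u b)) b) = 0" by simp
      qed
      then show "a (u b) = 0"
        using W.independentD[OF S(2) F(1,2), of "\<lambda>b. a (u b)" b] b by simp
    qed
    then have "t B = 0" if "B \<in> bil_maps V W ground" for B
      using tF[OF that] lin_maps_zero[OF that] by simp
    then show ?thesis using tensor_apply_outside[OF t] by (auto simp: fun_eq_iff)
  qed
qed

text \<open>It is enough that evaluation at a pure tensor pulls back to evaluation at a pure tensor;
  sums follow by induction. Only the existence of a corresponding tensor is asserted, so no linear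
  map between the tensor products has to be constructed.\<close>

lemma functionals_of_tensor_pair_pullback:
  assumes \<phi>: "\<phi> \<in> lin_maps L1 L2" and C: "is_chu (tensor_pair L2 V2 W2 \<beta>2)"
    and bil1: "\<And>l. l \<in> car L1 \<Longrightarrow> on_carriers V1 W1 (\<beta>1 l) \<in> bil_maps V1 W1 ground"
    and bil2: "\<And>l. l \<in> car L2 \<Longrightarrow> on_carriers V2 W2 (\<beta>2 l) \<in> bil_maps V2 W2 ground"
    and corr: "\<And>v w. v \<in> car V2 \<Longrightarrow> w \<in> car W2 \<Longrightarrow>
      \<exists>v'\<in>car V1. \<exists>w'\<in>car W1. \<forall>l\<in>car L1. \<beta>2 (\<phi> l) v w = \<beta>1 l v' w'"
    and h: "h \<in> functionals_of (tensor_pair L2 V2 W2 \<beta>2)"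
  shows "(\<lambda>l. h (\<phi> l)) \<in> functionals_of (tensor_pair L1 V1 W1 \<beta>1)"
proof -
  interpret T: vspace_on "tensor V1 W1" by unfold_locales (rule is_vspace_tensor)
  obtain t where t: "t \<in> car (tensor V2 W2)" "h = (\<lambda>l. pairing (tensor_pair L2 V2 W2 \<beta>2) l t)"
    using h by (auto simp: functionals_of_def)
  have "\<exists>t'\<in>car (tensor V1 W1). \<forall>l\<in>car L1. t (on_carriers V2 W2 (\<beta>2 (\<phi> l))) = t' (on_carriers V1 W1 (\<beta>1 l))"
    using t(1)
  proof (induction rule: tensor_induct)
    case zero
    show ?case by (rule bexI[of _ 0]) auto
  next
    case (step c v w t)
    then obtain t' where t': "t' \<in> car (tensor V1 W1)"
      "\<forall>l\<in>car L1. t (on_carriers V2 W2 (\<beta>2 (\<phi> l))) = t' (on_carriers V1 W1 (\<beta>1 l))" by blast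
    obtain v' w' where vw: "v' \<in> car V1" "w' \<in> car W1" "\<forall>l\<in>car L1. \<beta>2 (\<phi> l) v w = \<beta>1 l v' w'"
      using corr[OF step(1,2)] by blast
    show ?case
    proof (rule bexI[of _ "(\<lambda>B. c * pure_tensor V1 W1 v' w' B) + t'"])
      show "(\<lambda>B. c * pure_tensor V1 W1 v' w' B) + t' \<in> car (tensor V1 W1)"
        using T.car_closed(2)[OF T.car_closed(3)[OF pure_tensor_mem[OF vw(1,2)], of c] t'(1)] by simp
    qed (use step(1,2) t'(2) vw bil1 bil2 lin_mapsD(1)[OF \<phi>] in \<open>simp add: pure_tensor_def on_carriers_def\<close>)
  qed
  then obtain t' where t': "t' \<in> car (tensor V1 W1)"
    "\<And>l. l \<in> car L1 \<Longrightarrow> t (on_carriers V2 W2 (\<beta>2 (\<phi> l))) = t' (on_carriers V1 W1 (\<beta>1 l))" by blast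
  have "h (\<phi> l) = pairing (tensor_pair L1 V1 W1 \<beta>1) l t'" for l
  proof (cases "l \<in> car L1")
    case True
    then show ?thesis
      using pairing_tensor_pair[OF lin_mapsD(1)[OF \<phi> True] t(1)] pairing_tensor_pair[OF True t'(1)] t(2) t'(2)
      by simp
  next
    case False
    then have "\<phi> l = 0" using lin_mapsD(4)[OF \<phi>] by simp
    then show ?thesis using pairing_zero(1)[OF C] t(2) False by (simp add: tensor_pair_def on_carriers_def)
  qed
  then show ?thesis using t'(1) by (auto simp: functionals_of_def)
qed

section \<open>The internal hom of chu\<close>

lemma is_vspace_chu_hom_space:
  assumes A: "is_chu A" and B: "is_chu B"
  shows "is_vspace (chu_hom_space A B)"
proof (rule is_vspaceI)
  interpret LB: vspace_on "lft B" using is_chuD(1)[OF B] by unfold_locales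
  interpret RA: vspace_on "rgt A" using is_chuD(2)[OF A] by unfold_locales
  interpret LA: vspace_on "lft A" using is_chuD(1)[OF A] by unfold_locales
  interpret RB: vspace_on "rgt B" using is_chuD(2)[OF B] by unfold_locales
  note DA = pairingD[OF is_chuD(3)[OF A]] and DB = pairingD[OF is_chuD(3)[OF B]]
  show "vector_space (scl (chu_hom_space A B))"
    unfolding chu_hom_space_def vspace.simps
    by unfold_locales (simp_all add: case_prod_beta' prod_eq_iff fun_eq_iff LB.scale_right_distrib
        LB.scale_left_distrib RA.scale_right_distrib RA.scale_left_distrib)
  show "0 \<in> car (chu_hom_space A B)"
    using pairing_zero[OF A] pairing_zero[OF B]
    by (auto simp: chu_hom_space_def chu_hom_def zero_prod_def lin_maps_def)
  fix l assume "l \<in> car (chu_hom_space A B)"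
  then obtain f g where l: "l = (f, g)" and f: "f \<in> lin_maps (lft A) (lft B)" and g: "g \<in> lin_maps (rgt B) (rgt A)"
    and fg: "\<And>v w. v \<in> car (lft A) \<Longrightarrow> w \<in> car (rgt B) \<Longrightarrow> pairing B (f v) w = pairing A v (g w)"
    by (auto simp: chu_hom_space_def chu_hom_def)
  have "(\<lambda>v. scl (lft B) c (f v)) \<in> lin_maps (lft A) (lft B)" for c
    using lin_mapsD[OF f] by (intro lin_mapsI) (auto simp: LB.scale_right_distrib mult.commute)
  moreover have "(\<lambda>w. scl (rgt A) c (g w)) \<in> lin_maps (rgt B) (rgt A)" for c
    using lin_mapsD[OF g] by (intro lin_mapsI) (auto simp: RA.scale_right_distrib mult.commute)
  ultimately show "scl (chu_hom_space A B) c l \<in> car (chu_hom_space A B)" for c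
    using fg lin_mapsD(1)[OF f] lin_mapsD(1)[OF g] DA DB by (auto simp: chu_hom_space_def chu_hom_def l)
  fix l' assume "l' \<in> car (chu_hom_space A B)"
  then obtain f' g' where l': "l' = (f', g')" and f': "f' \<in> lin_maps (lft A) (lft B)" and g': "g' \<in> lin_maps (rgt B) (rgt A)"
    and fg': "\<And>v w. v \<in> car (lft A) \<Longrightarrow> w \<in> car (rgt B) \<Longrightarrow> pairing B (f' v) w = pairing A v (g' w)"
    by (auto simp: chu_hom_space_def chu_hom_def)
  have "f + f' \<in> lin_maps (lft A) (lft B)"
    using lin_mapsD[OF f] lin_mapsD[OF f'] by (intro lin_mapsI) (auto simp: LB.scale_right_distrib)
  moreover have "g + g' \<in> lin_maps (rgt B) (rgt A)"
    using lin_mapsD[OF g] lin_mapsD[OF g'] by (intro lin_mapsI) (auto simp: RA.scale_right_distrib)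
  ultimately show "l + l' \<in> car (chu_hom_space A B)"
    using fg fg' lin_mapsD(1)[OF f] lin_mapsD(1)[OF g] lin_mapsD(1)[OF f'] lin_mapsD(1)[OF g'] DA DB
    by (auto simp: chu_hom_space_def chu_hom_def l l')
qed

lemma chu_ihom_eq_tensor_pair:
  "chu_ihom A B = tensor_pair (chu_hom_space A B) (lft A) (rgt B) (\<lambda>l v w. pairing B (fst l v) w)"
  by (simp add: chu_ihom_def tensor_pair_def case_prod_beta')

lemma chu_ihom_bilinear:
  assumes A: "is_chu A" and B: "is_chu B" and l: "l \<in> car (chu_hom_space A B)"
  shows "on_carriers (lft A) (rgt B) (\<lambda>v w. pairing B (fst l v) w) \<in> bil_maps (lft A) (rgt B) ground"
proof -
  have f: "fst l \<in> lin_maps (lft A) (lft B)" using l by (auto simp: chu_hom_space_def chu_hom_def)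
  show ?thesis
    using pairingD[OF is_chuD(3)[OF B]] lin_mapsD[OF f] is_chuD(1)[OF A] is_chuD(2)[OF B]
    by (intro pairing_bil_mapsI) auto
qed

text \<open>If all values <f v, w> vanish, then f = 0 by nondegeneracy of B, and <f v, w> = <v, g w>
  gives g = 0 by nondegeneracy of A. The required rank one elements are v \<mapsto> <v, y> x with
  adjoint w \<mapsto> <x, w> y.\<close>

lemma is_chu_chu_ihom:
  fixes A :: "('k::{real_normed_field,euclidean_space}, 'v::ab_group_add, 'w::ab_group_add) chu"
    and B :: "('k, 'v2::ab_group_add, 'w2::ab_group_add) chu"
  assumes A: "is_chu A" and B: "is_chu B"
  shows "is_chu (chu_ihom A B)"
  unfolding chu_ihom_eq_tensor_pair
proof (rule is_chu_tensor_pair[OF is_vspace_chu_hom_space[OF A B] dual_pair_functionals_of[OF A]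
      dual_pair_functionals_of[OF is_chu_chu_dual[OF B], simplified] chu_ihom_bilinear[OF A B]])
  interpret LB: vspace_on "lft B" using is_chuD(1)[OF B] by unfold_locales
  interpret RA: vspace_on "rgt A" using is_chuD(2)[OF A] by unfold_locales
  note DA = pairingD[OF is_chuD(3)[OF A]] and DB = pairingD[OF is_chuD(3)[OF B]]
  have homD: "fst l \<in> lin_maps (lft A) (lft B)" "snd l \<in> lin_maps (rgt B) (rgt A)"
    "v \<in> car (lft A) \<Longrightarrow> w \<in> car (rgt B) \<Longrightarrow> pairing B (fst l v) w = pairing A v (snd l w)"
    if "l \<in> car (chu_hom_space A B)" for l v w
    using that by (auto simp: chu_hom_space_def chu_hom_def)
  show "pairing B (fst (l + l') v) w = pairing B (fst l v) w + pairing B (fst l' v) w"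
    if "l \<in> car (chu_hom_space A B)" "l' \<in> car (chu_hom_space A B)" "v \<in> car (lft A)" for l l' v w
    using DB(1) lin_mapsD(1)[OF homD(1)] that by simp
  show "pairing B (fst (scl (chu_hom_space A B) c l) v) w = c * pairing B (fst l v) w"
    if "l \<in> car (chu_hom_space A B)" "v \<in> car (lft A)" for c l v w
    using DB(2) lin_mapsD(1)[OF homD(1)] that by (simp add: chu_hom_space_def case_prod_beta')
  show "l = 0" if l: "l \<in> car (chu_hom_space A B)"
    and zero: "\<And>v w. v \<in> car (lft A) \<Longrightarrow> w \<in> car (rgt B) \<Longrightarrow> pairing B (fst l v) w = 0" for l
  proof -
    have "fst l v = 0" for v
      using is_chuD(4)[OF B, of "fst l v"] zero[of v] lin_mapsD(1,4)[OF homD(1)[OF l], of v]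
      by (cases "v \<in> car (lft A)") auto
    moreover have "snd l w = 0" for w
      using is_chuD(5)[OF A, of "snd l w"] zero[of _ w] homD(3)[OF l, of _ w] lin_mapsD(1,4)[OF homD(2)[OF l], of w]
      by (cases "w \<in> car (rgt B)") auto
    ultimately show ?thesis by (simp add: prod_eq_iff fun_eq_iff)
  qed
  fix a c assume "a \<in> functionals_of A" "c \<in> functionals_of (chu_dual B)"
  then obtain y x where y: "y \<in> car (rgt A)" "a = (\<lambda>v. pairing A v y)"
    and x: "x \<in> car (lft B)" "c = pairing B x"
    by (auto simp: functionals_of_def)
  define f where "f v = scl (lft B) (pairing A v y) x" for v
  define g where "g w = scl (rgt A) (pairing B x w) y" for w
  have "f \<in> lin_maps (lft A) (lft B)"
    using DA x by (intro lin_mapsI) (auto simp: f_def LB.scale_left_distrib)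
  moreover have "g \<in> lin_maps (rgt B) (rgt A)"
    using DB(3,4)[OF x(1)] DB(6) y by (intro lin_mapsI) (auto simp: g_def RA.scale_left_distrib)
  ultimately have "(f, g) \<in> car (chu_hom_space A B)"
    using DA(4) DB(2) x(1) y(1) by (simp add: chu_hom_space_def chu_hom_def f_def g_def)
  then show "\<exists>l\<in>car (chu_hom_space A B). \<forall>v\<in>car (lft A). \<forall>w\<in>car (rgt B). pairing B (fst l v) w = a v * c w"
    using DB(2)[OF x(1)] x(2) y(2) by (intro bexI[of _ "(f, g)"]) (auto simp: f_def)
qed

section \<open>Operators between spaces of the same kind\<close>

definition operator_chu where
  "operator_chu X Y = tensor_pair (cont_lin X Y) (und X) (top_dual Y) (\<lambda>f x w. w (f x))"

context
  fixes m and X :: "('k::{real_normed_field,euclidean_space}, 'v::ab_group_add) tvs"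
    and Y :: "('k, 'w::ab_group_add) tvs"
  assumes X: "is_TVS_of m X" and Y: "is_TVS_of m Y"
begin

interpretation VX: dual_pair "und X" "car (top_dual X)" using is_TVS_ofD(1)[OF X] by (rule dual_pair_top_dual)
interpretation VY: dual_pair "und Y" "car (top_dual Y)" using is_TVS_ofD(1)[OF Y] by (rule dual_pair_top_dual)

lemma scl_cont_lin: "scl (cont_lin X Y) = (\<lambda>c f x. scl (und Y) c (f x))"
  by (simp add: cont_lin_def)

lemma top_dualD:
  assumes "w \<in> car (top_dual Y)"
  shows "y \<in> car (und Y) \<Longrightarrow> y' \<in> car (und Y) \<Longrightarrow> w (y + y') = w y + w y'"
    "y \<in> car (und Y) \<Longrightarrow> w (scl (und Y) c y) = c * w y" "w 0 = 0"
  using assms VY.functionals alg_dualD(1,2)[of w "und Y"] lin_maps_zero[of w "und Y" ground]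
  by (auto simp: alg_dual_as_lin_maps)

lemma cont_lin_mem: "f \<in> car (cont_lin X Y) \<Longrightarrow> x \<in> car (und X) \<Longrightarrow> f x \<in> car (und Y)"
  by (auto simp: cont_lin_iff dest: lin_mapsD(1))

text \<open>The transpose criterion reduces closure under sums and multiples to the corresponding
  closure of the dual of X.\<close>

lemma is_vspace_cont_lin: "is_vspace (cont_lin X Y)"
proof -
  note iff = cont_lin_iff_transpose[OF X Y]
  have "0 \<in> car (cont_lin X Y)"
    unfolding iff using VX.functional_ex VX.functional_scale[of _ 0] by (auto simp: lin_maps_def top_dualD)
  moreover have "f + g \<in> car (cont_lin X Y)" if "f \<in> car (cont_lin X Y)" "g \<in> car (cont_lin X Y)" for f g
  proof -
    have f: "f \<in> lin_maps (und X) (und Y)" and g: "g \<in> lin_maps (und X) (und Y)"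
      using that by (auto simp: iff)
    have "(\<lambda>x. w ((f + g) x)) = (\<lambda>x. w (f x) + w (g x))" if w: "w \<in> car (top_dual Y)" for w
    proof
      show "w ((f + g) x) = w (f x) + w (g x)" for x
        using lin_mapsD(1,4)[OF f, of x] lin_mapsD(1,4)[OF g, of x] top_dualD[OF w]
        by (cases "x \<in> car (und X)") auto
    qed
    moreover have "f + g \<in> lin_maps (und X) (und Y)"
      using lin_mapsD[OF f] lin_mapsD[OF g] by (intro lin_mapsI) (auto simp: VY.scale_right_distrib)
    ultimately show ?thesis using that VX.functional_add by (auto simp: iff)
  qed
  moreover have "(\<lambda>x. scl (und Y) c (f x)) \<in> car (cont_lin X Y)" if "f \<in> car (cont_lin X Y)" for c f
  proof -
    have f: "f \<in> lin_maps (und X) (und Y)" using that by (auto simp: iff)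
    have "(\<lambda>x. w (scl (und Y) c (f x))) = (\<lambda>x. c * w (f x))" if w: "w \<in> car (top_dual Y)" for w
    proof
      show "w (scl (und Y) c (f x)) = c * w (f x)" for x
        using lin_mapsD(1,4)[OF f, of x] top_dualD[OF w] by (cases "x \<in> car (und X)") auto
    qed
    moreover have "(\<lambda>x. scl (und Y) c (f x)) \<in> lin_maps (und X) (und Y)"
      using lin_mapsD[OF f] by (intro lin_mapsI) (auto simp: VY.scale_right_distrib mult.commute)
    ultimately show ?thesis using that VX.functional_scale by (auto simp: iff)
  qed
  ultimately have "is_vspace \<lparr>car = car (cont_lin X Y), scl = \<lambda>c f x. scl (und Y) c (f x)\<rparr>"
    by (intro is_vspace_function_space VY.is_vspace)
  then show ?thesis by (simp add: cont_lin_def)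
qed

lemma operator_bilinear:
  assumes f: "f \<in> car (cont_lin X Y)"
  shows "on_carriers (und X) (top_dual Y) (\<lambda>x w. w (f x)) \<in> bil_maps (und X) (top_dual Y) ground"
proof -
  have "f \<in> lin_maps (und X) (und Y)" using f by (simp add: cont_lin_iff)
  note fD = lin_mapsD[OF this]
  show ?thesis
    by (rule pairing_bil_mapsI)
      (use fD top_dualD VX.is_vspace is_vspace_top_dual[OF is_TVS_ofD(1)[OF Y]] in auto)
qed

text \<open>The maps x \<mapsto> a(x) y with a in the dual of X are continuous, because composing
  with w gives w(y) times a; they serve as the rank one elements.\<close>

lemma is_chu_operator_chu: "is_chu (operator_chu X Y)"
  unfolding operator_chu_def
proof (rule is_chu_tensor_pair[OF is_vspace_cont_lin VX.dual_pair_axioms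
      dual_pair_functionals_of[OF is_chu_chu_dual[OF is_chu_chu_of[OF is_TVS_ofD(1)[OF Y]]], simplified]
      operator_bilinear])
  show "f = 0" if f: "f \<in> car (cont_lin X Y)"
    and zero: "\<And>x w. x \<in> car (und X) \<Longrightarrow> w \<in> car (top_dual Y) \<Longrightarrow> w (f x) = 0" for f
  proof
    have lin: "f \<in> lin_maps (und X) (und Y)" using f by (simp add: cont_lin_iff)
    show "f x = 0 x" for x
      using VY.separating[of "f x"] zero[of x] lin_mapsD(1,4)[OF lin, of x] by (cases "x \<in> car (und X)") auto
  qed
  fix a c assume a: "a \<in> car (top_dual X)" and "c \<in> functionals_of (chu_dual (chu_of Y))"
  then obtain y where y: "y \<in> car (und Y)" and c: "c = pairing (chu_of Y) y" by (auto simp: functionals_of_def)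
  have aD: "a \<in> car (alg_dual (und X))" using a VX.functionals by blast
  define f where "f x = scl (und Y) (a x) y" for x
  have "f \<in> lin_maps (und X) (und Y)"
    using alg_dualD[OF aD] y by (intro lin_mapsI) (auto simp: f_def VY.scale_left_distrib)
  moreover have "(\<lambda>x. w (f x)) \<in> car (top_dual X)" if "w \<in> car (top_dual Y)" for w
    using VX.functional_scale[OF a, of "w y"] top_dualD(2)[OF that y] by (simp add: f_def mult.commute)
  ultimately have "f \<in> car (cont_lin X Y)" by (simp add: cont_lin_iff_transpose[OF X Y])
  moreover have "w (f x) = a x * c w" if "w \<in> car (top_dual Y)" for x w
    using top_dualD(2)[OF that y] pairing_chu_of[OF y that] by (simp add: f_def c)
  ultimately show "\<exists>f\<in>car (cont_lin X Y). \<forall>x\<in>car (und X). \<forall>w\<in>car (top_dual Y). w (f x) = a x * c w" by blast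
qed (use top_dualD cont_lin_mem in \<open>auto simp: scl_cont_lin\<close>)

text \<open>The second component is forced to be the transpose of the first, and the transpose maps
  into the dual of X exactly when the first component is continuous.\<close>

lemma chu_hom_chu_of_iff:
  "(f, g) \<in> chu_hom (chu_of X) (chu_of Y) \<longleftrightarrow>
     f \<in> car (cont_lin X Y) \<and> g = (\<lambda>w. if w \<in> car (top_dual Y) then \<lambda>x. w (f x) else 0)"
proof safe
  assume "(f, g) \<in> chu_hom (chu_of X) (chu_of Y)"
  then have f: "f \<in> lin_maps (und X) (und Y)" and g: "g \<in> lin_maps (top_dual Y) (top_dual X)"
    and fg: "\<And>x w. x \<in> car (und X) \<Longrightarrow> w \<in> car (top_dual Y) \<Longrightarrow>
      pairing (chu_of Y) (f x) w = pairing (chu_of X) x (g w)"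
    by (auto simp: chu_hom_def)
  have gw: "g w = (\<lambda>x. w (f x))" if w: "w \<in> car (top_dual Y)" for w
  proof
    have gX: "g w \<in> car (top_dual X)" using lin_mapsD(1)[OF g w] .
    show "g w x = w (f x)" for x
    proof (cases "x \<in> car (und X)")
      case True
      then show ?thesis
        using fg[OF True w] pairing_chu_of[OF lin_mapsD(1)[OF f True] w] pairing_chu_of[OF True gX] by simp
    next
      case False
      then show ?thesis using alg_dualD(3)[OF subsetD[OF VX.functionals gX] False] lin_mapsD(4)[OF f False] top_dualD(3)[OF w] by simp
    qed
  qed
  then show "f \<in> car (cont_lin X Y)"
    using f lin_mapsD(1)[OF g] by (auto simp: cont_lin_iff_transpose[OF X Y])
  show "g = (\<lambda>w. if w \<in> car (top_dual Y) then \<lambda>x. w (f x) else 0)"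
    using gw lin_mapsD(4)[OF g] by (auto simp: fun_eq_iff)
next
  assume f: "f \<in> car (cont_lin X Y)"
  let ?g = "\<lambda>w. if w \<in> car (top_dual Y) then \<lambda>x. w (f x) else 0"
  interpret D: vspace_on "top_dual Y" using is_vspace_top_dual[OF is_TVS_ofD(1)[OF Y]] by unfold_locales
  have fY: "f \<in> lin_maps (und X) (und Y)" and tr: "\<And>w. w \<in> car (top_dual Y) \<Longrightarrow> (\<lambda>x. w (f x)) \<in> car (top_dual X)"
    using f by (auto simp: cont_lin_iff_transpose[OF X Y])
  have "?g \<in> lin_maps (top_dual Y) (top_dual X)"
  proof (rule lin_mapsI)
    show "?g (scl (top_dual Y) c w) = scl (top_dual X) c (?g w)" if "w \<in> car (top_dual Y)" for c w
      using that D.car_closed(3)[OF that, of c] by simp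
  qed (use tr in \<open>auto simp: fun_eq_iff\<close>)
  then show "(f, ?g) \<in> chu_hom (chu_of X) (chu_of Y)"
    using fY tr by (auto simp: chu_hom_def pairing_chu_of lin_mapsD)
qed

end

section \<open>The isomorphism with the space of operators\<close>

lemma tvs_iso_space_ofI:
  fixes A :: "('k::{real_normed_field,euclidean_space}, 'v::ab_group_add, 'w::ab_group_add) chu"
    and B :: "('k, 'v2::ab_group_add, 'w2::ab_group_add) chu"
  assumes A: "is_chu A" and B: "is_chu B"
    and "f \<in> lin_maps (lft A) (lft B)" "g \<in> lin_maps (lft B) (lft A)"
    and "\<And>x. x \<in> car (lft A) \<Longrightarrow> g (f x) = x" "\<And>y. y \<in> car (lft B) \<Longrightarrow> f (g y) = y"
    and "\<And>h. h \<in> functionals_of B \<Longrightarrow> (\<lambda>x. h (f x)) \<in> functionals_of A"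
    and "\<And>h. h \<in> functionals_of A \<Longrightarrow> (\<lambda>y. h (g y)) \<in> functionals_of B"
  shows "tvs_iso (space_of m A) (space_of m B)"
proof -
  have "f \<in> car (cont_lin (space_of m A) (space_of m B))"
    using assms
    by (simp add: cont_lin_iff_transpose[OF is_TVS_of_space_of[OF A] is_TVS_of_space_of[OF B]] top_dual_space_of)
  moreover have "g \<in> car (cont_lin (space_of m B) (space_of m A))"
    using assms
    by (simp add: cont_lin_iff_transpose[OF is_TVS_of_space_of[OF B] is_TVS_of_space_of[OF A]] top_dual_space_of)
  ultimately show ?thesis unfolding tvs_iso_def using assms(5,6) by auto
qed

text \<open>The case of use has the bidual of Y as Z. Composition with e and g matches the elements,
  and on the tensor side x \<otimes> w corresponds to x \<otimes> (w o g) in one direction and to x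
  \<otimes> (w o e) in the other.\<close>

lemma tvs_iso_ihom_operators:
  fixes X :: "('k::{real_normed_field,euclidean_space}, 'v::ab_group_add) tvs"
    and Y :: "('k, 'w::ab_group_add) tvs" and Z :: "('k, 'z::ab_group_add) tvs"
  assumes X: "is_TVS_of m X" and Y: "is_TVS_of m Y" and Z: "is_TVS_of m Z"
    and e: "e \<in> car (cont_lin Y Z)" and g: "g \<in> car (cont_lin Z Y)"
    and ge: "\<And>y. y \<in> car (und Y) \<Longrightarrow> g (e y) = y" and eg: "\<And>z. z \<in> car (und Z) \<Longrightarrow> e (g z) = z"
  shows "tvs_iso (space_of m (chu_ihom (chu_of X) (chu_of Z))) (space_of m (operator_chu X Y))"
proof -
  let ?H = "chu_hom_space (chu_of X) (chu_of Z)" and ?L = "cont_lin X Y"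
  have CX: "is_chu (chu_of X)" and CZ: "is_chu (chu_of Z)" using is_chu_chu_of is_TVS_ofD(1) X Z by auto
  have eD: "e \<in> lin_maps (und Y) (und Z)" and gD: "g \<in> lin_maps (und Z) (und Y)"
    using e g by (auto simp: cont_lin_iff)
  note eg_simps = lin_mapsD[OF eD] lin_mapsD[OF gD] lin_maps_zero[OF eD] lin_maps_zero[OF gD]
  interpret UY: dual_pair "und Y" "car (top_dual Y)" using is_TVS_ofD(1)[OF Y] by (rule dual_pair_top_dual)
  interpret UZ: dual_pair "und Z" "car (top_dual Z)" using is_TVS_ofD(1)[OF Z] by (rule dual_pair_top_dual)
  interpret H: vspace_on ?H using is_vspace_chu_hom_space[OF CX CZ] by unfold_locales
  interpret L: vspace_on ?L using is_vspace_cont_lin[OF X Y] by unfold_locales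
  have scl_H: "fst (scl ?H c l) = (\<lambda>x. scl (und Z) c (fst l x))" for c l
    by (simp add: chu_hom_space_def case_prod_beta')
  have scl_L: "scl ?L c f = (\<lambda>x. scl (und Y) c (f x))" for c f
    by (simp add: cont_lin_def)
  have H_iff: "l \<in> car ?H \<longleftrightarrow> fst l \<in> car (cont_lin X Z) \<and>
      snd l = (\<lambda>w. if w \<in> car (top_dual Z) then \<lambda>x. w (fst l x) else 0)" for l
    using chu_hom_chu_of_iff[OF X Z, of "fst l" "snd l"] by (simp add: chu_hom_space_def)
  \<comment> \<open>A morphism is determined by its first component, so equalities in the internal
    hom are checked there only.\<close>
  have H_eqI: "l = l'" if "l \<in> car ?H" "l' \<in> car ?H" "fst l = fst l'" for l l'
    using that(1,2) H_iff[of l] H_iff[of l'] unfolding that(3) by (simp add: prod_eq_iff that(3))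
  have H_lin: "fst l \<in> lin_maps (und X) (und Z)" if "l \<in> car ?H" for l
    using that H_iff by (simp add: cont_lin_iff)
  have L_lin: "f \<in> lin_maps (und X) (und Y)" if "f \<in> car ?L" for f
    using that by (simp add: cont_lin_iff)
  define \<phi> where "\<phi> l = (if l \<in> car ?H then \<lambda>x. g (fst l x) else 0)" for l
  \<comment> \<open>The second component has no freedom: by \<open>H_iff\<close> it must be the
    transpose of e o f.\<close>
  define \<psi> where "\<psi> f = (if f \<in> car ?L then (\<lambda>x. e (f x),
      \<lambda>w. if w \<in> car (top_dual Z) then \<lambda>x. w (e (f x)) else 0) else 0)" for f
  have \<phi>_mem: "\<phi> l \<in> car ?L" if "l \<in> car ?H" for l
    using that cont_lin_compose[OF _ g, of "fst l" X] by (simp add: \<phi>_def H_iff)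
  have \<psi>_mem: "\<psi> f \<in> car ?H" if "f \<in> car ?L" for f
    using that cont_lin_compose[OF that e] by (simp add: \<psi>_def H_iff cong: if_cong)
  have \<phi>: "\<phi> \<in> lin_maps ?H ?L"
  proof (rule lin_mapsI)
    fix l assume l: "l \<in> car ?H"
    show "\<phi> l \<in> car ?L" using \<phi>_mem[OF l] .
    show "\<phi> (scl ?H c l) = scl ?L c (\<phi> l)" for c
    proof
      show "\<phi> (scl ?H c l) x = scl ?L c (\<phi> l) x" for x
        using l H.car_closed(3)[OF l, of c] lin_mapsD(1,4)[OF H_lin[OF l], of x] eg_simps
        by (cases "x \<in> car (und X)") (auto simp: \<phi>_def scl_H scl_L)
    qed
    fix l' assume l': "l' \<in> car ?H"
    show "\<phi> (l + l') = \<phi> l + \<phi> l'"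
    proof
      show "\<phi> (l + l') x = (\<phi> l + \<phi> l') x" for x
        using l l' lin_mapsD(1,4)[OF H_lin[OF l], of x] lin_mapsD(1,4)[OF H_lin[OF l'], of x] eg_simps
        by (cases "x \<in> car (und X)") (auto simp: \<phi>_def)
    qed
  qed (simp add: \<phi>_def)
  have \<psi>: "\<psi> \<in> lin_maps ?L ?H"
  proof (rule lin_mapsI)
    fix f assume f: "f \<in> car ?L"
    show "\<psi> f \<in> car ?H" using \<psi>_mem[OF f] .
    show "\<psi> (scl ?L c f) = scl ?H c (\<psi> f)" for c
    proof (rule H_eqI)
      show "fst (\<psi> (scl ?L c f)) = fst (scl ?H c (\<psi> f))"
      proof
        show "fst (\<psi> (scl ?L c f)) x = fst (scl ?H c (\<psi> f)) x" for x
          using f L.car_closed(3)[OF f, of c] lin_mapsD(1,4)[OF L_lin[OF f], of x] eg_simps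
          by (cases "x \<in> car (und X)") (auto simp: \<psi>_def scl_H scl_L)
      qed
    qed (use f \<psi>_mem in auto)
    fix f' assume f': "f' \<in> car ?L"
    show "\<psi> (f + f') = \<psi> f + \<psi> f'"
    proof (rule H_eqI)
      show "fst (\<psi> (f + f')) = fst (\<psi> f + \<psi> f')"
      proof
        show "fst (\<psi> (f + f')) x = fst (\<psi> f + \<psi> f') x" for x
          using f f' lin_mapsD(1,4)[OF L_lin[OF f], of x] lin_mapsD(1,4)[OF L_lin[OF f'], of x] eg_simps
          by (cases "x \<in> car (und X)") (auto simp: \<psi>_def)
      qed
    qed (use f f' \<psi>_mem in auto)
  qed (simp add: \<psi>_def)
  have \<psi>\<phi>: "\<psi> (\<phi> l) = l" if l: "l \<in> car ?H" for l
  proof (rule H_eqI)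
    show "fst (\<psi> (\<phi> l)) = fst l"
    proof
      show "fst (\<psi> (\<phi> l)) x = fst l x" for x
        using l \<phi>_mem[OF l] lin_mapsD(1,4)[OF H_lin[OF l], of x] eg eg_simps
        by (cases "x \<in> car (und X)") (auto simp: \<psi>_def, auto simp: \<phi>_def)
    qed
  qed (use l \<phi>_mem \<psi>_mem in auto)
  have \<phi>\<psi>: "\<phi> (\<psi> f) = f" if f: "f \<in> car ?L" for f
  proof
    show "\<phi> (\<psi> f) x = f x" for x
      using f \<psi>_mem[OF f] lin_mapsD(1,4)[OF L_lin[OF f], of x] ge eg_simps
      by (cases "x \<in> car (und X)") (auto simp: \<phi>_def, auto simp: \<psi>_def)
  qed
  have CH: "is_chu (chu_ihom (chu_of X) (chu_of Z))" using is_chu_chu_ihom[OF CX CZ] .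
  have CO: "is_chu (operator_chu X Y)" using is_chu_operator_chu[OF X Y] .
  note bilH = chu_ihom_bilinear[OF CX CZ, simplified chu_of_sel] and bilL = operator_bilinear[OF X Y]
  show ?thesis
  proof (rule tvs_iso_space_ofI[OF CH CO])
    show "\<phi> \<in> lin_maps (lft (chu_ihom (chu_of X) (chu_of Z))) (lft (operator_chu X Y))"
      "\<psi> \<in> lin_maps (lft (operator_chu X Y)) (lft (chu_ihom (chu_of X) (chu_of Z)))"
      using \<phi> \<psi> by (simp_all add: chu_ihom_def operator_chu_def)
    show "\<psi> (\<phi> l) = l" if "l \<in> car (lft (chu_ihom (chu_of X) (chu_of Z)))" for l
      using that \<psi>\<phi> by (simp add: chu_ihom_def)
    show "\<phi> (\<psi> f) = f" if "f \<in> car (lft (operator_chu X Y))" for f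
      using that \<phi>\<psi> by (simp add: operator_chu_def)
    show "(\<lambda>l. h (\<phi> l)) \<in> functionals_of (chu_ihom (chu_of X) (chu_of Z))"
      if "h \<in> functionals_of (operator_chu X Y)" for h
      using that unfolding chu_ihom_eq_tensor_pair operator_chu_def chu_of_sel
    proof (rule functionals_of_tensor_pair_pullback[OF \<phi> CO[unfolded operator_chu_def] bilH bilL, rotated -1])
      fix x w assume x: "x \<in> car (und X)" and w: "w \<in> car (top_dual Y)"
      have "(\<lambda>z. w (g z)) \<in> car (top_dual Z)" using cont_lin_compose[OF g w] .
      then show "\<exists>x'\<in>car (und X). \<exists>w'\<in>car (top_dual Z). \<forall>l\<in>car ?H.
          w (\<phi> l x) = pairing (chu_of Z) (fst l x') w'"
        using x lin_mapsD(1)[OF H_lin x]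
        by (intro bexI[of _ x] bexI[of _ "\<lambda>z. w (g z)"]) (auto simp: \<phi>_def pairing_chu_of)
    qed auto
    show "(\<lambda>f. h (\<psi> f)) \<in> functionals_of (operator_chu X Y)"
      if "h \<in> functionals_of (chu_ihom (chu_of X) (chu_of Z))" for h
      using that unfolding chu_ihom_eq_tensor_pair operator_chu_def chu_of_sel
    proof (rule functionals_of_tensor_pair_pullback[OF \<psi> CH[unfolded chu_ihom_eq_tensor_pair chu_of_sel] bilL bilH, rotated -1])
      fix x w assume x: "x \<in> car (und X)" and w: "w \<in> car (top_dual Z)"
      have "(\<lambda>z. w (e z)) \<in> car (top_dual Y)" using cont_lin_compose[OF e w] .
      then show "\<exists>x'\<in>car (und X). \<exists>w'\<in>car (top_dual Y). \<forall>f\<in>car ?L.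
          pairing (chu_of Z) (fst (\<psi> f) x) w = w' (f x')"
        using x w lin_mapsD(1)[OF L_lin x] eg_simps(1)
        by (intro bexI[of _ x] bexI[of _ "\<lambda>z. w (e z)"]) (auto simp: \<psi>_def pairing_chu_of)
    qed auto
  qed
qed

text \<open>Biduality is used twice: on the internal hom, to remove the two outer dualities in T,
  and on V, to replace the codomain \<open>D_of m (D_of m V)\<close> by V.\<close>

theorem tensor2_operators:
  fixes V :: "('k::{real_normed_field,euclidean_space}, 'v::ab_group_add) tvs"
    and W :: "('k, 'w::ab_group_add) tvs"
  assumes V: "is_TVS_of m V" and W: "is_TVS_of m W"
  defines "T \<equiv> D_of m (D_of m (space_of m (chu_ihom (chu_of (D_of m W)) (chu_of (D_of m (D_of m V))))))"
  shows "is_TVS_of m T" "is_TVS_of m (space_of m (operator_chu (D_of m W) V))"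
    "tvs_iso T (space_of m (operator_chu (D_of m W) V))"
proof -
  have DW: "is_TVS_of m (D_of m W)" using is_TVS_of_D_of[OF is_TVS_ofD(1)[OF W]] .
  have DV: "is_TVS_of m (D_of m V)" using is_TVS_of_D_of[OF is_TVS_ofD(1)[OF V]] .
  have DDV: "is_TVS_of m (D_of m (D_of m V))" using is_TVS_of_D_of[OF is_TVS_ofD(1)[OF DV]] .
  let ?H = "space_of m (chu_ihom (chu_of (D_of m W)) (chu_of (D_of m (D_of m V))))"
  have H: "is_TVS_of m ?H"
    using DW DDV by (intro is_TVS_of_space_of is_chu_chu_ihom is_chu_chu_of is_TVS_ofD(1))
  have DH: "is_TVS_of m (D_of m ?H)" using is_TVS_of_D_of[OF is_TVS_ofD(1)[OF H]] .
  show "is_TVS_of m T" unfolding T_def using is_TVS_of_D_of[OF is_TVS_ofD(1)[OF DH]] .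
  show "is_TVS_of m (space_of m (operator_chu (D_of m W) V))"
    using is_TVS_of_space_of[OF is_chu_operator_chu[OF DW V]] .
  have "tvs_iso ?H T"
    using biduality[OF H] unfolding T_def tvs_iso_def by metis
  moreover have "tvs_iso ?H (space_of m (operator_chu (D_of m W) V))"
    using biduality[OF V] tvs_iso_ihom_operators[OF DW V DDV] by metis
  ultimately show "tvs_iso T (space_of m (operator_chu (D_of m W) V))"
    using tvs_iso_trans tvs_iso_sym by blast
qed

section \<open>Translation into the given definitions\<close>

lemma eval_dual_eq: "eval_dual W = chu_dual (chu_of W)"
  by (auto simp: eval_dual_def chu_dual_def chu_of_def on_carriers_def fun_eq_iff)

text \<open>Meant for X the weak or Mackey dual of W, whose underlying space is the dual of
  W.\<close>

lemma operator_pair_eq: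
  "und X = top_dual W \<Longrightarrow> operator_pair (cont_lin X V) W V = operator_chu X V"
  by (simp add: operator_pair_def operator_chu_def tensor_pair_def)

lemma weak_space_eq: "weak_space A = space_of False A" and mackey_space_eq: "mackey_space A = space_of True A"
  by (simp_all add: weak_space_def mackey_space_def space_of_def top_of_def)

lemma dual_sigma_eq: "dual_sigma W = D_of False W" and dual_tau_eq: "dual_tau W = D_of True W"
  by (simp_all add: dual_sigma_def dual_tau_def D_of_def space_of_def top_of_def eval_dual_eq)

lemma L_sigma_eq: "L_sigma W V = space_of False (operator_chu (D_of False W) V)"
  by (simp add: L_sigma_def dual_sigma_eq operator_pair_eq space_of_def top_of_def)
    (simp add: operator_chu_def)

lemma L_tau_eq: "L_tau W V = space_of True (operator_chu (D_of True W) V)"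
  by (simp add: L_tau_def dual_tau_eq operator_pair_eq space_of_def top_of_def)
    (simp add: operator_chu_def)

lemma is_TVSw_eq: "is_TVSw X \<longleftrightarrow> is_TVS_of False X" and is_TVSm_eq: "is_TVSm X \<longleftrightarrow> is_TVS_of True X"
  by (simp_all add: is_TVSw_def is_TVSm_def is_TVS_of_def top_of_def)

lemma D_w_eq: "D_w X = D_of False X" and D_m_eq: "D_m X = D_of True X"
  by (simp_all add: D_w_def D_m_def D_of_def weak_space_eq mackey_space_eq)

lemma tensor2_w_iso:
  fixes V :: "('k::{real_normed_field,euclidean_space}, 'v::ab_group_add) tvs"
    and W :: "('k, 'w::ab_group_add) tvs"
  assumes "is_TVSw V" "is_TVSw W"
  shows "V \<otimes>\<^sup>2\<^sub>w W \<cong>\<^sub>w L_sigma W V"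
  using tensor2_operators[of False V W] assms
  by (simp add: iso_w_def is_TVSw_eq L_sigma_eq tensor2_w_def tensor1_w_def hom_w_def D_w_eq weak_space_eq)

lemma tensor2_m_iso:
  fixes V :: "('k::{real_normed_field,euclidean_space}, 'v::ab_group_add) tvs"
    and W :: "('k, 'w::ab_group_add) tvs"
  assumes "is_TVSm V" "is_TVSm W"
  shows "V \<otimes>\<^sup>2\<^sub>m W \<cong>\<^sub>m L_tau W V"
  using tensor2_operators[of True V W] assms
  by (simp add: iso_m_def is_TVSm_eq L_tau_eq tensor2_m_def tensor1_m_def hom_m_def D_m_eq mackey_space_eq)

text \<open>Real and complex scalars are different types, so each isomorphism appears once for each
  field; both types are Euclidean spaces with multiplicative norm.\<close>

theorem lemma4p3p6:
  fixes V :: "(real, 'v::ab_group_add) tvs" and W :: "(real, 'w::ab_group_add) tvs"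
    and X :: "(complex, 'x::ab_group_add) tvs" and Y :: "(complex, 'y::ab_group_add) tvs"
  shows "(is_TVSw V \<and> is_TVSw W \<longrightarrow> V \<otimes>\<^sup>2\<^sub>w W \<cong>\<^sub>w L_sigma W V) \<and>
         (is_TVSm V \<and> is_TVSm W \<longrightarrow> V \<otimes>\<^sup>2\<^sub>m W \<cong>\<^sub>m L_tau W V) \<and>
         (is_TVSw X \<and> is_TVSw Y \<longrightarrow> X \<otimes>\<^sup>2\<^sub>w Y \<cong>\<^sub>w L_sigma Y X) \<and>
         (is_TVSm X \<and> is_TVSm Y \<longrightarrow> X \<otimes>\<^sup>2\<^sub>m Y \<cong>\<^sub>m L_tau Y X)"
  by (auto intro: tensor2_w_iso tensor2_m_iso)

end
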